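(* Let $d\ge 1$ be an integer, let $\delta>d/2$ and $0\le s\le\delta$. There is a constant $C>0$, independent of $h$, $f$ and $g$, such that for all $h>0$ and all $f,g\in H^\delta(h\mathbb{Z}^d)$, $$\|\mathcal{S}_h(fg)-(\mathcal{S}_hf)(\mathcal{S}_hg)\|_{H^s(\mathbb{R}^d)}\le C\,h^{\delta-s}\,\|\mathcal{S}_hf\|_{H^\delta(\mathbb{R}^d)}\,\|\mathcal{S}_hg\|_{H^\delta(\mathbb{R}^d)} .$$
   Context: $L^2(h\mathbb{Z}^d)$ has norm $\|g\|_{L^2(h\mathbb{Z}^d)}^2=h^d\sum_{a\in h\mathbb{Z}^d}|g(a)|^2$. The discrete Fourier transform of $g\in L^2(h\mathbb{Z}^d)$ is $\widehat g(\xi)=h^d\sum_{a\in h\mathbb{Z}^d}g(a)e^{-ia\cdot\xi}$ for $\xi\in\mathbb{T}_h^d=\mathbb{R}^d/(\frac{2\pi}{h}\mathbb{Z}^d)$, identified with $[-\pi/h,\pi/h]^d$. For $s\in\mathbb{R}$, $\|g\|_{H^s(h\mathbb{Z}^d)}^2=(2\pi)^{-d}\int_{\mathbb{T}_h^d}\big(1+\frac{4}{h^2}\sum_{j=1}^d\sin^2(\frac{h\xi_j}{2})\big)^s|\widehat g(\xi)|^2\,d\xi$. The Fourier transform on $\mathbb{R}^d$ is $\mathcal{F}f(\xi)=\int_{\mathbb{R}^d}f(x)e^{-ix\cdot\xi}\,dx$, and $\|f\|_{H^s(\mathbb{R}^d)}^2=(2\pi)^{-d}\int_{\mathbb{R}^d}(1+|\xi|^2)^s|\mathcal{F}f(\xi)|^2\,d\xi$.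 The Shannon interpolation $\mathcal{S}_h:L^2(h\mathbb{Z}^d)\to L^2(\mathbb{R}^d)$ is $\mathcal{S}_hg=\mathcal{F}^{-1}(\mathbf{1}_{\mathbb{T}_h^d}\widehat g)$. The product $fg$ is the pointwise product on $h\mathbb{Z}^d$. *)

theory Defs
  imports "HOL-Analysis.Analysis"
begin

section \<open>Square-integrable functions and convergence in mean square\<close>

definition L2_space :: "'a measure \<Rightarrow> ('a \<Rightarrow> complex) set" where
  "L2_space M = {f \<in> borel_measurable M. integrable M (\<lambda>x. (norm (f x))\<^sup>2)}"

definition tendsto_L2 ::
    "'a measure \<Rightarrow> ('i \<Rightarrow> 'a \<Rightarrow> complex) \<Rightarrow> ('a \<Rightarrow> complex) \<Rightarrow> 'i filter \<Rightarrow> bool" where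
  "tendsto_L2 M u f F \<longleftrightarrow>
     ((\<lambda>i. \<integral>\<^sup>+x. ennreal ((norm (u i x - f x))\<^sup>2) \<partial>M) \<longlongrightarrow> 0) F"


section \<open>Fourier transform and Sobolev spaces on Euclidean space\<close>

text \<open>
  An element of \<open>L\<^sup>2\<close> need not be integrable, so its Fourier integral is taken as the limit in
  \<open>L\<^sup>2\<close> of the integrals over balls. It is determined up to a null set; for functions that are
  also integrable it agrees almost everywhere with the absolutely convergent integral.
\<close>

definition fourier :: "(real ^ 'n \<Rightarrow> complex) \<Rightarrow> real ^ 'n \<Rightarrow> complex" where
  "fourier f = (SOME F. F \<in> L2_space lborel \<and>
     tendsto_L2 lborel (\<lambda>R \<xi>. LINT x:cball 0 R|lborel. f x * cis (- (x \<bullet> \<xi>))) F at_top)"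

definition inv_fourier :: "(real ^ 'n \<Rightarrow> complex) \<Rightarrow> real ^ 'n \<Rightarrow> complex" where
  "inv_fourier v = (SOME u. u \<in> L2_space lborel \<and> (AE \<xi> in lborel. fourier u \<xi> = v \<xi>))"

text \<open>
  As a subset of \<open>L\<^sup>2\<close>, the following is the whole Sobolev space only for \<open>s \<ge> 0\<close>. The real-valued
  norm is meaningful only for members of the space.
\<close>

definition sobolev :: "real \<Rightarrow> (real ^ 'n \<Rightarrow> complex) set" where
  "sobolev s = {f \<in> L2_space lborel.
     integrable lborel (\<lambda>\<xi>. (1 + (norm \<xi>)\<^sup>2) powr s * (norm (fourier f \<xi>))\<^sup>2)}"

definition sobolev_norm :: "real \<Rightarrow> (real ^ 'n \<Rightarrow> complex) \<Rightarrow> real" where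
  "sobolev_norm s f = sqrt (1 / (2 * pi) ^ CARD('n) *
     (LINT \<xi>|lborel. (1 + (norm \<xi>)\<^sup>2) powr s * (norm (fourier f \<xi>))\<^sup>2))"


section \<open>Functions on the grid\<close>

text \<open>
  A function on the grid is represented by a function on the whole space; nothing below depends
  on its values off the grid.
\<close>

definition grid :: "real \<Rightarrow> (real ^ 'n) set" where
  "grid h = {a. \<forall>j. \<exists>k::int. a $ j = h * of_int k}"

definition L2_grid :: "real \<Rightarrow> (real ^ 'n \<Rightarrow> complex) set" where
  "L2_grid h = {g. (\<lambda>a. (norm (g a))\<^sup>2) summable_on grid h}"

definition torus :: "real \<Rightarrow> (real ^ 'n) set" where
  "torus h = cbox (\<chi> j. - pi / h) (\<chi> j. pi / h)"

abbreviation torus_measure :: "real \<Rightarrow> (real ^ 'n) measure" where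
  "torus_measure h \<equiv> restrict_space lborel (torus h)"

text \<open>
  For square-summable \<open>g\<close> the series need not converge absolutely; it converges unconditionally in
  \<open>L\<^sup>2\<close> of the torus, which is how its sum is defined.
\<close>

definition dft :: "real \<Rightarrow> (real ^ 'n \<Rightarrow> complex) \<Rightarrow> real ^ 'n \<Rightarrow> complex" where
  "dft h g = (SOME G. G \<in> L2_space (torus_measure h) \<and>
     tendsto_L2 (torus_measure h)
       (\<lambda>A \<xi>. of_real (h ^ CARD('n)) * (\<Sum>a\<in>A. g a * cis (- (a \<bullet> \<xi>)))) G
       (finite_subsets_at_top (grid h)))"

definition sobolev_grid :: "real \<Rightarrow> real \<Rightarrow> (real ^ 'n \<Rightarrow> complex) set" where
  "sobolev_grid s h = {g \<in> L2_grid h. integrable (torus_measure h)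
     (\<lambda>\<xi>. (1 + 4 / h\<^sup>2 * (\<Sum>j\<in>UNIV. (sin (h * \<xi> $ j / 2))\<^sup>2)) powr s * (norm (dft h g \<xi>))\<^sup>2)}"

definition shannon :: "real \<Rightarrow> (real ^ 'n \<Rightarrow> complex) \<Rightarrow> real ^ 'n \<Rightarrow> complex" where
  "shannon h g = inv_fourier (\<lambda>\<xi>. indicator (torus h) \<xi> * dft h g \<xi>)"

end

theory Submission
  imports Defs "HOL-Probability.Characteristic_Functions"
begin

text \<open>
  On the Fourier side the interpolant of a grid function \<open>f\<close> is its discrete transform \<open>F\<close>, extended
  by zero from the torus cube \<open>[-\<pi>/h, \<pi>/h]\<^sup>n\<close>. The product of two interpolants has the transform
  \<open>H = (2\<pi>)^(-n) F * G\<close>, which is supported in the doubled cube. The product on the grid has as its discrete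
  transform the periodic convolution of the two, and this is the periodization of the same \<open>H\<close>
  (\<open>dft_product\<close>). The error is therefore pure aliasing: on the cube it is the sum of the translates
  \<open>H(\<xi> + 2\<pi>k/h)\<close> with \<open>k \<noteq> 0\<close>, and off the cube it is \<open>-H(\<xi>)\<close>. In both cases \<open>H\<close> is
  evaluated at frequencies of length at least \<open>\<pi>/h\<close>, where the weight \<open>(1 + |\<eta>|\<^sup>2)\<^sup>s\<close> is at most
  \<open>h^(2(\<delta>-s)) (1 + |\<eta>|\<^sup>2)^\<delta>\<close>; and for \<open>\<xi>\<close> in the cube the weight at \<open>\<xi>\<close> is at most a constant times the
  weight at \<open>\<xi> + 2\<pi>k/h\<close> (\<open>aliasing_bound\<close>). What remains is the norm of \<open>H\<close> of order \<open>\<delta>\<close>, and for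
  \<open>\<delta> > n/2\<close> it is bounded by the product of the norms of \<open>F\<close> and \<open>G\<close>, because the Sobolev space is
  an algebra (\<open>wsq_conv\<close>).

  To make these identities available, the Fourier transform on \<open>L\<^sup>2\<close> has to be brought under control.
  Testing with Gaussians gives Bessel's inequality for integrable functions (\<open>fint_Bessel\<close>); together with
  completeness of \<open>L\<^sup>2\<close> it yields the existence of the limit that defines the transform. The same
  Gaussians, tested against boxes, give the inversion formula (\<open>fourier_fint\<close>), and inversion with
  boundedness gives injectivity (\<open>fourier_inj\<close>). Hence an interpolant equals almost everywhere the inverse
  Fourier integral of its band-limited transform, so that products and differences of interpolants can be
  computed with Fubini's theorem.

  The discrete transform exists because the characters are orthogonal on the torus. The formula for products holds exactly for finite sums
  and passes to the limit, since convolution maps mean-square convergence to uniform convergence.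
\<close>

section \<open>Mean-square norms and completeness\<close>

text \<open>
  The square of the norm is kept as an extended nonnegative number: statements about convergence then
  carry no finiteness conditions, and the inequality \<open>N (f + g) \<le> 2 N f + 2 N g\<close> replaces the triangle
  inequality throughout.
\<close>

definition l2sq :: "'a measure \<Rightarrow> ('a \<Rightarrow> complex) \<Rightarrow> ennreal" where
  "l2sq M f = (\<integral>\<^sup>+x. ennreal ((norm (f x))\<^sup>2) \<partial>M)"

lemma L2_space_iff: "f \<in> L2_space M \<longleftrightarrow> f \<in> borel_measurable M \<and> l2sq M f < \<infinity>"
  unfolding L2_space_def l2sq_def by (auto simp: integrable_iff_bounded)

lemma L2_spaceD [dest]:
  assumes "f \<in> L2_space M"
  shows "f \<in> borel_measurable M" "l2sq M f < \<infinity>"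
  using assms by (auto simp: L2_space_iff)

lemma tendsto_L2_iff:
  "tendsto_L2 M u f F \<longleftrightarrow> ((\<lambda>i. l2sq M (\<lambda>x. u i x - f x)) \<longlongrightarrow> 0) F"
  unfolding tendsto_L2_def l2sq_def ..

lemma l2sq_cong_AE:
  assumes "AE x in M. f x = g x"
  shows "l2sq M f = l2sq M g"
  unfolding l2sq_def using assms by (intro nn_integral_cong_AE) auto

lemma l2sq_minus_commute: "l2sq M (\<lambda>x. f x - g x) = l2sq M (\<lambda>x. g x - f x)"
  unfolding l2sq_def by (simp add: norm_minus_commute)

lemma l2sq_mono:
  assumes "\<And>x. norm (f x) \<le> norm (g x)"
  shows "l2sq M f \<le> l2sq M g"
  unfolding l2sq_def using assms by (intro nn_integral_mono ennreal_leI power_mono) auto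

lemma l2sq_eq_0_iff:
  assumes [measurable]: "f \<in> borel_measurable M"
  shows "l2sq M f = 0 \<longleftrightarrow> (AE x in M. f x = 0)"
  unfolding l2sq_def by (subst nn_integral_0_iff_AE) (auto simp: ennreal_eq_0_iff)

lemma l2sq_cmult:
  assumes [measurable]: "f \<in> borel_measurable M"
  shows "l2sq M (\<lambda>x. c * f x) = ennreal ((norm c)\<^sup>2) * l2sq M f"
  unfolding l2sq_def
  by (subst nn_integral_cmult[symmetric])
     (auto simp: norm_mult power_mult_distrib ennreal_mult intro!: nn_integral_cong)

lemma norm_add_sq_le: "(norm (a + b :: complex))\<^sup>2 \<le> 2 * (norm a)\<^sup>2 + 2 * (norm b)\<^sup>2"
proof -
  have "(norm (a + b))\<^sup>2 \<le> (norm a + norm b)\<^sup>2"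
    by (intro power_mono norm_triangle_ineq) auto
  also have "\<dots> \<le> 2 * (norm a)\<^sup>2 + 2 * (norm b)\<^sup>2"
    using zero_le_power2[of "norm a - norm b"] by (simp add: power2_eq_square algebra_simps)
  finally show ?thesis .
qed

lemma l2sq_add:
  assumes [measurable]: "f \<in> borel_measurable M" "g \<in> borel_measurable M"
  shows "l2sq M (\<lambda>x. f x + g x) \<le> 2 * l2sq M f + 2 * l2sq M g"
proof -
  have "l2sq M (\<lambda>x. f x + g x) \<le> (\<integral>\<^sup>+x. ennreal (2 * (norm (f x))\<^sup>2 + 2 * (norm (g x))\<^sup>2) \<partial>M)"
    unfolding l2sq_def by (intro nn_integral_mono ennreal_leI norm_add_sq_le)
  also have "\<dots> = (\<integral>\<^sup>+x. 2 * ennreal ((norm (f x))\<^sup>2) + 2 * ennreal ((norm (g x))\<^sup>2) \<partial>M)"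
    by (intro nn_integral_cong) (simp add: ennreal_mult ennreal_plus)
  also have "\<dots> = 2 * l2sq M f + 2 * l2sq M g"
    unfolding l2sq_def by (subst nn_integral_add) (auto simp: nn_integral_cmult)
  finally show ?thesis .
qed

lemma l2sq_uminus: "l2sq M (\<lambda>x. - f x) = l2sq M f"
  unfolding l2sq_def by simp

lemma l2sq_diff:
  assumes [measurable]: "f \<in> borel_measurable M" "g \<in> borel_measurable M"
  shows "l2sq M (\<lambda>x. f x - g x) \<le> 2 * l2sq M f + 2 * l2sq M g"
  using l2sq_add[of f M "\<lambda>x. - g x"] by (simp add: l2sq_uminus)

lemma l2sq_triangle:
  assumes [measurable]: "f \<in> borel_measurable M" "g \<in> borel_measurable M" "k \<in> borel_measurable M"
  shows "l2sq M (\<lambda>x. f x - g x) \<le> 2 * l2sq M (\<lambda>x. f x - k x) + 2 * l2sq M (\<lambda>x. k x - g x)"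
  using l2sq_add[of "\<lambda>x. f x - k x" M "\<lambda>x. k x - g x"] by simp

lemma L2_space_add:
  assumes "f \<in> L2_space M" "g \<in> L2_space M"
  shows "(\<lambda>x. f x + g x) \<in> L2_space M"
  using l2sq_add[of f M g] assms unfolding L2_space_iff
  by (auto simp: ennreal_mult_less_top top.not_eq_extremum intro!: le_less_trans[of "l2sq M (\<lambda>x. f x + g x)"])

lemma L2_space_cmult:
  assumes "f \<in> L2_space M"
  shows "(\<lambda>x. c * f x) \<in> L2_space M"
  using assms unfolding L2_space_iff by (auto simp: l2sq_cmult ennreal_mult_less_top)

lemma L2_space_diff:
  assumes "f \<in> L2_space M" "g \<in> L2_space M"
  shows "(\<lambda>x. f x - g x) \<in> L2_space M"
  using L2_space_add[OF assms(1) L2_space_cmult[OF assms(2), of "-1"]] by simp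

lemma L2_space_bound:
  assumes "f \<in> L2_space M" "g \<in> borel_measurable M" "\<And>x. norm (g x) \<le> norm (f x)"
  shows "g \<in> L2_space M"
  using assms l2sq_mono[of g f M] by (auto simp: L2_space_iff)

lemma tendsto_L2_unique:
  assumes "F \<noteq> bot" and u: "\<And>i. u i \<in> borel_measurable M"
    and f: "f \<in> borel_measurable M" and g: "g \<in> borel_measurable M"
    and lf: "tendsto_L2 M u f F" and lg: "tendsto_L2 M u g F"
  shows "AE x in M. f x = g x"
proof -
  have le: "l2sq M (\<lambda>x. f x - g x) \<le>
      2 * l2sq M (\<lambda>x. u i x - f x) + 2 * l2sq M (\<lambda>x. u i x - g x)" for i
    using l2sq_triangle[OF f g u[of i]] by (simp add: l2sq_minus_commute[of M f])
  have "((\<lambda>i. 2 * l2sq M (\<lambda>x. u i x - f x) + 2 * l2sq M (\<lambda>x. u i x - g x)) \<longlongrightarrow> 2 * 0 + 2 * 0) F"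
    using lf lg unfolding tendsto_L2_iff by (intro tendsto_add tendsto_mult_ennreal) auto
  then have "l2sq M (\<lambda>x. f x - g x) \<le> 2 * 0 + 2 * 0"
    by (rule tendsto_lowerbound) (use le assms(1) in auto)
  then have "l2sq M (\<lambda>x. f x - g x) = 0" by simp
  then show ?thesis using f g by (subst (asm) l2sq_eq_0_iff) auto
qed

lemma tendsto_zero_boundI:
  fixes a b :: "'i \<Rightarrow> ennreal"
  assumes "\<And>i. a i \<le> c * b i" "(b \<longlongrightarrow> 0) F" "c < \<infinity>"
  shows "(a \<longlongrightarrow> 0) F"
proof -
  have "((\<lambda>i. c * b i) \<longlongrightarrow> c * 0) F"
    using assms by (intro tendsto_mult_ennreal) auto
  then have "((\<lambda>i. c * b i) \<longlongrightarrow> 0) F" by simp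
  then show ?thesis
    by (rule tendsto_sandwich[OF _ _ tendsto_const, rotated -1]) (use assms in auto)
qed

text \<open>
  Completeness for an arbitrary filter, because the Fourier transform is a limit over radii and the
  discrete one a limit over finite sets. A sequence of indices along which consecutive terms differ by
  at most \<open>4^-k\<close> converges almost everywhere. Its limit is close to every late member of the family by
  Fatou's lemma, so the whole family converges to it.
\<close>

theorem L2_complete:
  fixes u :: "'i \<Rightarrow> 'a \<Rightarrow> complex"
  assumes F: "F \<noteq> bot" and u: "\<And>i. u i \<in> L2_space M"
    and cauchy: "\<And>e. e > 0 \<Longrightarrow> \<exists>P. eventually P F \<and>
       (\<forall>i j. P i \<longrightarrow> P j \<longrightarrow> l2sq M (\<lambda>x. u i x - u j x) \<le> ennreal e)"
  shows "\<exists>f \<in> L2_space M. tendsto_L2 M u f F"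
proof -
  have [measurable]: "u i \<in> borel_measurable M" for i using u by auto
  have "\<forall>k. \<exists>P. eventually P F \<and>
       (\<forall>i j. P i \<longrightarrow> P j \<longrightarrow> l2sq M (\<lambda>x. u i x - u j x) \<le> ennreal ((1/4)^k))" for k :: nat
    using cauchy by simp
  then obtain P where P: "\<And>k. eventually (P k) F"
    and Pc: "\<And>k i j. P k i \<Longrightarrow> P k j \<Longrightarrow> l2sq M (\<lambda>x. u i x - u j x) \<le> ennreal ((1/4)^k)"
    by metis
  have "eventually (\<lambda>i. \<forall>j\<in>{..k}. P j i) F" for k
    using P by (intro eventually_ball_finite) auto
  then have "\<exists>i. \<forall>j\<le>k. P j i" for k
    using eventually_happens'[OF F] by fastforce
  then obtain m where m: "\<And>k j. j \<le> k \<Longrightarrow> P j (m k)" by metis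
  define v where "v k = u (m k)" for k
  have [measurable]: "v k \<in> borel_measurable M" for k unfolding v_def by simp
  have vd: "l2sq M (\<lambda>x. v (Suc k) x - v k x) \<le> ennreal ((1/4)^k)" for k
    unfolding v_def by (rule Pc) (auto intro: m)
  \<comment> \<open>The factor \<open>2^k\<close> keeps the series finite and forces the differences to decay geometrically at almost every point.\<close>
  let ?s = "\<lambda>x k. 2^k * (norm (v (Suc k) x - v k x))\<^sup>2"
  have "(\<integral>\<^sup>+x. (\<Sum>k. ennreal (?s x k)) \<partial>M)
      = (\<Sum>k. ennreal (2^k) * l2sq M (\<lambda>x. v (Suc k) x - v k x))"
    unfolding l2sq_def
    by (subst nn_integral_suminf) (auto simp: ennreal_mult nn_integral_cmult)
  also have "\<dots> \<le> (\<Sum>k. ennreal ((1/2)^k))"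
  proof (intro suminf_le allI)
    fix k :: nat
    have "ennreal (2^k) * l2sq M (\<lambda>x. v (Suc k) x - v k x) \<le> ennreal (2^k) * ennreal ((1/4)^k)"
      by (intro mult_left_mono vd) auto
    also have "\<dots> = ennreal ((1/2)^k)"
      by (simp add: ennreal_mult[symmetric] power_mult_distrib[symmetric] del: ennreal_power)
    finally show "ennreal (2^k) * l2sq M (\<lambda>x. v (Suc k) x - v k x) \<le> ennreal ((1/2)^k)" .
  qed auto
  also have "\<dots> < \<infinity>"
    by (subst suminf_ennreal_eq[OF _ geometric_sums]) auto
  finally have fin: "(\<integral>\<^sup>+x. (\<Sum>k. ennreal (?s x k)) \<partial>M) < \<infinity>" .
  have "AE x in M. (\<Sum>k. ennreal (?s x k)) \<noteq> \<infinity>"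
    using fin by (intro nn_integral_noteq_infinite) auto
  then have conv: "AE x in M. convergent (\<lambda>k. v k x)"
  proof eventually_elim
    fix x assume "(\<Sum>k. ennreal (?s x k)) \<noteq> \<infinity>"
    then have "summable (\<lambda>k. ?s x k)"
      by (intro summable_suminf_not_top) auto
    then have "(\<lambda>k. ?s x k) \<longlonglongrightarrow> 0"
      by (rule summable_LIMSEQ_zero)
    then have "Bseq (\<lambda>k. ?s x k)"
      by (intro convergent_imp_Bseq) (auto simp: convergent_def)
    then obtain B where B: "B > 0" "\<And>k. norm (?s x k) \<le> B"
      by (auto elim: BseqE)
    have le: "norm (v (Suc k) x - v k x) \<le> sqrt B * (1 / sqrt 2)^k" for k
    proof (rule power2_le_imp_le)
      have "(norm (v (Suc k) x - v k x))\<^sup>2 \<le> B / 2^k"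
        using B(2)[of k] by (simp add: field_simps)
      also have "\<dots> = (sqrt B * (1 / sqrt 2)^k)\<^sup>2"
        using B(1) by (simp add: power_mult_distrib power_divide power_mult[symmetric] mult.commute[of k 2])
          (simp add: power_mult)
      finally show "(norm (v (Suc k) x - v k x))\<^sup>2 \<le> (sqrt B * (1 / sqrt 2)^k)\<^sup>2" .
    qed (use B in auto)
    have "summable (\<lambda>k. sqrt B * (1 / sqrt 2)^k)"
      by (intro summable_mult summable_geometric) auto
    then have "summable (\<lambda>k. v (Suc k) x - v k x)"
      by (rule summable_comparison_test') (rule le)
    then have "convergent (\<lambda>n. v n x - v 0 x)"
      by (simp add: summable_iff_convergent sum_lessThan_telescope[of "\<lambda>k. v k x"])
    then have "convergent (\<lambda>n. (v n x - v 0 x) + v 0 x)"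
      by (intro convergent_add convergent_const)
    then show "convergent (\<lambda>k. v k x)" by simp
  qed
  define f where "f x = lim (\<lambda>k. v k x)" for x
  have [measurable]: "f \<in> borel_measurable M"
    unfolding f_def[abs_def] by (rule borel_measurable_lim_metric) simp
  have close: "l2sq M (\<lambda>x. u i x - f x) \<le> ennreal ((1/4)^k)" if i: "P k i" for i k
  proof -
    have "l2sq M (\<lambda>x. u i x - f x) = (\<integral>\<^sup>+x. liminf (\<lambda>j. ennreal ((norm (u i x - v j x))\<^sup>2)) \<partial>M)"
      unfolding l2sq_def
    proof (intro nn_integral_cong_AE, use conv in eventually_elim)
      fix x assume "convergent (\<lambda>k. v k x)"
      then have "(\<lambda>j. v j x) \<longlonglongrightarrow> f x" unfolding f_def by (simp add: convergent_LIMSEQ_iff)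
      then have "(\<lambda>j. ennreal ((norm (u i x - v j x))\<^sup>2)) \<longlonglongrightarrow> ennreal ((norm (u i x - f x))\<^sup>2)"
        by (intro tendsto_intros tendsto_ennrealI)
      then show "ennreal ((norm (u i x - f x))\<^sup>2) = liminf (\<lambda>j. ennreal ((norm (u i x - v j x))\<^sup>2))"
        by (intro lim_imp_Liminf[symmetric]) auto
    qed
    also have "\<dots> \<le> liminf (\<lambda>j. l2sq M (\<lambda>x. u i x - v j x))"
      unfolding l2sq_def by (rule nn_integral_liminf) simp
    also have "\<dots> \<le> ennreal ((1/4)^k)"
    proof (rule Liminf_le[OF trivial_limit_sequentially])
      show "\<forall>\<^sub>F j in sequentially. l2sq M (\<lambda>x. u i x - v j x) \<le> ennreal ((1/4)^k)"
        using eventually_ge_at_top[of k]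
        by eventually_elim (unfold v_def, rule Pc[OF i m])
    qed
    finally show ?thesis .
  qed
  have "tendsto_L2 M u f F"
    unfolding tendsto_L2_iff
  proof (rule order_tendstoI)
    fix a :: ennreal assume "0 < a"
    then obtain c where c: "0 < c" "c < a" using dense by blast
    define e where "e = enn2real c"
    have e: "e > 0" "ennreal e < a"
      using c by (auto simp: e_def enn2real_positive_iff less_top[symmetric] ennreal_enn2real_if)
    obtain k where "(1/4::real)^k < e" using real_arch_pow_inv[of e "1/4"] e by auto
    then have ka: "ennreal ((1/4)^k) < a" using e by (meson ennreal_leI le_less_trans less_imp_le)
    show "\<forall>\<^sub>F i in F. l2sq M (\<lambda>x. u i x - f x) < a"
      by (rule eventually_mono[OF P[of k]]) (use close ka le_less_trans in blast)
  qed simp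
  moreover have "f \<in> L2_space M"
  proof -
    have "l2sq M f \<le> 2 * l2sq M (u (m 0)) + 2 * l2sq M (\<lambda>x. u (m 0) x - f x)"
      using l2sq_diff[of "u (m 0)" M "\<lambda>x. u (m 0) x - f x"] by simp
    also have "\<dots> < \<infinity>"
      using close[of 0 "m 0"] m[of 0 0] L2_spaceD(2)[OF u[of "m 0"]]
      by (auto simp: ennreal_mult_less_top intro: le_less_trans)
    finally show ?thesis by (simp add: L2_space_iff)
  qed
  ultimately show ?thesis by blast
qed

lemma l2sq_Cauchy_Schwarz:
  assumes [measurable]: "f \<in> borel_measurable M" "g \<in> borel_measurable M"
  shows "(\<integral>\<^sup>+x. ennreal (norm (f x * g x)) \<partial>M)\<^sup>2 \<le> l2sq M f * l2sq M g"
  using Cauchy_Schwarz_nn_integral[of "\<lambda>x. ennreal (norm (f x))" M "\<lambda>x. ennreal (norm (g x))"]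
  unfolding l2sq_def by (simp add: norm_mult ennreal_mult ennreal_power)

lemma L2_mult_integrable:
  assumes f: "f \<in> L2_space M" and g: "g \<in> L2_space M"
  shows "integrable M (\<lambda>x. f x * g x)"
proof -
  have [measurable]: "f \<in> borel_measurable M" "g \<in> borel_measurable M" using f g by auto
  have "(\<integral>\<^sup>+x. ennreal (norm (f x * g x)) \<partial>M)\<^sup>2 < \<infinity>"
    using l2sq_Cauchy_Schwarz[of f M g] L2_spaceD(2)[OF f] L2_spaceD(2)[OF g]
    by (auto simp: ennreal_mult_less_top intro: le_less_trans)
  then show ?thesis by (simp add: integrable_iff_bounded power_less_top_ennreal)
qed

lemma norm_integral_mult_le:
  assumes f: "f \<in> L2_space M" and g: "g \<in> L2_space M"
  shows "ennreal ((norm (LINT x|M. f x * g x))\<^sup>2) \<le> l2sq M f * l2sq M g"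
proof -
  have "ennreal ((norm (LINT x|M. f x * g x))\<^sup>2) = (ennreal (norm (LINT x|M. f x * g x)))\<^sup>2"
    by (simp add: ennreal_power)
  also have "\<dots> \<le> (\<integral>\<^sup>+x. ennreal (norm (f x * g x)) \<partial>M)\<^sup>2"
    by (intro power_mono_ennreal integral_norm_bound_ennreal L2_mult_integrable f g)
  also have "\<dots> \<le> l2sq M f * l2sq M g"
    using f g by (intro l2sq_Cauchy_Schwarz) auto
  finally show ?thesis .
qed

lemma tendsto_norm_sq_ennrealD:
  fixes a :: "'i \<Rightarrow> complex"
  assumes "((\<lambda>i. ennreal ((norm (a i - b))\<^sup>2)) \<longlongrightarrow> 0) F"
  shows "(a \<longlongrightarrow> b) F"
proof -
  have "((\<lambda>i. (norm (a i - b))\<^sup>2) \<longlongrightarrow> 0) F"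
    using assms by (subst (asm) ennreal_0[symmetric], subst (asm) tendsto_ennreal_iff) auto
  then have "((\<lambda>i. sqrt ((norm (a i - b))\<^sup>2)) \<longlongrightarrow> sqrt 0) F"
    by (rule tendsto_real_sqrt)
  then have "((\<lambda>i. norm (a i - b)) \<longlongrightarrow> 0) F" by simp
  then show ?thesis by (simp add: tendsto_norm_zero_iff LIM_zero_iff)
qed

lemma tendsto_L2_integral_mult:
  assumes u: "\<And>i. u i \<in> L2_space M" and f: "f \<in> L2_space M" and g: "g \<in> L2_space M"
    and lim: "tendsto_L2 M u f F"
  shows "((\<lambda>i. LINT x|M. u i x * g x) \<longlongrightarrow> (LINT x|M. f x * g x)) F"
proof (rule tendsto_norm_sq_ennrealD, rule tendsto_zero_boundI)
  fix i
  have "(LINT x|M. u i x * g x) - (LINT x|M. f x * g x) = (LINT x|M. (u i x - f x) * g x)"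
    by (subst Bochner_Integration.integral_diff[symmetric])
       (auto intro: L2_mult_integrable u f g simp: algebra_simps)
  then show "ennreal ((norm ((LINT x|M. u i x * g x) - (LINT x|M. f x * g x)))\<^sup>2)
     \<le> l2sq M g * l2sq M (\<lambda>x. u i x - f x)"
    using norm_integral_mult_le[OF L2_space_diff[OF u[of i] f] g] by (simp add: mult.commute)
qed (use lim g in \<open>auto simp: tendsto_L2_iff\<close>)

lemma cis_measurable [measurable (raw)]:
  "f \<in> borel_measurable M \<Longrightarrow> (\<lambda>x. cis (f x)) \<in> borel_measurable M"
  by (rule measurable_compose[of f M borel]) (auto intro!: borel_measurable_continuous_onI continuous_intros simp: cis_conv_exp)

section \<open>Affine substitution and product integrands\<close>

lemma nn_integral_lborel_affine:
  fixes f :: "'a::euclidean_space \<Rightarrow> ennreal"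
  assumes [measurable]: "f \<in> borel_measurable borel" and "c \<noteq> 0"
  shows "(\<integral>\<^sup>+x. f x \<partial>lborel) = \<bar>c\<bar> ^ DIM('a) * (\<integral>\<^sup>+x. f (t + c *\<^sub>R x) \<partial>lborel)"
  by (subst lborel_affine[OF assms(2), of t])
     (simp add: nn_integral_density nn_integral_distr nn_integral_cmult ennreal_power)

lemma integral_lborel_affine:
  fixes f :: "'a::euclidean_space \<Rightarrow> 'b::{banach, second_countable_topology}"
  assumes [measurable]: "f \<in> borel_measurable borel" and "c \<noteq> 0"
  shows "(LINT x|lborel. f x) = (\<bar>c\<bar> ^ DIM('a)) *\<^sub>R (LINT x|lborel. f (t + c *\<^sub>R x))"
  by (subst lborel_affine[OF assms(2), of t]) (simp add: integral_density integral_distr)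

lemma integrable_lborel_affine:
  fixes f :: "'a::euclidean_space \<Rightarrow> 'b::{banach, second_countable_topology}"
  assumes f: "integrable lborel f" and "c \<noteq> 0"
  shows "integrable lborel (\<lambda>x. f (t + c *\<^sub>R x))"
proof -
  have [measurable]: "f \<in> borel_measurable borel" using f by auto
  have "ennreal (\<bar>c\<bar> ^ DIM('a)) * (\<integral>\<^sup>+x. ennreal (norm (f (t + c *\<^sub>R x))) \<partial>lborel) < \<infinity>"
    using f nn_integral_lborel_affine[OF _ assms(2), of "\<lambda>x. ennreal (norm (f x))" t]
    by (simp add: integrable_iff_bounded ennreal_power)
  then have "(\<integral>\<^sup>+x. ennreal (norm (f (t + c *\<^sub>R x))) \<partial>lborel) < \<infinity>"
    using assms(2) by (auto simp: ennreal_mult_less_top)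
  then show ?thesis by (simp add: integrable_iff_bounded)
qed

lemma AE_lborel_affine:
  fixes P :: "'a::euclidean_space \<Rightarrow> bool"
  assumes "AE x in lborel. P x" and c: "c \<noteq> 0"
  shows "AE x in lborel. P (t + c *\<^sub>R x)"
proof -
  obtain N where N: "N \<in> null_sets lborel" "{x. \<not> P x} \<subseteq> N"
    using assms(1) by (auto simp: eventually_ae_filter)
  have [measurable]: "N \<in> sets borel" using N by auto
  have "(\<integral>\<^sup>+x. indicator N x \<partial>lborel) = 0" using N by (auto simp: null_sets_def)
  then have "(\<integral>\<^sup>+x. indicator N (t + c *\<^sub>R x) \<partial>lborel) = 0"
    using nn_integral_lborel_affine[OF _ c, of "indicator N" t] c by auto
  then have "AE x in lborel. indicator N (t + c *\<^sub>R x) = (0::ennreal)"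
    by (subst (asm) nn_integral_0_iff_AE) auto
  then show ?thesis
    by (rule eventually_mono) (use N in \<open>auto split: split_indicator_asm\<close>)
qed

lemma nn_integral_lborel_reflect:
  fixes f :: "'a::euclidean_space \<Rightarrow> ennreal"
  assumes "f \<in> borel_measurable borel"
  shows "(\<integral>\<^sup>+x. f (- x) \<partial>lborel) = (\<integral>\<^sup>+x. f x \<partial>lborel)"
  using nn_integral_lborel_affine[OF assms, of "-1" 0] by simp

lemma integral_lborel_reflect:
  fixes f :: "'a::euclidean_space \<Rightarrow> 'b::{banach, second_countable_topology}"
  assumes "f \<in> borel_measurable borel"
  shows "(LINT x|lborel. f (- x)) = (LINT x|lborel. f x)"
  using integral_lborel_affine[OF assms, of "-1" 0] by simp

lemma integrable_lborel_reflect: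
  fixes f :: "'a::euclidean_space \<Rightarrow> 'b::{banach, second_countable_topology}"
  assumes "integrable lborel f"
  shows "integrable lborel (\<lambda>x. f (- x))"
  using integrable_lborel_affine[OF assms, of "-1" 0] by simp

lemma AE_lborel_reflect:
  fixes P :: "'a::euclidean_space \<Rightarrow> bool"
  assumes "AE x in lborel. P x"
  shows "AE x in lborel. P (- x)"
  using AE_lborel_affine[OF assms, of "-1" 0] by simp

lemma lborel_prod_Basis:
  fixes f :: "'a::euclidean_space \<Rightarrow> real \<Rightarrow> complex"
  assumes f: "\<And>b. b \<in> Basis \<Longrightarrow> integrable lborel (f b)"
  shows "integrable lborel (\<lambda>x. \<Prod>b\<in>Basis. f b (x \<bullet> b))" (is ?A)
    and "(LINT x|lborel. (\<Prod>b\<in>Basis. f b (x \<bullet> b))) = (\<Prod>b\<in>Basis. (LINT t|lborel. f b t))" (is ?B)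
proof -
  interpret product_sigma_finite "\<lambda>_::'a. lborel :: real measure" ..
  let ?M = "\<Pi>\<^sub>M b\<in>(Basis::'a set). (lborel :: real measure)"
  let ?T = "\<lambda>g. \<Sum>b\<in>(Basis::'a set). g b *\<^sub>R b"
  have [measurable]: "?T \<in> ?M \<rightarrow>\<^sub>M borel" by simp
  have [measurable]: "f b \<in> borel_measurable borel" if "b \<in> Basis" for b using f[OF that] by auto
  have m: "(\<lambda>x. \<Prod>b\<in>Basis. f b (x \<bullet> b)) \<in> borel_measurable borel"
    by (intro borel_measurable_prod) simp
  have eq: "(\<Prod>b\<in>Basis. f b (?T g \<bullet> b)) = (\<Prod>b\<in>Basis. f b (g b))" for g
    by (intro prod.cong) auto
  show ?A
    by (subst lborel_eq, subst integrable_distr_eq) (auto simp: m eq intro!: product_integrable_prod f)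
  show ?B
    by (subst lborel_eq, subst integral_distr) (auto simp: m eq intro!: product_integral_prod f)
qed

text \<open>
  Both explicit integrals below, those of the Gaussian and of the characters over the torus, factor over
  the coordinates and are reduced to one variable by this.
\<close>

lemma lborel_prod_vec:
  fixes f :: "'n::finite \<Rightarrow> real \<Rightarrow> complex"
  assumes f: "\<And>j. integrable lborel (f j)"
  shows "integrable lborel (\<lambda>x::real^'n. \<Prod>j\<in>UNIV. f j (x $ j))"
    and "(LINT x|lborel. (\<Prod>j\<in>UNIV. f j ((x::real^'n) $ j))) = (\<Prod>j\<in>UNIV. (LINT t|lborel. f j t))"
proof -
  have B: "(Basis :: (real^'n) set) = range (\<lambda>j. axis j 1)"
    by (auto simp: Basis_vec_def)
  have inj: "inj (\<lambda>j::'n. axis j (1::real))"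
    by (auto simp: inj_def axis_eq_axis)
  define g where "g b = f (the_inv (\<lambda>j::'n. axis j (1::real)) b)" for b
  have g: "g (axis j 1) = f j" for j unfolding g_def using the_inv_f_f[OF inj] by simp
  have gi: "integrable lborel (g b)" for b unfolding g_def by (rule f)
  have e1: "(\<Prod>b\<in>Basis. g b (x \<bullet> b)) = (\<Prod>j\<in>UNIV. f j (x $ j))" for x :: "real^'n"
    unfolding B using inj by (subst prod.reindex) (auto simp: g inner_axis)
  have e2: "(\<Prod>b\<in>Basis. (LINT t|lborel. g b t)) = (\<Prod>j\<in>UNIV. (LINT t|lborel. f j t))"
    unfolding B using inj by (subst prod.reindex) (auto simp: g)
  show "integrable lborel (\<lambda>x::real^'n. \<Prod>j\<in>UNIV. f j (x $ j))"
    using lborel_prod_Basis(1)[of g] gi by (simp add: e1)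
  show "(LINT x|lborel. (\<Prod>j\<in>UNIV. f j ((x::real^'n) $ j))) = (\<Prod>j\<in>UNIV. (LINT t|lborel. f j t))"
    using lborel_prod_Basis(2)[of g] gi by (simp add: e1 e2)
qed

lemma prod_cis: "finite A \<Longrightarrow> (\<Prod>j\<in>A. cis (f j)) = cis (\<Sum>j\<in>A. f j)"
  by (induction A rule: finite_induct) (auto simp: cis_mult)

section \<open>The Gaussian and its Fourier integral\<close>

definition gauss :: "real \<Rightarrow> real ^ 'n \<Rightarrow> real" where
  "gauss e x = exp (- (e * norm x)\<^sup>2 / 2)"

lemma gauss_measurable [measurable]: "gauss e \<in> borel_measurable borel"
  unfolding gauss_def[abs_def] by simp

lemma gauss_bounds [simp]: "0 \<le> gauss e x" "gauss e x \<le> 1" "0 < gauss e x"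
  by (auto simp: gauss_def)

text \<open>
  This is the characteristic function of the standard normal distribution, rescaled.
\<close>

lemma gaussian_fourier_1d:
  assumes "e > 0"
  shows "integrable lborel (\<lambda>t. of_real (exp (- (e * t)\<^sup>2 / 2)) * cis (- (u * t)))" (is ?A)
    and "(LINT t|lborel. of_real (exp (- (e * t)\<^sup>2 / 2)) * cis (- (u * t)))
        = complex_of_real (sqrt (2 * pi) / e * exp (- (u / e)\<^sup>2 / 2))" (is ?B)
proof -
  let ?g = "\<lambda>u t. complex_of_real (exp (- t\<^sup>2 / 2)) * cis (- (u * t))"
  have i1: "integrable lborel (\<lambda>t::real. exp (- t\<^sup>2 / 2))"
  proof -
    have "integrable lborel (\<lambda>t. sqrt (2 * pi) * std_normal_density t)"
      by simp
    then show ?thesis by (simp add: std_normal_density_def)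
  qed
  have i: "integrable lborel (\<lambda>t. ?g u t)" for u :: real
    by (rule Bochner_Integration.integrable_bound[OF i1]) (auto simp: norm_mult)
  have v: "(LINT t|lborel. ?g u t) = complex_of_real (sqrt (2 * pi) * exp (- u\<^sup>2 / 2))" for u :: real
  proof -
    have "complex_of_real (exp (- u\<^sup>2 / 2)) = char std_normal_distribution (- u)"
      by (simp add: char_std_normal_distribution)
    also have "\<dots> = (LINT t|lborel. std_normal_density t *\<^sub>R cis (- (u * t)))"
      unfolding char_def by (subst integral_density) (auto simp: cis_conv_exp)
    also have "\<dots> = (LINT t|lborel. complex_of_real (1 / sqrt (2 * pi)) * (?g u t))"
      by (simp add: std_normal_density_def scaleR_conv_of_real mult.assoc)
    also have "\<dots> = complex_of_real (1 / sqrt (2 * pi)) * (LINT t|lborel. ?g u t)"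
      by (rule integral_mult_right_zero)
    finally show ?thesis by (simp add: field_simps)
  qed
  show ?A using lborel_integrable_real_affine[OF i[of "u/e"], of e 0] assms by simp
  have "(LINT t|lborel. ?g (u / e) t)
     = \<bar>e\<bar> *\<^sub>R (LINT t|lborel. of_real (exp (- (e * t)\<^sup>2 / 2)) * cis (- (u * t)))"
    using lborel_integral_real_affine[of e "\<lambda>t. ?g (u / e) t" 0] assms by simp
  then show ?B unfolding v using assms by (simp add: scaleR_conv_of_real field_simps)
qed

lemma gauss_prod: "gauss e x = (\<Prod>j\<in>UNIV. exp (- (e * x $ j)\<^sup>2 / 2))"
proof -
  have "(norm x)\<^sup>2 = (\<Sum>j\<in>UNIV. (x $ j)\<^sup>2)"
    by (simp add: norm_vec_def L2_set_def sum_nonneg)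
  then have "- (e * norm x)\<^sup>2 / 2 = (\<Sum>j\<in>UNIV. - (e * x $ j)\<^sup>2 / 2)"
    by (simp add: power_mult_distrib sum_distrib_left sum_negf sum_divide_distrib)
  then show ?thesis unfolding gauss_def by (simp add: exp_sum)
qed

lemma gauss_fourier:
  fixes x :: "real ^ 'n"
  assumes "e > 0"
  shows "integrable lborel (\<lambda>\<xi>::real^'n. of_real (gauss e \<xi>) * cis (- (x \<bullet> \<xi>)))" (is ?A)
    and "(LINT \<xi>|lborel. of_real (gauss e \<xi>) * cis (- (x \<bullet> \<xi>)))
        = complex_of_real ((sqrt (2 * pi) / e) ^ CARD('n) * gauss (1 / e) x)" (is ?B)
proof -
  let ?f = "\<lambda>(j::'n) t. of_real (exp (- (e * t)\<^sup>2 / 2)) * cis (- (x $ j * t))"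
  have eq: "of_real (gauss e \<xi>) * cis (- (x \<bullet> \<xi>)) = (\<Prod>j\<in>UNIV. ?f j (\<xi> $ j))" for \<xi>
    unfolding gauss_prod by (simp add: prod.distrib prod_cis inner_vec_def sum_negf)
  show ?A unfolding eq by (intro lborel_prod_vec gaussian_fourier_1d assms)
  have "(LINT \<xi>|lborel. of_real (gauss e \<xi>) * cis (- (x \<bullet> \<xi>)))
      = (\<Prod>j\<in>UNIV. complex_of_real (sqrt (2 * pi) / e * exp (- (x $ j / e)\<^sup>2 / 2)))"
    unfolding eq
    by (subst lborel_prod_vec(2)[OF gaussian_fourier_1d(1)[OF assms]])
       (simp only: gaussian_fourier_1d(2)[OF assms])
  also have "\<dots> = complex_of_real ((sqrt (2 * pi) / e) ^ CARD('n) * gauss (1 / e) x)"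
    by (simp only: of_real_prod[symmetric] prod.distrib prod_constant gauss_prod)
       (simp add: power_divide)
  finally show ?B .
qed

lemma integrable_gauss:
  assumes "e > 0"
  shows "integrable lborel (gauss e :: real^'n \<Rightarrow> real)"
  using integrable_norm[OF gauss_fourier(1)[OF assms, of "0 :: real^'n"]] by simp

text \<open>
  For \<open>e > 0\<close> this is the Fourier integral of \<open>gauss e\<close>. It is positive, has total mass \<open>(2\<pi>)\<^sup>n\<close> for every \<open>e\<close>, and
  concentrates at the origin as \<open>e\<close> tends to zero.
\<close>

definition gauss_kernel :: "real \<Rightarrow> real ^ 'n \<Rightarrow> real" where
  "gauss_kernel e x = (sqrt (2 * pi) / e) ^ CARD('n) * gauss (1 / e) x"

lemma gauss_kernel_measurable [measurable]: "gauss_kernel e \<in> borel_measurable borel"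
  unfolding gauss_kernel_def[abs_def] by simp

lemma gauss_kernel_nonneg: "e > 0 \<Longrightarrow> 0 \<le> gauss_kernel e x"
  by (simp add: gauss_kernel_def)

lemma integrable_gauss_kernel: "e > 0 \<Longrightarrow> integrable lborel (gauss_kernel e)"
  unfolding gauss_kernel_def[abs_def] by (intro integrable_mult_right integrable_gauss) simp

lemma gauss_kernel_integral:
  assumes "e > 0"
  shows "(LINT x|lborel. gauss_kernel e (x :: real^'n)) = (2 * pi) ^ CARD('n)"
proof -
  have "complex_of_real (LINT x|lborel. gauss (1 / e) (x :: real^'n)) = of_real ((sqrt (2 * pi) * e) ^ CARD('n))"
    using gauss_fourier(2)[of "1 / e" "0 :: real^'n"] assms by (simp add: gauss_def)
  then have "(LINT x|lborel. gauss (1 / e) (x :: real^'n)) = (sqrt (2 * pi) * e) ^ CARD('n)"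
    by (simp only: of_real_eq_iff)
  then have "(LINT x|lborel. gauss_kernel e (x :: real^'n)) = ((sqrt (2 * pi) / e) * (sqrt (2 * pi) * e)) ^ CARD('n)"
    unfolding gauss_kernel_def by (simp only: integral_mult_right_zero power_mult_distrib)
  also have "(sqrt (2 * pi) / e) * (sqrt (2 * pi) * e) = 2 * pi" using assms by simp
  finally show ?thesis .
qed

lemma gauss_kernel_nn_integral:
  fixes a :: "real^'n"
  assumes "e > 0"
  shows "(\<integral>\<^sup>+x. ennreal (gauss_kernel e (a + x)) \<partial>lborel) = ennreal ((2 * pi) ^ CARD('n))"
proof -
  have "(\<integral>\<^sup>+x. ennreal (gauss_kernel e (a + x)) \<partial>lborel) = (\<integral>\<^sup>+x. ennreal (gauss_kernel e (x::real^'n)) \<partial>lborel)"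
    using nn_integral_lborel_affine[of "\<lambda>x. ennreal (gauss_kernel e x)" 1 a] by simp
  also have "\<dots> = ennreal ((2 * pi) ^ CARD('n))"
    using assms by (subst nn_integral_eq_integral) (auto simp: integrable_gauss_kernel gauss_kernel_nonneg gauss_kernel_integral)
  finally show ?thesis .
qed

lemma gauss_kernel_scale:
  "e > 0 \<Longrightarrow> e ^ CARD('n) * gauss_kernel e (e *\<^sub>R x) = gauss_kernel 1 (x :: real^'n)"
  by (simp add: gauss_kernel_def gauss_def power_divide)

lemma cnj_measurable [measurable (raw)]:
  "f \<in> borel_measurable M \<Longrightarrow> (\<lambda>x. cnj (f x)) \<in> borel_measurable M"
  by (rule measurable_compose[of f M borel]) (auto intro!: borel_measurable_continuous_onI continuous_intros)

section \<open>The Fourier integral\<close>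

text \<open>
  The absolutely convergent Fourier integral. It is the meaningful object for integrable \<open>f\<close>; the
  transform on \<open>L\<^sup>2\<close> is reached from it by limits.
\<close>

definition fint :: "(real ^ 'n \<Rightarrow> complex) \<Rightarrow> real ^ 'n \<Rightarrow> complex" where
  "fint f \<xi> = (LINT x|lborel. f x * cis (- (x \<bullet> \<xi>)))"

lemma fint_measurable [measurable]:
  assumes [measurable]: "f \<in> borel_measurable borel"
  shows "fint f \<in> borel_measurable borel"
  unfolding fint_def[abs_def] by measurable

lemma integrable_mult_cis:
  assumes f: "integrable M f" and [measurable]: "g \<in> borel_measurable M"
  shows "integrable M (\<lambda>x. f x * cis (g x))"
proof (rule Bochner_Integration.integrable_bound[OF f])
  have [measurable]: "f \<in> borel_measurable M" using f by auto
  show "(\<lambda>x. f x * cis (g x)) \<in> borel_measurable M" by measurable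
qed (auto simp: norm_mult)

lemma norm_fint_le:
  assumes "integrable lborel f"
  shows "norm (fint f \<xi>) \<le> (LINT x|lborel. norm (f x))"
proof -
  have "norm (fint f \<xi>) \<le> (LINT x|lborel. norm (f x * cis (- (x \<bullet> \<xi>))))"
    unfolding fint_def by (rule integral_norm_bound)
  then show ?thesis by (simp add: norm_mult)
qed

lemma fint_diff:
  assumes f: "integrable lborel f" and g: "integrable lborel g"
  shows "fint (\<lambda>x. f x - g x) \<xi> = fint f \<xi> - fint g \<xi>"
  unfolding fint_def
  by (simp add: left_diff_distrib integrable_mult_cis f g)

lemma integrable_mult_pair:
  fixes f g :: "_ \<Rightarrow> complex"
  assumes f: "integrable lborel (f :: 'a::euclidean_space \<Rightarrow> _)" and g: "integrable lborel (g :: 'b::euclidean_space \<Rightarrow> _)"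
  shows "integrable (lborel \<Otimes>\<^sub>M lborel) (\<lambda>(x, y). f x * g y)"
proof -
  have [measurable]: "f \<in> borel_measurable borel" "g \<in> borel_measurable borel" using f g by auto
  show ?thesis
  proof (rule lborel_pair.Fubini_integrable)
    show "integrable lborel (\<lambda>x. LINT y|lborel. norm (case (x, y) of (x, y) \<Rightarrow> f x * g y))"
      using f by (simp add: norm_mult)
    show "AE x in lborel. integrable lborel (\<lambda>y. case (x, y) of (x, y) \<Rightarrow> f x * g y)"
      using g by simp
  qed measurable
qed

lemma integrable_mult_pair_cis:
  fixes f g :: "real^'n \<Rightarrow> complex"
  assumes f: "integrable lborel f" and g: "integrable lborel g"
    and [measurable]: "\<phi> \<in> borel_measurable (borel \<Otimes>\<^sub>M borel)"
  shows "integrable (lborel \<Otimes>\<^sub>M lborel) (\<lambda>(x, y). f x * g y * cis (\<phi> (x, y)))"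
proof -
  have "integrable (lborel \<Otimes>\<^sub>M lborel) (\<lambda>p. (case p of (x, y) \<Rightarrow> f x * g y) * cis (\<phi> p))"
    by (rule integrable_mult_cis[OF integrable_mult_pair[OF f g]]) measurable
  then show ?thesis by (simp add: case_prod_unfold)
qed

text \<open>
  Fubini's theorem. All later identities between transforms come from moving the Fourier integral
  from one factor to the other in this way.
\<close>

lemma fint_multiplication:
  fixes f g :: "real^'n \<Rightarrow> complex"
  assumes f: "integrable lborel f" and g: "integrable lborel g"
  shows "(LINT \<xi>|lborel. fint f \<xi> * g \<xi>) = (LINT x|lborel. f x * fint g x)"
proof -
  have int: "integrable (lborel \<Otimes>\<^sub>M lborel) (\<lambda>(x, \<xi>). f x * g \<xi> * cis (- (x \<bullet> \<xi>)))"
    using integrable_mult_pair_cis[OF f g, of "\<lambda>p. - (fst p \<bullet> snd p)"] by simp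
  have "(LINT \<xi>|lborel. fint f \<xi> * g \<xi>) = (LINT \<xi>|lborel. LINT x|lborel. f x * g \<xi> * cis (- (x \<bullet> \<xi>)))"
    unfolding fint_def integral_mult_left_zero[symmetric] by (simp add: mult_ac)
  also have "\<dots> = (LINT x|lborel. LINT \<xi>|lborel. f x * g \<xi> * cis (- (x \<bullet> \<xi>)))"
    by (rule lborel_pair.Fubini_integral[OF int])
  also have "\<dots> = (LINT x|lborel. f x * fint g x)"
    unfolding fint_def integral_mult_right_zero[symmetric] by (simp add: mult_ac inner_commute)
  finally show ?thesis .
qed

text \<open>
  With a Gaussian damping factor, transforming twice is averaging against the Gaussian kernel. As
  \<open>e\<close> tends to zero this becomes both Bessel's inequality and the inversion formula.
\<close>

lemma fint_mult_gauss:
  fixes f :: "real^'n \<Rightarrow> complex"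
  assumes f: "integrable lborel f" and e: "e > 0"
  shows "fint (\<lambda>\<xi>. fint f \<xi> * of_real (gauss e \<xi>)) x = (LINT y|lborel. f y * of_real (gauss_kernel e (x + y)))"
proof -
  have i: "integrable lborel (\<lambda>\<xi>. complex_of_real (gauss e \<xi>) * cis (- (x \<bullet> \<xi>)))"
    by (rule gauss_fourier[OF e])
  have k: "fint (\<lambda>\<xi>. of_real (gauss e \<xi>) * cis (- (x \<bullet> \<xi>))) y = of_real (gauss_kernel e (x + y))" for y
    unfolding fint_def gauss_kernel_def gauss_fourier(2)[OF e, symmetric]
    by (intro Bochner_Integration.integral_cong)
       (simp_all add: mult.assoc cis_mult inner_add_left inner_add_right inner_commute)
  have "fint (\<lambda>\<xi>. fint f \<xi> * of_real (gauss e \<xi>)) x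
      = (LINT \<xi>|lborel. fint f \<xi> * (of_real (gauss e \<xi>) * cis (- (x \<bullet> \<xi>))))"
    unfolding fint_def[of "\<lambda>\<xi>. fint f \<xi> * of_real (gauss e \<xi>)"] by (simp add: inner_commute mult_ac)
  also have "\<dots> = (LINT y|lborel. f y * fint (\<lambda>\<xi>. of_real (gauss e \<xi>) * cis (- (x \<bullet> \<xi>))) y)"
    by (rule fint_multiplication[OF f i])
  finally show ?thesis by (simp add: k)
qed

lemma integrable_fint_mult_gauss:
  fixes f :: "real^'n \<Rightarrow> complex"
  assumes f: "integrable lborel f" and e: "e > 0"
  shows "integrable lborel (\<lambda>\<xi>. fint f \<xi> * of_real (gauss e \<xi>))"
proof -
  have [measurable]: "f \<in> borel_measurable borel" using f by auto
  show ?thesis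
  proof (rule Bochner_Integration.integrable_bound)
    show "integrable lborel (\<lambda>\<xi>. (LINT x|lborel. norm (f x)) * gauss e (\<xi>::real^'n))"
      by (intro integrable_mult_right integrable_gauss e)
    show "AE \<xi> in lborel. norm (fint f \<xi> * of_real (gauss e \<xi>)) \<le> norm ((LINT x|lborel. norm (f x)) * gauss e \<xi>)"
      using norm_fint_le[OF f] by (auto simp: norm_mult intro!: mult_right_mono)
  qed measurable
qed

section \<open>Bessel's inequality\<close>

lemma nn_integral_norm_bound:
  fixes f :: "'a \<Rightarrow> 'b::{banach, second_countable_topology}"
  shows "ennreal (norm (LINT x|M. f x)) \<le> (\<integral>\<^sup>+x. ennreal (norm (f x)) \<partial>M)"
  by (cases "integrable M f") (auto simp: integral_norm_bound_ennreal not_integrable_integral_eq)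

lemma l2sq_lborel_reflect:
  fixes f :: "real^'n \<Rightarrow> complex"
  assumes [measurable]: "f \<in> borel_measurable borel"
  shows "l2sq lborel (\<lambda>x. f (- x)) = l2sq lborel f"
  unfolding l2sq_def using nn_integral_lborel_reflect[of "\<lambda>x. ennreal ((norm (f x))\<^sup>2)"] by simp

lemma ennreal_half_add_half: "(x :: ennreal) / 2 + x / 2 = x"
proof -
  have "x / 2 + x / 2 = (x * 2) / 2"
    by (simp add: add_divide_distrib_ennreal[symmetric] mult_2_right)
  also have "\<dots> = x" by (rule mult_divide_eq_ennreal) auto
  finally show ?thesis .
qed

text \<open>
  The left side is the integral of \<open>f(x) * cnj (f(y)) * k(x - y)\<close> with the Gaussian kernel \<open>k\<close>. By
  \<open>2 a b \<le> a\<^sup>2 + b\<^sup>2\<close> it splits into two terms, and in each of them the kernel integrates to \<open>(2\<pi>)\<^sup>n\<close>.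
\<close>

lemma fint_weighted_Bessel:
  fixes f :: "real^'n \<Rightarrow> complex"
  assumes f: "integrable lborel f" and e: "e > 0"
  shows "(\<integral>\<^sup>+\<xi>. ennreal ((norm (fint f \<xi>))\<^sup>2 * gauss e \<xi>) \<partial>lborel) \<le> ennreal ((2 * pi) ^ CARD('n)) * l2sq lborel f"
proof -
  have [measurable]: "f \<in> borel_measurable borel" using f by auto
  \<comment> \<open>The conjugate of the transform of \<open>f\<close> is again a Fourier integral, that of \<open>f'\<close>.\<close>
  define f' where "f' y = cnj (f (- y))" for y
  have f': "integrable lborel f'"
    unfolding f'_def using integrable_lborel_reflect[OF f] by (simp add: integrable_cnj)
  have [measurable]: "f' \<in> borel_measurable borel" using f' by auto
  have cnj: "cnj (fint f \<xi>) = fint f' \<xi>" for \<xi>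
  proof -
    have "cnj (fint f \<xi>) = (LINT x|lborel. cnj (f x) * cis (x \<bullet> \<xi>))"
      unfolding fint_def by (subst Bochner_Integration.integral_cnj[symmetric]) (simp add: cis_cnj)
    also have "\<dots> = (LINT x|lborel. cnj (f (- x)) * cis ((- x) \<bullet> \<xi>))"
      by (subst integral_lborel_reflect[symmetric]) auto
    finally show ?thesis unfolding fint_def f'_def by simp
  qed
  let ?g = "\<lambda>\<xi>. fint f' \<xi> * of_real (gauss e \<xi>)"
  have g: "integrable lborel ?g" by (rule integrable_fint_mult_gauss[OF f' e])
  have eq: "fint f \<xi> * ?g \<xi> = of_real ((norm (fint f \<xi>))\<^sup>2 * gauss e \<xi>)" for \<xi>
    by (simp add: cnj[symmetric] mult.assoc[symmetric] complex_norm_square[symmetric])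
  have "integrable lborel (\<lambda>\<xi>. fint f \<xi> * ?g \<xi>)"
  proof (rule Bochner_Integration.integrable_bound)
    show "integrable lborel (\<lambda>\<xi>. of_real (LINT x|lborel. norm (f x)) * ?g \<xi>)"
      by (intro integrable_mult_right g)
    show "AE \<xi> in lborel. norm (fint f \<xi> * ?g \<xi>) \<le> norm (of_real (LINT x|lborel. norm (f x)) * ?g \<xi>)"
      using norm_fint_le[OF f] unfolding norm_mult by (intro AE_I2 mult_right_mono) auto
  qed measurable
  then have "integrable lborel (\<lambda>\<xi>. norm (fint f \<xi> * ?g \<xi>))" by (rule integrable_norm)
  then have i: "integrable lborel (\<lambda>\<xi>. (norm (fint f \<xi>))\<^sup>2 * gauss e \<xi>)"
    unfolding eq norm_of_real by (simp add: abs_mult)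
  let ?k = "\<lambda>x y. gauss_kernel e (x + y)" and ?m = "\<lambda>x y. (ennreal ((norm (f x))\<^sup>2) + ennreal ((norm (f' y))\<^sup>2)) / 2"
  have "(\<integral>\<^sup>+\<xi>. ennreal ((norm (fint f \<xi>))\<^sup>2 * gauss e \<xi>) \<partial>lborel)
      = ennreal (norm (complex_of_real (LINT \<xi>|lborel. (norm (fint f \<xi>))\<^sup>2 * gauss e \<xi>)))"
    using i by (subst nn_integral_eq_integral) auto
  also have "complex_of_real (LINT \<xi>|lborel. (norm (fint f \<xi>))\<^sup>2 * gauss e \<xi>) = (LINT \<xi>|lborel. fint f \<xi> * ?g \<xi>)"
    unfolding eq by (rule integral_complex_of_real[symmetric])
  also have "\<dots> = (LINT x|lborel. f x * fint ?g x)"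
    by (rule fint_multiplication[OF f g])
  also have "\<dots> = (LINT x|lborel. f x * (LINT y|lborel. f' y * of_real (?k x y)))"
    by (simp add: fint_mult_gauss[OF f' e])
  also have "ennreal (norm \<dots>) \<le> (\<integral>\<^sup>+x. ennreal (norm (f x * (LINT y|lborel. f' y * of_real (?k x y)))) \<partial>lborel)"
    by (rule nn_integral_norm_bound)
  also have "\<dots> \<le> (\<integral>\<^sup>+x. \<integral>\<^sup>+y. ?m x y * ennreal (?k x y) \<partial>lborel \<partial>lborel)"
  proof (rule nn_integral_mono)
    fix x :: "real^'n"
    have "ennreal (norm (f x * (LINT y|lborel. f' y * of_real (?k x y))))
       \<le> ennreal (norm (f x)) * (\<integral>\<^sup>+y. ennreal (norm (f' y * of_real (?k x y))) \<partial>lborel)"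
      unfolding norm_mult[of "f x"] ennreal_mult''[OF norm_ge_zero]
      by (intro mult_left_mono nn_integral_norm_bound) simp
    also have "\<dots> = (\<integral>\<^sup>+y. ennreal (norm (f x) * norm (f' y) * ?k x y) \<partial>lborel)"
      using e by (subst nn_integral_cmult[symmetric])
        (auto simp: norm_mult gauss_kernel_nonneg ennreal_mult mult.assoc)
    also have "\<dots> \<le> (\<integral>\<^sup>+y. ?m x y * ennreal (?k x y) \<partial>lborel)"
    proof (rule nn_integral_mono)
      fix y :: "real^'n"
      have "norm (f x) * norm (f' y) \<le> ((norm (f x))\<^sup>2 + (norm (f' y))\<^sup>2) / 2"
        using zero_le_power2[of "norm (f x) - norm (f' y)"] by (simp add: power2_eq_square algebra_simps)
      then have "ennreal (norm (f x) * norm (f' y)) \<le> ennreal (((norm (f x))\<^sup>2 + (norm (f' y))\<^sup>2) / 2)"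
        by (rule ennreal_leI)
      also have "\<dots> = (ennreal ((norm (f x))\<^sup>2) + ennreal ((norm (f' y))\<^sup>2)) / 2"
        by (simp add: divide_ennreal[symmetric])
      finally show "ennreal (norm (f x) * norm (f' y) * ?k x y) \<le>
           ?m x y * ennreal (?k x y)"
        using e by (simp add: ennreal_mult gauss_kernel_nonneg mult_right_mono)
    qed
    finally show "ennreal (norm (f x * (LINT y|lborel. f' y * of_real (?k x y))))
       \<le> (\<integral>\<^sup>+y. ?m x y * ennreal (?k x y) \<partial>lborel)" .
  qed
  also have "\<dots> = (\<integral>\<^sup>+x. \<integral>\<^sup>+y. (ennreal ((norm (f x))\<^sup>2) / 2 * ennreal (?k x y)) \<partial>lborel \<partial>lborel)
      + (\<integral>\<^sup>+x. \<integral>\<^sup>+y. (ennreal ((norm (f' y))\<^sup>2) / 2 * ennreal (?k x y)) \<partial>lborel \<partial>lborel)"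
    by (simp add: add_divide_distrib_ennreal distrib_right nn_integral_add)
  also have "(\<integral>\<^sup>+x. \<integral>\<^sup>+y. (ennreal ((norm (f x))\<^sup>2) / 2 * ennreal (?k x y)) \<partial>lborel \<partial>lborel)
      = ennreal ((2 * pi) ^ CARD('n)) * l2sq lborel f / 2"
    using e by (simp add: nn_integral_cmult nn_integral_multc nn_integral_divide gauss_kernel_nn_integral l2sq_def mult.commute ennreal_times_divide)
  also have "(\<integral>\<^sup>+x. \<integral>\<^sup>+y. (ennreal ((norm (f' y))\<^sup>2) / 2 * ennreal (?k x y)) \<partial>lborel \<partial>lborel)
      = (\<integral>\<^sup>+y. \<integral>\<^sup>+x. (ennreal ((norm (f' y))\<^sup>2) / 2 * ennreal (gauss_kernel e (y + x))) \<partial>lborel \<partial>lborel)"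
    by (subst lborel_pair.Fubini') (auto simp: add.commute)
  also have "\<dots> = ennreal ((2 * pi) ^ CARD('n)) * l2sq lborel f' / 2"
    using e by (simp add: nn_integral_cmult nn_integral_multc nn_integral_divide gauss_kernel_nn_integral l2sq_def mult.commute ennreal_times_divide)
  also have "l2sq lborel f' = l2sq lborel f"
    using l2sq_lborel_reflect[of f] by (simp add: f'_def l2sq_def)
  also have "ennreal ((2 * pi) ^ CARD('n)) * l2sq lborel f / 2 + ennreal ((2 * pi) ^ CARD('n)) * l2sq lborel f / 2
      = ennreal ((2 * pi) ^ CARD('n)) * l2sq lborel f"
    by (rule ennreal_half_add_half)
  finally show ?thesis .
qed

lemma gauss_tendsto: "(\<lambda>k. gauss (1 / real (Suc k)) \<xi>) \<longlonglongrightarrow> 1"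
proof -
  have "(\<lambda>k. exp (- (1 / real (Suc k) * norm \<xi>)\<^sup>2 / 2)) \<longlonglongrightarrow> exp (- (0 * norm \<xi>)\<^sup>2 / 2)"
    by (intro tendsto_intros LIMSEQ_Suc[OF lim_1_over_n]) auto
  then show ?thesis by (simp add: gauss_def)
qed

text \<open>
  The weighted inequality is uniform in \<open>e\<close>, so Fatou's lemma removes the Gaussian.
\<close>

theorem fint_Bessel:
  fixes f :: "real^'n \<Rightarrow> complex"
  assumes f: "integrable lborel f"
  shows "l2sq lborel (fint f) \<le> ennreal ((2 * pi) ^ CARD('n)) * l2sq lborel f"
proof -
  have [measurable]: "f \<in> borel_measurable borel" using f by auto
  have "l2sq lborel (fint f) = (\<integral>\<^sup>+\<xi>. liminf (\<lambda>k. ennreal ((norm (fint f \<xi>))\<^sup>2 * gauss (1 / real (Suc k)) \<xi>)) \<partial>lborel)"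
    unfolding l2sq_def
  proof (rule nn_integral_cong)
    fix \<xi> :: "real^'n"
    have "(\<lambda>k. ennreal ((norm (fint f \<xi>))\<^sup>2 * gauss (1 / real (Suc k)) \<xi>)) \<longlonglongrightarrow> ennreal ((norm (fint f \<xi>))\<^sup>2 * 1)"
      by (intro tendsto_ennrealI tendsto_intros gauss_tendsto)
    then show "ennreal ((norm (fint f \<xi>))\<^sup>2) = liminf (\<lambda>k. ennreal ((norm (fint f \<xi>))\<^sup>2 * gauss (1 / real (Suc k)) \<xi>))"
      by (intro lim_imp_Liminf[symmetric]) auto
  qed
  also have "\<dots> \<le> liminf (\<lambda>k. \<integral>\<^sup>+\<xi>. ennreal ((norm (fint f \<xi>))\<^sup>2 * gauss (1 / real (Suc k)) \<xi>) \<partial>lborel)"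
    by (rule nn_integral_liminf) simp
  also have "\<dots> \<le> ennreal ((2 * pi) ^ CARD('n)) * l2sq lborel f"
    by (intro Liminf_le always_eventually allI fint_weighted_Bessel f) auto
  finally show ?thesis .
qed

section \<open>The Fourier transform on \<open>L\<^sup>2\<close>\<close>

lemma cball_borel [measurable]: "cball (a::'a::euclidean_space) R \<in> sets borel"
  by (intro borel_closed closed_cball)

lemma box_borel [measurable]: "box (a::'a::euclidean_space) b \<in> sets borel"
  by (intro borel_open open_box)

lemma indicator_L2_space:
  fixes A :: "'a::euclidean_space set"
  assumes [measurable]: "A \<in> sets borel" and "emeasure lborel A < \<infinity>"
  shows "(indicator A :: 'a \<Rightarrow> complex) \<in> L2_space lborel"
proof -
  have "l2sq lborel (indicator A :: 'a \<Rightarrow> complex) = (\<integral>\<^sup>+x. indicator A x \<partial>lborel)"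
    unfolding l2sq_def by (intro nn_integral_cong) (auto split: split_indicator)
  then show ?thesis using assms by (simp add: L2_space_iff)
qed

lemma L2_integrable_on_finite_measure:
  fixes f :: "'a::euclidean_space \<Rightarrow> complex"
  assumes f: "f \<in> L2_space lborel" and A: "A \<in> sets borel" "emeasure lborel A < \<infinity>"
  shows "integrable lborel (\<lambda>x. f x * indicator A x)"
  by (rule L2_mult_integrable[OF f indicator_L2_space[OF A]])

definition trunc :: "real \<Rightarrow> ('a::euclidean_space \<Rightarrow> complex) \<Rightarrow> 'a \<Rightarrow> complex" where
  "trunc R f x = f x * indicator (cball 0 R) x"

lemma trunc_L2_space: "f \<in> L2_space lborel \<Longrightarrow> trunc R f \<in> L2_space lborel"
  by (rule L2_space_bound[of f])
     (auto simp: trunc_def[abs_def] L2_space_iff split: split_indicator)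

lemma trunc_integrable: "f \<in> L2_space lborel \<Longrightarrow> integrable lborel (trunc R f)"
  unfolding trunc_def[abs_def]
  by (intro L2_integrable_on_finite_measure cball_borel emeasure_lborel_cball_finite)

lemma trunc_diff: "trunc R (\<lambda>x. f x - g x) = (\<lambda>x. trunc R f x - trunc R g x)"
  by (auto simp: trunc_def algebra_simps)

text \<open>
  Dominated convergence along integer radii; the error decreases in the radius, which covers the rest.
\<close>

lemma trunc_tendsto:
  assumes f: "f \<in> L2_space lborel"
  shows "tendsto_L2 lborel (\<lambda>R. trunc R f) f at_top"
proof -
  have [measurable]: "f \<in> borel_measurable borel" using f by auto
  let ?d = "\<lambda>R. l2sq lborel (\<lambda>x. trunc R f x - f x)" and ?r = "\<lambda>x N. ennreal ((norm (trunc (real N) f x - f x))\<^sup>2)"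
  have "(\<lambda>N. ?d (real N)) \<longlonglongrightarrow> (\<integral>\<^sup>+x. 0 \<partial>(lborel::'a measure))"
    unfolding l2sq_def
  proof (rule nn_integral_dominated_convergence[where w = "\<lambda>x. ennreal ((norm (f x))\<^sup>2)"])
    show "(\<integral>\<^sup>+x. ennreal ((norm (f x))\<^sup>2) \<partial>lborel) < \<infinity>"
      using f by (auto simp: L2_space_iff l2sq_def)
    show "AE x in lborel. (\<lambda>N. ?r x N) \<longlonglongrightarrow> 0"
    proof (rule AE_I2)
      fix x :: 'a
      obtain N0 :: nat where N0: "norm x \<le> real N0" using real_arch_simple by blast
      have "\<forall>\<^sub>F N in sequentially. ?r x N = 0"
        using eventually_ge_at_top[of N0] by eventually_elim (use N0 in \<open>auto simp: trunc_def\<close>)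
      then show "(\<lambda>N. ?r x N) \<longlonglongrightarrow> 0"
        by (rule tendsto_eventually)
    qed
    show "AE x in lborel. ?r x N \<le> ennreal ((norm (f x))\<^sup>2)" for N
      by (auto simp: trunc_def split: split_indicator)
  qed (auto simp: trunc_def[abs_def])
  then have seq: "(\<lambda>N. ?d (real N)) \<longlonglongrightarrow> 0" by simp
  show ?thesis unfolding tendsto_L2_iff
  proof (rule order_tendstoI)
    fix a :: ennreal assume "0 < a"
    then obtain N where N: "?d (real N) < a"
      using order_tendstoD(2)[OF seq] by (auto simp: eventually_sequentially)
    have mono: "?d R \<le> ?d (real N)" if "R \<ge> real N" for R
      using that by (intro l2sq_mono) (auto simp: trunc_def split: split_indicator)
    show "\<forall>\<^sub>F R in at_top. ?d R < a"
      using eventually_ge_at_top[of "real N"] by (rule eventually_mono) (rule le_less_trans[OF mono N])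
  qed simp
qed

lemma fint_L2_space:
  fixes f :: "real^'n \<Rightarrow> complex"
  assumes "integrable lborel f" "f \<in> L2_space lborel"
  shows "fint f \<in> L2_space lborel"
proof -
  have "l2sq lborel (fint f) < \<infinity>"
    using fint_Bessel[OF assms(1)] assms(2)
    by (auto simp: L2_space_iff ennreal_mult_less_top intro: le_less_trans)
  then show ?thesis using assms by (auto simp: L2_space_iff)
qed

lemma ball_integral_eq_fint:
  "(LINT x:cball 0 R|lborel. f x * cis (- (x \<bullet> \<xi>))) = fint (trunc R f) \<xi>"
  unfolding set_lebesgue_integral_def fint_def trunc_def
  by (intro Bochner_Integration.integral_cong) (auto split: split_indicator)

text \<open>
  Truncations of a square-integrable function to balls are integrable and form a Cauchy family, and
  Bessel's inequality carries this over to their Fourier integrals.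
\<close>

lemma fourier_exists:
  fixes f :: "real^'n \<Rightarrow> complex"
  assumes f: "f \<in> L2_space lborel"
  shows "\<exists>F \<in> L2_space lborel. tendsto_L2 lborel (\<lambda>R. fint (trunc R f)) F at_top"
proof (rule L2_complete)
  show "fint (trunc R f) \<in> L2_space lborel" for R
    by (intro fint_L2_space trunc_integrable trunc_L2_space f)
  fix e :: real assume "e > 0"
  have [measurable]: "f \<in> borel_measurable borel" "trunc R f \<in> borel_measurable borel" for R
    using f trunc_L2_space[OF f, of R] by auto
  \<comment> \<open>Bessel contributes \<open>(2\<pi>)\<^sup>n\<close>, the two halves of the quasi-triangle inequality a factor \<open>4\<close>.\<close>
  define c where "c = 4 * (2 * pi) ^ CARD('n)"
  have c: "c > 0" by (simp add: c_def)
  let ?P = "\<lambda>R. l2sq lborel (\<lambda>x. trunc R f x - f x) < ennreal (e / c)"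
  let ?D = "\<lambda>R S. l2sq lborel (\<lambda>\<xi>. fint (trunc R f) \<xi> - fint (trunc S f) \<xi>)" and ?c = "ennreal ((2 * pi) ^ CARD('n))"
  have "eventually ?P at_top"
    using trunc_tendsto[OF f] c \<open>e > 0\<close> unfolding tendsto_L2_iff by (intro order_tendstoD(2)) auto
  moreover have "?D R S \<le> ennreal e" if "?P R" "?P S" for R S
  proof -
    have "?D R S
        = l2sq lborel (fint (\<lambda>x. trunc R f x - trunc S f x))"
      by (intro arg_cong[where f = "l2sq lborel"]) (auto simp: fint_diff trunc_integrable f)
    also have "\<dots> \<le> ?c * l2sq lborel (\<lambda>x. trunc R f x - trunc S f x)"
      by (intro fint_Bessel Bochner_Integration.integrable_diff trunc_integrable f)
    also have "\<dots> \<le> ?c *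
        (2 * l2sq lborel (\<lambda>x. trunc R f x - f x) + 2 * l2sq lborel (\<lambda>x. f x - trunc S f x))"
      by (intro mult_left_mono l2sq_triangle) auto
    also have "\<dots> \<le> ?c * (2 * ennreal (e / c) + 2 * ennreal (e / c))"
      using that by (intro mult_left_mono add_mono) (auto simp: l2sq_minus_commute[of _ f] less_imp_le)
    also have "2 * ennreal (e / c) + 2 * ennreal (e / c) = ennreal 4 * ennreal (e / c)"
      by (simp flip: distrib_right)
    also have "\<dots> = ennreal (4 * (e / c))"
      using c \<open>e > 0\<close> by (intro ennreal_mult[symmetric]) auto
    also have "?c * \<dots> = ennreal ((2 * pi) ^ CARD('n) * (4 * (e / c)))"
      using c \<open>e > 0\<close> by (intro ennreal_mult[symmetric]) auto
    also have "(2 * pi) ^ CARD('n) * (4 * (e / c)) = e" by (simp add: c_def)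
    finally show ?thesis .
  qed
  ultimately show "\<exists>P. eventually P at_top \<and> (\<forall>R S. P R \<longrightarrow> P S \<longrightarrow>
      ?D R S \<le> ennreal e)"
    by (intro exI[of _ ?P]) auto
qed simp

lemma
  fixes f :: "real^'n \<Rightarrow> complex"
  assumes f: "f \<in> L2_space lborel"
  shows fourier_L2_space: "fourier f \<in> L2_space lborel"
    and fourier_tendsto: "tendsto_L2 lborel (\<lambda>R. fint (trunc R f)) (fourier f) at_top"
proof -
  have "\<exists>F. F \<in> L2_space lborel \<and> tendsto_L2 lborel (\<lambda>R. fint (trunc R f)) F at_top"
    using fourier_exists[OF f] by auto
  from someI_ex[OF this] show "fourier f \<in> L2_space lborel" "tendsto_L2 lborel (\<lambda>R. fint (trunc R f)) (fourier f) at_top"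
    unfolding fourier_def ball_integral_eq_fint by auto
qed

lemma fourier_cong_AE:
  fixes f g :: "real^'n \<Rightarrow> complex"
  assumes "AE x in lborel. f x = g x" and [measurable]: "f \<in> borel_measurable borel" "g \<in> borel_measurable borel"
  shows "fourier f = fourier g"
proof -
  have "fint (trunc R f) \<xi> = fint (trunc R g) \<xi>" for R \<xi>
    unfolding fint_def trunc_def by (intro integral_cong_AE) (use assms(1) in auto)
  then show ?thesis unfolding fourier_def ball_integral_eq_fint by simp
qed

lemma fourier_diff:
  fixes f g :: "real^'n \<Rightarrow> complex"
  assumes f: "f \<in> L2_space lborel" and g: "g \<in> L2_space lborel"
  shows "AE \<xi> in lborel. fourier (\<lambda>x. f x - g x) \<xi> = fourier f \<xi> - fourier g \<xi>"
proof (rule tendsto_L2_unique)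
  let ?u = "\<lambda>R. fint (trunc R (\<lambda>x. f x - g x))"
  have [measurable]: "f \<in> borel_measurable borel" "g \<in> borel_measurable borel"
    "fourier f \<in> borel_measurable borel" "fourier g \<in> borel_measurable borel"
    "trunc R f \<in> borel_measurable borel" "trunc R g \<in> borel_measurable borel" for R
    using f g fourier_L2_space[OF f] fourier_L2_space[OF g] trunc_L2_space[OF f, of R] trunc_L2_space[OF g, of R] by auto
  note fg = L2_space_diff[OF f g]
  let ?f = "\<lambda>R. l2sq lborel (\<lambda>\<xi>. fint (trunc R f) \<xi> - fourier f \<xi>)" and ?g = "\<lambda>R. l2sq lborel (\<lambda>\<xi>. fint (trunc R g) \<xi> - fourier g \<xi>)"
  show "tendsto_L2 lborel ?u (fourier (\<lambda>x. f x - g x)) at_top" by (rule fourier_tendsto[OF fg])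
  have eq: "fint (trunc R (\<lambda>x. f x - g x)) \<xi> = fint (trunc R f) \<xi> - fint (trunc R g) \<xi>" for R \<xi>
    unfolding trunc_diff by (intro fint_diff trunc_integrable f g)
  show "tendsto_L2 lborel ?u (\<lambda>\<xi>. fourier f \<xi> - fourier g \<xi>) at_top"
    unfolding tendsto_L2_iff
  proof (rule tendsto_zero_boundI)
    show "l2sq lborel (\<lambda>\<xi>. ?u R \<xi> - (fourier f \<xi> - fourier g \<xi>)) \<le>
        2 * (?f R + ?g R)" for R
      using l2sq_diff[of "\<lambda>\<xi>. fint (trunc R f) \<xi> - fourier f \<xi>" lborel "\<lambda>\<xi>. fint (trunc R g) \<xi> - fourier g \<xi>"]
      by (simp add: eq algebra_simps)
    show "((\<lambda>R. ?f R + ?g R) \<longlongrightarrow> 0) at_top"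
      using tendsto_add[OF fourier_tendsto[OF f, unfolded tendsto_L2_iff] fourier_tendsto[OF g, unfolded tendsto_L2_iff]] by simp
  qed simp
  show "fourier (\<lambda>x. f x - g x) \<in> borel_measurable lborel" using fourier_L2_space[OF fg] by auto
  show "?u R \<in> borel_measurable lborel" for R using trunc_L2_space[OF fg, of R] by auto
  show "(\<lambda>\<xi>. fourier f \<xi> - fourier g \<xi>) \<in> borel_measurable lborel"
    using L2_space_diff[OF fourier_L2_space[OF f] fourier_L2_space[OF g]] by auto
qed auto

text \<open>
  The factor \<open>2\<close> is that of the quasi-triangle inequality and does no harm to continuity arguments.
\<close>

lemma l2sq_tendsto_bound:
  assumes "F \<noteq> bot" and u: "\<And>i. u i \<in> borel_measurable M" "f \<in> borel_measurable M"
    and lim: "tendsto_L2 M u f F" and le: "\<And>i. l2sq M (u i) \<le> C"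
  shows "l2sq M f \<le> 2 * C"
proof -
  have "l2sq M f \<le> 2 * C + 2 * l2sq M (\<lambda>x. u i x - f x)" for i
  proof -
    have "l2sq M f \<le> 2 * l2sq M (u i) + 2 * l2sq M (\<lambda>x. u i x - f x)"
      using l2sq_diff[of "u i" M "\<lambda>x. u i x - f x"] u by simp
    also have "\<dots> \<le> 2 * C + 2 * l2sq M (\<lambda>x. u i x - f x)"
      by (intro add_mono mult_left_mono le) auto
    finally show ?thesis .
  qed
  moreover have "((\<lambda>i. 2 * C + 2 * l2sq M (\<lambda>x. u i x - f x)) \<longlongrightarrow> 2 * C + 2 * 0) F"
    using lim unfolding tendsto_L2_iff by (intro tendsto_add tendsto_const tendsto_mult_ennreal) auto
  ultimately have "l2sq M f \<le> 2 * C + 2 * 0"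
    by (intro tendsto_lowerbound[OF _ _ assms(1)]) auto
  then show ?thesis by simp
qed

lemma fourier_bound:
  fixes f :: "real^'n \<Rightarrow> complex"
  assumes f: "f \<in> L2_space lborel"
  shows "l2sq lborel (fourier f) \<le> 2 * (ennreal ((2 * pi) ^ CARD('n)) * l2sq lborel f)"
proof (rule l2sq_tendsto_bound[OF _ _ _ fourier_tendsto[OF f]])
  fix R
  have "l2sq lborel (fint (trunc R f)) \<le> ennreal ((2 * pi) ^ CARD('n)) * l2sq lborel (trunc R f)"
    by (intro fint_Bessel trunc_integrable f)
  also have "\<dots> \<le> ennreal ((2 * pi) ^ CARD('n)) * l2sq lborel f"
    by (intro mult_left_mono l2sq_mono) (auto simp: trunc_def split: split_indicator)
  finally show "l2sq lborel (fint (trunc R f)) \<le> ennreal ((2 * pi) ^ CARD('n)) * l2sq lborel f" .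
  have [measurable]: "trunc R f \<in> borel_measurable borel" using trunc_L2_space[OF f, of R] by auto
  show "fint (trunc R f) \<in> borel_measurable lborel" by simp
qed (use fourier_L2_space[OF f] in auto)

text \<open>
  Pairing with a fixed square-integrable function is continuous, so the multiplication formula survives
  the limit that defines the transform.
\<close>

lemma fourier_multiplication:
  fixes f g :: "real^'n \<Rightarrow> complex"
  assumes f: "f \<in> L2_space lborel" and g: "integrable lborel g" "g \<in> L2_space lborel"
  shows "(LINT \<xi>|lborel. fourier f \<xi> * g \<xi>) = (LINT x|lborel. f x * fint g x)"
proof (rule tendsto_unique)
  show "((\<lambda>R. LINT \<xi>|lborel. fint (trunc R f) \<xi> * g \<xi>) \<longlongrightarrow> (LINT \<xi>|lborel. fourier f \<xi> * g \<xi>)) (at_top :: real filter)"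
    by (intro tendsto_L2_integral_mult fourier_tendsto fourier_L2_space fint_L2_space trunc_integrable trunc_L2_space f g)
  show "((\<lambda>R. LINT \<xi>|lborel. fint (trunc R f) \<xi> * g \<xi>) \<longlongrightarrow> (LINT x|lborel. f x * fint g x)) (at_top :: real filter)"
    by (subst fint_multiplication[OF trunc_integrable[OF f] g(1)])
       (intro tendsto_L2_integral_mult trunc_tendsto fint_L2_space trunc_L2_space f g)
qed simp

section \<open>Fourier inversion\<close>

text \<open>
  Boxes are stable under intersection and generate the Borel sets, so the integral vanishes over every
  Borel set.
\<close>

lemma AE_zero_if_box_integrals_zero:
  fixes F :: "'a::euclidean_space \<Rightarrow> complex"
  assumes F: "integrable lborel F"
    and zero: "\<And>a b. (LINT x|lborel. F x * indicator (box a b) x) = 0"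
    and zero_UNIV: "(LINT x|lborel. F x) = 0"
  shows "AE x in lborel. F x = 0"
proof (rule sigma_finite_measure.density_zero[OF sigma_finite_lborel F])
  have int: "integrable lborel (\<lambda>x. F x * indicator A x)" if "A \<in> sets borel" for A
    using integrable_mult_indicator[OF _ F, of A] that
    by (auto simp: scaleR_conv_of_real of_real_indicator mult.commute)
  fix A :: "'a set" assume "A \<in> sets lborel"
  then have A: "A \<in> sigma_sets UNIV (range (\<lambda>(a, b). box a b))"
    by (simp add: borel_eq_box)
  have sets: "sigma_sets UNIV (range (\<lambda>(a, b). box a b)) = sets (borel :: 'a measure)"
    by (simp add: borel_eq_box)
  have sub: "range (\<lambda>(a, b). box a b :: 'a set) \<subseteq> Pow UNIV" by simp
  have stable: "Int_stable (range (\<lambda>(a, b). box a b :: 'a set))"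
    by (auto simp: Int_stable_def box_Int_box)
  have "(LINT x|lborel. F x * indicator A x) = 0"
    using stable sub A
  proof (induction rule: sigma_sets_induct_disjoint)
    case (basic A) then show ?case using zero by auto
  next
    case (compl A)
    then have A: "A \<in> sets borel" using sets by simp
    have "(LINT x|lborel. F x * indicator (UNIV - A) x) = (LINT x|lborel. F x - F x * indicator A x)"
      by (intro Bochner_Integration.integral_cong) (auto split: split_indicator)
    then show ?case using compl(2) zero_UNIV int[OF A] F by simp
  next
    case (union A)
    then have A: "A i \<in> sets borel" for i using sets by auto
    have "(\<lambda>n. LINT x|lborel. F x * indicator (\<Union>i<n. A i) x) \<longlonglongrightarrow> (LINT x|lborel. F x * indicator (\<Union>i. A i) x)"
    proof (rule integral_dominated_convergence[where w = "\<lambda>x. norm (F x)"])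
      show "integrable lborel (\<lambda>x. norm (F x))" using F by simp
      show "AE x in lborel. (\<lambda>n. F x * indicator (\<Union>i<n. A i) x) \<longlonglongrightarrow> F x * indicator (\<Union>i. A i) x"
        by (intro AE_I2 tendsto_mult tendsto_const LIMSEQ_indicator_UN)
      show "AE x in lborel. norm (F x * indicator (\<Union>i<n. A i) x) \<le> norm (F x)" for n
        by (auto split: split_indicator)
    qed (use A int in auto)
    moreover have "(LINT x|lborel. F x * indicator (\<Union>i<n. A i) x) = 0" for n
    proof -
      have "(indicator (\<Union>i<n. A i) x :: complex) = (\<Sum>i<n. indicator (A i) x)" for x
        using union(1) by (intro indicator_UN_disjoint) (auto simp: disjoint_family_on_def)
      then have "(LINT x|lborel. F x * indicator (\<Union>i<n. A i) x) = (LINT x|lborel. (\<Sum>i<n. F x * indicator (A i) x))"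
        by (simp add: sum_distrib_left)
      also have "\<dots> = (\<Sum>i<n. (LINT x|lborel. F x * indicator (A i) x))"
        by (intro Bochner_Integration.integral_sum int A)
      finally show ?thesis using union(3) by simp
    qed
    ultimately show ?case by (simp add: LIMSEQ_const_iff)
  qed auto
  then show "set_lebesgue_integral lborel A F = 0"
    unfolding set_lebesgue_integral_def
    by (simp add: scaleR_conv_of_real of_real_indicator mult.commute)
qed

lemma L2_AE_zero_if_box_integrals_zero:
  fixes F :: "'a::euclidean_space \<Rightarrow> complex"
  assumes F: "F \<in> L2_space lborel"
    and zero: "\<And>a b. (LINT x|lborel. F x * indicator (box a b) x) = 0"
  shows "AE x in lborel. F x = 0"
proof -
  let ?B = "\<lambda>n::nat. box (- (real n *\<^sub>R One)) (real n *\<^sub>R One) :: 'a set"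
  have "AE x in lborel. F x * indicator (?B n) x = 0" for n
  proof (rule AE_zero_if_box_integrals_zero)
    show "integrable lborel (\<lambda>x. F x * indicator (?B n) x)"
      by (intro L2_integrable_on_finite_measure F box_borel emeasure_lborel_box_finite)
    show "(LINT x|lborel. F x * indicator (?B n) x * indicator (box a b) x) = 0" for a b
      using zero by (simp add: mult.assoc box_Int_box flip: indicator_inter_arith)
  qed (rule zero)
  then have "AE x in lborel. \<forall>n. F x * indicator (?B n) x = 0" by (subst AE_all_countable) blast
  then show ?thesis
  proof eventually_elim
    fix x assume *: "\<forall>n. F x * indicator (?B n) x = 0"
    have "x \<in> (\<Union>n. ?B n)" using UN_box_eq_UNIV by auto
    then obtain n where "x \<in> ?B n" by auto
    then show "F x = 0" using *[rule_format, of n] by simp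
  qed
qed

text \<open>
  After the substitution \<open>y = e w - x\<close> the kernel no longer depends on \<open>e\<close>, and the indicator at
  \<open>e w - x\<close> is eventually constant unless \<open>-x\<close> lies on the boundary of the box.
\<close>

lemma gauss_mollify_box:
  fixes x a b :: "real^'n"
  assumes x: "- x \<notin> frontier (box a b)"
  shows "(\<lambda>k. LINT y|lborel. indicator (box a b) y * complex_of_real (gauss_kernel (1 / real (Suc k)) (x + y)))
    \<longlonglongrightarrow> complex_of_real ((2 * pi) ^ CARD('n)) * indicator (box a b) (- x)"
proof -
  let ?e = "\<lambda>k. 1 / real (Suc k)"
  let ?I = "indicator (box a b) :: real^'n \<Rightarrow> complex"
  let ?g = "\<lambda>k w. ?I (- x + ?e k *\<^sub>R w) * complex_of_real (gauss_kernel 1 w)" and ?l = "\<lambda>k. LINT y|lborel. ?I y * complex_of_real (gauss_kernel (?e k) (x + y))"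
  have "?l k
      = (LINT w|lborel. ?g k w)" for k
  proof -
    have e: "?e k > 0" by simp
    have "?l k
      = (\<bar>?e k\<bar> ^ DIM(real^'n)) *\<^sub>R (LINT w|lborel. ?I (- x + ?e k *\<^sub>R w) * complex_of_real (gauss_kernel (?e k) (x + (- x + ?e k *\<^sub>R w))))"
      by (rule integral_lborel_affine) auto
    also have "\<dots> = (LINT w|lborel. ?I (- x + ?e k *\<^sub>R w) * complex_of_real (?e k ^ CARD('n) * gauss_kernel (?e k) (?e k *\<^sub>R w)))"
      by (simp add: scaleR_conv_of_real mult_ac flip: integral_mult_right_zero)
    also have "\<dots> = (LINT w|lborel. ?g k w)"
      by (simp only: gauss_kernel_scale[OF e])
    finally show ?thesis .
  qed
  moreover have "(\<lambda>k. LINT w|lborel. ?g k w)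
      \<longlonglongrightarrow> (LINT w|lborel. ?I (- x) * complex_of_real (gauss_kernel 1 (w :: real^'n)))"
  proof (rule integral_dominated_convergence[where w = "gauss_kernel 1"])
    show "integrable lborel (gauss_kernel 1 :: real^'n \<Rightarrow> real)" by (rule integrable_gauss_kernel) simp
    show "AE w in lborel. (\<lambda>k. ?g k w) \<longlonglongrightarrow> ?I (- x) * complex_of_real (gauss_kernel 1 w)"
    proof (rule AE_I2)
      fix w :: "real^'n"
      have "(\<lambda>k. - x + ?e k *\<^sub>R w) \<longlonglongrightarrow> - x + 0 *\<^sub>R w"
        by (intro tendsto_intros LIMSEQ_Suc[OF lim_1_over_n])
      then have l: "(\<lambda>k. - x + ?e k *\<^sub>R w) \<longlonglongrightarrow> - x" by simp
      have "\<forall>\<^sub>F k in sequentially. ?I (- x + ?e k *\<^sub>R w) = ?I (- x)"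
      proof (cases "- x \<in> box a b")
        case True
        then have "\<forall>\<^sub>F k in sequentially. - x + ?e k *\<^sub>R w \<in> box a b"
          using l by (intro topological_tendstoD) auto
        then show ?thesis by eventually_elim (use True in auto)
      next
        case False
        then have "- x \<in> - closure (box a b)" using x by (auto simp: frontier_def interior_open[OF open_box])
        then have "\<forall>\<^sub>F k in sequentially. - x + ?e k *\<^sub>R w \<in> - closure (box a b)"
          using l by (intro topological_tendstoD) auto
        then show ?thesis by eventually_elim (use False closure_subset in \<open>auto split: split_indicator\<close>)
      qed
      then have "(\<lambda>k. ?I (- x + ?e k *\<^sub>R w)) \<longlonglongrightarrow> ?I (- x)" by (rule tendsto_eventually)
      then show "(\<lambda>k. ?g k w) \<longlonglongrightarrow> ?I (- x) * complex_of_real (gauss_kernel 1 w)"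
        by (intro tendsto_intros)
    qed
    show "AE w in lborel. norm (?g k w) \<le> gauss_kernel 1 w" for k
      by (auto simp: gauss_kernel_nonneg split: split_indicator)
  qed auto
  moreover have "(LINT w|lborel. ?I (- x) * complex_of_real (gauss_kernel 1 (w :: real^'n))) = complex_of_real ((2 * pi) ^ CARD('n)) * ?I (- x)"
    unfolding integral_mult_right_zero integral_complex_of_real gauss_kernel_integral[OF zero_less_one]
    by (rule mult.commute)
  ultimately show ?thesis by (simp only:)
qed


lemma indicator_box_L2_space: "(indicator (box a b) :: real^'n \<Rightarrow> complex) \<in> L2_space lborel"
  by (intro indicator_L2_space box_borel emeasure_lborel_box_finite)

lemma integrable_indicator_box: "integrable lborel (indicator (box a b) :: real^'n \<Rightarrow> complex)"
  using L2_mult_integrable[OF indicator_box_L2_space indicator_box_L2_space, of a b a b]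
  by (simp flip: indicator_inter_arith)

lemma frontier_box_null: "AE x in lborel. x \<notin> frontier (box a b :: (real^'n) set)"
proof (cases "box a b = {}")
  case False
  have "frontier (box a b) = cbox a b - box a b"
    using False by (simp add: frontier_def closure_box interior_open[OF open_box])
  then show ?thesis
    using AE_not_in[OF null_sets_cbox_Diff_box] by simp
qed (auto simp: frontier_def)

text \<open>
  Fourier inversion. Two square-integrable functions agree if their integrals over all boxes do. The
  integral of the double transform over a box is moved by the multiplication formula to the product of
  the transforms of \<open>K\<close> and of the indicator. A Gaussian inserted there turns it into the integral of
  \<open>K\<close> against a mollified indicator, where the damping can be removed by dominated convergence.
\<close>

theorem fourier_fint:
  fixes K :: "real^'n \<Rightarrow> complex"
  assumes K: "integrable lborel K" "K \<in> L2_space lborel"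
  shows "AE x in lborel. fourier (fint K) x = complex_of_real ((2 * pi) ^ CARD('n)) * K (- x)"
proof -
  let ?c = "complex_of_real ((2 * pi) ^ CARD('n))"
  let ?e = "\<lambda>k. 1 / real (Suc k)"
  have v: "fint K \<in> L2_space lborel" by (rule fint_L2_space[OF K])
  have [measurable]: "K \<in> borel_measurable borel" using K by auto
  have K': "(\<lambda>x. K (- x)) \<in> L2_space lborel"
    using K l2sq_lborel_reflect[of K] by (auto simp: L2_space_iff)
  have "AE x in lborel. fourier (fint K) x - ?c * K (- x) = 0"
  proof (rule L2_AE_zero_if_box_integrals_zero)
    show "(\<lambda>x. fourier (fint K) x - ?c * K (- x)) \<in> L2_space lborel"
      by (intro L2_space_diff fourier_L2_space v L2_space_cmult K')
    fix a b :: "real^'n"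
    let ?I = "indicator (box a b) :: real^'n \<Rightarrow> complex"
    note I = integrable_indicator_box[of a b] indicator_box_L2_space[of a b]
    have lhs: "(LINT x|lborel. fourier (fint K) x * ?I x) = (LINT \<xi>|lborel. fint K \<xi> * fint ?I \<xi>)"
      by (rule fourier_multiplication[OF v I])
    let ?m = "\<lambda>k x. LINT y|lborel. ?I y * of_real (gauss_kernel (?e k) (x + y))" and ?d = "\<lambda>k \<xi>. fint K \<xi> * (fint ?I \<xi> * of_real (gauss (?e k) \<xi>))"
    have step: "(LINT \<xi>|lborel. ?d k \<xi>)
        = (LINT x|lborel. K x * (?m k x))" for k
      by (subst fint_multiplication[OF K(1) integrable_fint_mult_gauss[OF I(1)]])
         (simp_all add: fint_mult_gauss[OF I(1)])
    have lim1: "(\<lambda>k. LINT \<xi>|lborel. ?d k \<xi>)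
        \<longlonglongrightarrow> (LINT \<xi>|lborel. fint K \<xi> * fint ?I \<xi>)"
    proof (rule integral_dominated_convergence[where w = "\<lambda>\<xi>. norm (fint K \<xi> * fint ?I \<xi>)"])
      show "integrable lborel (\<lambda>\<xi>. norm (fint K \<xi> * fint ?I \<xi>))"
        by (intro integrable_norm L2_mult_integrable v fint_L2_space I)
      show "AE \<xi> in lborel. (\<lambda>k. ?d k \<xi>) \<longlonglongrightarrow> fint K \<xi> * fint ?I \<xi>"
      proof (rule AE_I2)
        fix \<xi> :: "real^'n"
        have "(\<lambda>k. ?d k \<xi>) \<longlonglongrightarrow> fint K \<xi> * (fint ?I \<xi> * of_real 1)"
          by (intro tendsto_intros gauss_tendsto)
        then show "(\<lambda>k. ?d k \<xi>) \<longlonglongrightarrow> fint K \<xi> * fint ?I \<xi>" by simp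
      qed
      show "AE \<xi> in lborel. norm (?d k \<xi>) \<le> norm (fint K \<xi> * fint ?I \<xi>)" for k
        by (auto simp: norm_mult intro!: mult_left_mono mult_left_le)
    qed auto
    have bnd: "norm (?m k x) \<le> (2 * pi) ^ CARD('n)" for k x
    proof -
      have "ennreal (norm (?m k x))
          \<le> (\<integral>\<^sup>+y. ennreal (norm (?I y * of_real (gauss_kernel (?e k) (x + y)))) \<partial>lborel)"
        by (rule nn_integral_norm_bound)
      also have "\<dots> \<le> (\<integral>\<^sup>+y. ennreal (gauss_kernel (?e k) (x + y)) \<partial>lborel)"
        by (intro nn_integral_mono ennreal_leI) (auto simp: gauss_kernel_nonneg split: split_indicator)
      also have "\<dots> = ennreal ((2 * pi) ^ CARD('n))"
        by (rule gauss_kernel_nn_integral) simp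
      finally show ?thesis by (subst (asm) ennreal_le_iff) auto
    qed
    have lim2: "(\<lambda>k. LINT x|lborel. K x * (?m k x))
        \<longlonglongrightarrow> (LINT x|lborel. K x * (?c * ?I (- x)))"
    proof (rule integral_dominated_convergence[where w = "\<lambda>x. norm (K x) * (2 * pi) ^ CARD('n)"])
      show "integrable lborel (\<lambda>x. norm (K x) * (2 * pi) ^ CARD('n))" using K by simp
      show "AE x in lborel. (\<lambda>k. K x * (?m k x)) \<longlonglongrightarrow> K x * (?c * ?I (- x))"
        using AE_lborel_reflect[OF frontier_box_null[of a b]]
        by eventually_elim (intro tendsto_mult tendsto_const gauss_mollify_box)
      show "AE x in lborel. norm (K x * (?m k x)) \<le> norm (K x) * (2 * pi) ^ CARD('n)" for k
        unfolding norm_mult[of "K _"] by (intro AE_I2 mult_left_mono bnd) simp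
    qed auto
    have "(LINT \<xi>|lborel. fint K \<xi> * fint ?I \<xi>) = (LINT x|lborel. K x * (?c * ?I (- x)))"
      by (rule LIMSEQ_unique[OF lim1 lim2[folded step]])
    also have "\<dots> = (LINT x|lborel. ?c * K (- x) * ?I x)"
      by (subst integral_lborel_reflect[symmetric]) (auto simp: mult_ac)
    finally have "(LINT x|lborel. fourier (fint K) x * ?I x) = (LINT x|lborel. ?c * K (- x) * ?I x)"
      using lhs by simp
    then show "(LINT x|lborel. (fourier (fint K) x - ?c * K (- x)) * ?I x) = 0"
      unfolding left_diff_distrib
      by (subst Bochner_Integration.integral_diff)
         (auto intro!: L2_mult_integrable L2_space_cmult fourier_L2_space v K' I)
  qed
  then show ?thesis by simp
qed

text \<open>
  Transforming a truncation \<open>u\<close> twice returns \<open>u\<close> up to reflection and a constant, so boundedness of the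
  second transform bounds the norm of \<open>u\<close> by the norm of its first transform. If the transform of the
  full function vanishes, the transforms of its truncations tend to zero, and so do the truncations.
\<close>

theorem fourier_inj:
  fixes f g :: "real^'n \<Rightarrow> complex"
  assumes f: "f \<in> L2_space lborel" and g: "g \<in> L2_space lborel"
    and eq: "AE \<xi> in lborel. fourier f \<xi> = fourier g \<xi>"
  shows "AE x in lborel. f x = g x"
proof -
  define u where "u x = f x - g x" for x
  have u: "u \<in> L2_space lborel" unfolding u_def[abs_def] by (rule L2_space_diff[OF f g])
  have [measurable]: "u \<in> borel_measurable borel" "trunc R u \<in> borel_measurable borel"
    "fourier u \<in> borel_measurable borel" for R
    using u trunc_L2_space[OF u, of R] fourier_L2_space[OF u] by auto
  have z: "AE \<xi> in lborel. fourier u \<xi> = 0"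
    using fourier_diff[OF f g] eq by eventually_elim (simp add: u_def[abs_def])
  define c where "c = (2 * pi) ^ CARD('n)"
  have c: "c > 0" by (simp add: c_def)
  have bound: "ennreal (c\<^sup>2) * l2sq lborel (trunc R u) \<le> 2 * ennreal c * l2sq lborel (\<lambda>\<xi>. fint (trunc R u) \<xi> - fourier u \<xi>)" for R
  proof -
    note R = trunc_integrable[OF u, of R] trunc_L2_space[OF u, of R]
    have "ennreal (c\<^sup>2) * l2sq lborel (trunc R u) = l2sq lborel (\<lambda>x. complex_of_real c * trunc R u (- x))"
      by (subst l2sq_cmult) (use c in \<open>auto simp: l2sq_lborel_reflect\<close>)
    also have "\<dots> = l2sq lborel (fourier (fint (trunc R u)))"
      unfolding c_def using fourier_fint[OF R] by (intro l2sq_cong_AE) (auto elim: eventually_mono)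
    also have "\<dots> \<le> 2 * (ennreal c * l2sq lborel (fint (trunc R u)))"
      unfolding c_def by (intro fourier_bound fint_L2_space R)
    also have "l2sq lborel (fint (trunc R u)) = l2sq lborel (\<lambda>\<xi>. fint (trunc R u) \<xi> - fourier u \<xi>)"
      using z by (intro l2sq_cong_AE) (auto elim: eventually_mono)
    finally show ?thesis by (simp add: mult.assoc)
  qed
  have "((\<lambda>R. ennreal (c\<^sup>2) * l2sq lborel (trunc R u)) \<longlongrightarrow> 0) at_top"
    using bound fourier_tendsto[OF u, unfolded tendsto_L2_iff]
    by (rule tendsto_zero_boundI) (auto simp: ennreal_mult_less_top)
  then have lim: "((\<lambda>R. ennreal (1 / c\<^sup>2) * (ennreal (c\<^sup>2) * l2sq lborel (trunc R u))) \<longlongrightarrow> 0) at_top"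
    by (rule tendsto_zero_boundI[OF order_refl]) simp
  have "ennreal (1 / c\<^sup>2) * (ennreal (c\<^sup>2) * x) = x" for x
    using c by (simp add: mult.assoc[symmetric] ennreal_mult[symmetric])
  then have "tendsto_L2 lborel (\<lambda>R. trunc R u) (\<lambda>x. 0) at_top"
    using lim unfolding tendsto_L2_iff by simp
  then have "AE x in lborel. u x = 0"
    by (intro tendsto_L2_unique[OF _ _ _ _ trunc_tendsto[OF u]]) auto
  then show ?thesis by (simp add: u_def)
qed

section \<open>The inverse Fourier integral\<close>

text \<open>
  The reflection of the argument stands for the opposite sign in the exponential, so that results on
  \<^const>\<open>fint\<close> apply directly.
\<close>

definition ifint :: "(real ^ 'n \<Rightarrow> complex) \<Rightarrow> real ^ 'n \<Rightarrow> complex" where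
  "ifint K x = fint K (- x) / complex_of_real ((2 * pi) ^ CARD('n))"

lemma ifint_L2_space:
  fixes K :: "real^'n \<Rightarrow> complex"
  assumes K: "integrable lborel K" "K \<in> L2_space lborel"
  shows "ifint K \<in> L2_space lborel"
proof -
  have "(\<lambda>x. fint K (- x)) \<in> L2_space lborel"
    using fint_L2_space[OF K] l2sq_lborel_reflect[of "fint K"] by (auto simp: L2_space_iff)
  from L2_space_cmult[OF this, of "1 / complex_of_real ((2 * pi) ^ CARD('n))"]
  show ?thesis by (simp add: ifint_def[abs_def])
qed

lemma fourier_ifint:
  fixes K :: "real^'n \<Rightarrow> complex"
  assumes K: "integrable lborel K" "K \<in> L2_space lborel"
  shows "AE \<xi> in lborel. fourier (ifint K) \<xi> = K \<xi>"
proof -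
  let ?c = "complex_of_real ((2 * pi) ^ CARD('n))"
  have [measurable]: "K \<in> borel_measurable borel" using K by auto
  define K' where "K' x = 1 / ?c * K (- x)" for x
  have "ifint K x = fint K' x" for x
  proof -
    have "fint K' x = (LINT y|lborel. 1 / ?c * (K (- y) * cis (- (y \<bullet> x))))"
      unfolding fint_def K'_def by (simp add: mult.assoc)
    also have "\<dots> = (LINT y|lborel. 1 / ?c * (K y * cis (- (y \<bullet> - x))))"
      by (subst integral_lborel_reflect[symmetric]) auto
    finally show ?thesis unfolding ifint_def fint_def integral_mult_right_zero by simp
  qed
  then have eq: "ifint K = fint K'" by blast
  have "(\<lambda>x. K (- x)) \<in> L2_space lborel"
    using K l2sq_lborel_reflect[of K] by (auto simp: L2_space_iff)
  then have L2: "K' \<in> L2_space lborel" unfolding K'_def[abs_def] by (rule L2_space_cmult)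
  have L1: "integrable lborel K'"
    unfolding K'_def[abs_def] by (intro integrable_mult_right integrable_lborel_reflect K)
  from fourier_fint[OF L1 L2] show ?thesis
    unfolding eq K'_def by eventually_elim (simp add: field_simps)
qed

text \<open>
  Injectivity makes the choice in \<^const>\<open>inv_fourier\<close> immaterial, and inversion exhibits a candidate. This gives
  a pointwise integral formula for functions whose transform is integrable.
\<close>

lemma
  fixes V :: "real^'n \<Rightarrow> complex"
  assumes V: "integrable lborel V" "V \<in> L2_space lborel"
  shows inv_fourier_L2_space: "inv_fourier V \<in> L2_space lborel"
    and fourier_inv_fourier: "AE \<xi> in lborel. fourier (inv_fourier V) \<xi> = V \<xi>"
    and inv_fourier_eq_ifint: "AE x in lborel. inv_fourier V x = ifint V x"
proof -
  have "\<exists>u. u \<in> L2_space lborel \<and> (AE \<xi> in lborel. fourier u \<xi> = V \<xi>)"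
    using ifint_L2_space[OF V] fourier_ifint[OF V] by blast
  from someI_ex[OF this] show *: "inv_fourier V \<in> L2_space lborel" "AE \<xi> in lborel. fourier (inv_fourier V) \<xi> = V \<xi>"
    unfolding inv_fourier_def by auto
  show "AE x in lborel. inv_fourier V x = ifint V x"
    by (rule fourier_inj[OF *(1) ifint_L2_space[OF V]])
       (use *(2) fourier_ifint[OF V] in eventually_elim, simp)
qed

section \<open>The torus\<close>

text \<open>
  Extension by zero. Every statement about the torus is made about the extended function on the whole
  space, where translations and Fourier integrals are available.
\<close>

abbreviation on_torus :: "real \<Rightarrow> (real^'n \<Rightarrow> complex) \<Rightarrow> real^'n \<Rightarrow> complex" where
  "on_torus h f \<equiv> (\<lambda>\<xi>. indicator (torus h) \<xi> * f \<xi>)"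

lemma torus_borel [measurable]: "torus h \<in> sets borel"
  by (simp add: torus_def)

lemma torus_finite: "emeasure lborel (torus h) < \<infinity>"
  unfolding torus_def by (rule emeasure_lborel_cbox_finite)

lemma mem_torus: "\<xi> \<in> torus h \<longleftrightarrow> (\<forall>j. - pi / h \<le> \<xi> $ j \<and> \<xi> $ j \<le> pi / h)"
  by (simp add: torus_def mem_box_cart)

lemma l2sq_torus: "l2sq (torus_measure h) f = l2sq lborel (on_torus h f)"
  unfolding l2sq_def
  by (subst nn_integral_restrict_space)
     (auto simp: norm_mult power_mult_distrib intro!: nn_integral_cong split: split_indicator)

lemma borel_measurable_torus:
  fixes f :: "real^'n \<Rightarrow> complex"
  shows "f \<in> borel_measurable (torus_measure h) \<longleftrightarrow> on_torus h f \<in> borel_measurable borel"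
proof -
  have "(\<lambda>x. indicator (torus h) x *\<^sub>R f x) = on_torus h f"
    by (auto split: split_indicator)
  then show ?thesis by (subst borel_measurable_restrict_space_iff) auto
qed

lemma L2_space_torus: "f \<in> L2_space (torus_measure h) \<longleftrightarrow> on_torus h f \<in> L2_space lborel"
  by (simp add: L2_space_iff l2sq_torus borel_measurable_torus)

lemma tendsto_L2_torus:
  "tendsto_L2 (torus_measure h) u f F \<longleftrightarrow> tendsto_L2 lborel (\<lambda>i. on_torus h (u i)) (on_torus h f) F"
  unfolding tendsto_L2_iff l2sq_torus by (simp add: right_diff_distrib)

lemma on_torus_integrable:
  assumes "on_torus h f \<in> L2_space lborel"
  shows "integrable lborel (on_torus h f)"
proof -
  have "integrable lborel (\<lambda>\<xi>. on_torus h f \<xi> * indicator (torus h) \<xi>)"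
    by (rule L2_integrable_on_finite_measure[OF assms torus_borel torus_finite])
  moreover have "(\<lambda>\<xi>. on_torus h f \<xi> * indicator (torus h) \<xi>) = on_torus h f"
    by (auto split: split_indicator)
  ultimately show ?thesis by simp
qed

lemma on_torus_bounded_L2:
  fixes f :: "real^'n \<Rightarrow> complex"
  assumes [measurable]: "f \<in> borel_measurable borel" and B: "\<And>\<xi>. norm (f \<xi>) \<le> B"
  shows "on_torus h f \<in> L2_space lborel"
proof -
  have "(\<lambda>\<xi>. of_real B * indicator (torus h) \<xi>) \<in> L2_space lborel"
    by (intro L2_space_cmult indicator_L2_space torus_borel torus_finite)
  then show ?thesis
    by (rule L2_space_bound)
       (use B order_trans[OF norm_ge_zero B] in \<open>auto split: split_indicator\<close>)
qed

section \<open>Orthogonality of the characters\<close>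

lemma integral_cis_period:
  assumes "h > 0"
  shows "integrable lborel (\<lambda>t. indicator {- pi / h..pi / h} t * cis (- (h * of_int k * t)))" (is ?A)
    and "(LINT t|lborel. indicator {- pi / h..pi / h} t * cis (- (h * of_int k * t)))
      = (if k = 0 then of_real (2 * pi / h) else 0)" (is ?B)
proof -
  have le: "- pi / h \<le> pi / h" using assms by (simp add: field_simps)
  have eq: "(\<lambda>t. indicator {- pi / h..pi / h} t * cis (- (h * of_int k * t)))
      = (\<lambda>t. indicator {- pi / h..pi / h} t *\<^sub>R cis (- (h * of_int k * t)))"
    by (auto split: split_indicator)
  have cont: "continuous_on {- pi / h..pi / h} (\<lambda>t. cis (- (h * of_int k * t)))"
    by (intro continuous_intros)
  show ?A unfolding eq
    using borel_integrable_atLeastAtMost'[OF cont] by (simp add: set_integrable_def)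
  show ?B
  proof (cases "k = 0")
    case True
    have "(LINT t|lborel. indicator {- pi / h..pi / h} t *\<^sub>R cis (- (h * of_int k * t)))
        = of_real (pi / h) - of_real (- pi / h)"
    proof (rule integral_FTC_Icc[OF le _ cont])
      fix x assume "- pi / h \<le> x" "x \<le> pi / h"
      show "(complex_of_real has_vector_derivative cis (- (h * of_int k * x))) (at x within {- pi / h..pi / h})"
        using has_vector_derivative_of_real[OF DERIV_ident] True by simp
    qed
    then show ?thesis using True unfolding eq by simp
  next
    case False
    define c where "c = h * of_int k"
    have c: "c \<noteq> 0" using False assms by (simp add: c_def)
    have "(LINT t|lborel. indicator {- pi / h..pi / h} t *\<^sub>R cis (- (h * of_int k * t)))
        = \<i> / c * cis (- (c * (pi / h))) - \<i> / c * cis (- (c * (- pi / h)))"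
    proof (rule integral_FTC_Icc[OF le _ cont])
      fix x assume "- pi / h \<le> x" "x \<le> pi / h"
      show "((\<lambda>t. \<i> / c * cis (- (c * t))) has_vector_derivative cis (- (h * of_int k * x))) (at x within {- pi / h..pi / h})"
      proof -
        have "((\<lambda>z. \<i> / c * exp (- (\<i> * (c * z)))) has_field_derivative exp (- (\<i> * (c * complex_of_real x)))) (at (complex_of_real x))"
          using c by (auto intro!: derivative_eq_intros)
        from has_vector_derivative_real_field[OF this] show ?thesis
          by (simp add: cis_conv_exp c_def mult.assoc)
      qed
    qed
    also have "c * (pi / h) = pi * of_int k"
      using assms by (simp add: c_def)
    also have "c * (- pi / h) = - (pi * of_int k)"
      using assms by (simp add: c_def)
    also have "cis (- (pi * of_int k)) = cis (- (- (pi * of_int k)))"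
      by (simp add: complex_eq_iff)
    finally show ?thesis using False unfolding eq by simp
  qed
qed

lemma indicator_torus_prod:
  "(indicator (torus h) \<xi> :: complex) = (\<Prod>j\<in>UNIV. indicator {- pi / h..pi / h} (\<xi> $ j))"
proof (cases "\<xi> \<in> torus h")
  case False
  then obtain j where "\<xi> $ j \<notin> {- pi / h..pi / h}" by (auto simp: mem_torus)
  then have "(\<Prod>j\<in>UNIV. indicator {- pi / h..pi / h} (\<xi> $ j)) = (0::complex)"
    by (intro prod_zero bexI[of _ j]) auto
  then show ?thesis using False by simp
qed (auto simp: mem_torus)

lemma grid_diff: "a \<in> grid h \<Longrightarrow> b \<in> grid h \<Longrightarrow> a - b \<in> grid h"
  unfolding grid_def by (auto, metis of_int_diff right_diff_distrib)

lemma torus_orthogonality: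
  fixes a :: "real^'n"
  assumes h: "h > 0" and a: "a \<in> grid h"
  shows "integrable lborel (\<lambda>\<xi>. indicator (torus h) \<xi> * cis (- (a \<bullet> \<xi>)))" (is ?A)
    and "(LINT \<xi>|lborel. indicator (torus h) \<xi> * cis (- (a \<bullet> \<xi>))) = (if a = 0 then of_real ((2 * pi / h) ^ CARD('n)) else 0)" (is ?B)
proof -
  obtain k :: "'n \<Rightarrow> int" where k: "\<And>j. a $ j = h * of_int (k j)" using a unfolding grid_def by (auto, metis)
  have eq: "indicator (torus h) \<xi> * cis (- (a \<bullet> \<xi>)) =
      (\<Prod>j\<in>UNIV. indicator {- pi / h..pi / h} (\<xi> $ j) * cis (- (h * of_int (k j) * \<xi> $ j)))" for \<xi>
    unfolding indicator_torus_prod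
    by (simp add: prod.distrib prod_cis inner_vec_def sum_negf k)
  show ?A unfolding eq by (intro lborel_prod_vec integral_cis_period h)
  have "(LINT \<xi>|lborel. indicator (torus h) \<xi> * cis (- (a \<bullet> \<xi>))) = (\<Prod>j\<in>UNIV. if k j = 0 then complex_of_real (2 * pi / h) else 0)"
    unfolding eq by (subst lborel_prod_vec(2)[OF integral_cis_period(1)[OF h]]) (simp only: integral_cis_period(2)[OF h])
  also have "\<dots> = (if a = 0 then of_real ((2 * pi / h) ^ CARD('n)) else 0)"
  proof (cases "a = 0")
    case True then have "k j = 0" for j using k[of j] h by simp
    then show ?thesis using True by simp
  next
    case False then obtain j where "k j \<noteq> 0" using k by (auto simp: vec_eq_iff)
    then have "(\<Prod>j\<in>UNIV. if k j = 0 then complex_of_real (2 * pi / h) else 0) = 0"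
      by (intro prod_zero bexI[of _ j]) auto
    then show ?thesis using False by simp
  qed
  finally show ?B .
qed

section \<open>Trigonometric polynomials and the discrete Fourier transform\<close>

text \<open>
  The truncated series of the discrete Fourier transform. If the coefficients sit on the grid, it is a
  periodic function on the whole space.
\<close>

definition trigpoly :: "real \<Rightarrow> (real^'n \<Rightarrow> complex) \<Rightarrow> (real^'n) set \<Rightarrow> real^'n \<Rightarrow> complex" where
  "trigpoly h g A \<xi> = of_real (h ^ CARD('n)) * (\<Sum>a\<in>A. g a * cis (- (a \<bullet> \<xi>)))"

lemma trigpoly_measurable [measurable]: "trigpoly h g A \<in> borel_measurable borel"
  unfolding trigpoly_def[abs_def] by measurable

lemma trigpoly_L2:
  fixes g :: "real^'n \<Rightarrow> complex"
  shows "on_torus h (trigpoly h g A) \<in> L2_space lborel"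
proof (rule on_torus_bounded_L2[OF trigpoly_measurable])
  fix \<xi> :: "real^'n"
  have "norm (\<Sum>a\<in>A. g a * cis (- (a \<bullet> \<xi>))) \<le> (\<Sum>a\<in>A. norm (g a))"
    by (rule order_trans[OF norm_sum]) (simp add: norm_mult)
  then show "norm (trigpoly h g A \<xi>) \<le> \<bar>h ^ CARD('n)\<bar> * (\<Sum>a\<in>A. norm (g a))"
    unfolding trigpoly_def norm_mult norm_of_real by (rule mult_left_mono) simp
qed

text \<open>
  Convolution over one period multiplies the coefficients: of the double sum over pairs of grid points,
  orthogonality leaves the diagonal.
\<close>

lemma trigpoly_product_integral:
  fixes f g :: "real^'n \<Rightarrow> complex" and h :: real
  assumes h: "h > 0" and A: "finite A" "A \<subseteq> grid h"
  shows "(LINT \<eta>|lborel. indicator (torus h) \<eta> * (trigpoly h f A \<eta> * trigpoly h g A (\<xi> - \<eta>)))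
     = of_real ((2 * pi) ^ CARD('n)) * trigpoly h (\<lambda>a. f a * g a) A \<xi>"
proof -
  let ?c = "complex_of_real (h ^ CARD('n))"
  let ?e = "\<lambda>a b \<eta>. indicator (torus h) \<eta> * cis (- ((a - b) \<bullet> \<eta>))"
  let ?t = "\<lambda>a b. ?c\<^sup>2 * (f a * g b * cis (- (b \<bullet> \<xi>)))" and ?d = "complex_of_real ((2 * pi / h) ^ CARD('n))"
  have e: "integrable lborel (?e a b)" "(LINT \<eta>|lborel. ?e a b \<eta>) = (if a = b then ?d else 0)"
    if "a \<in> A" "b \<in> A" for a b
  proof -
    have "a \<in> grid h" "b \<in> grid h" using A that by auto
    from torus_orthogonality[OF h grid_diff[OF this]]
    show "integrable lborel (?e a b)" "(LINT \<eta>|lborel. ?e a b \<eta>) = (if a = b then ?d else 0)"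
      by auto
  qed
  have ti: "integrable lborel (\<lambda>\<eta>. ?t a b * ?e a b \<eta>)" if "a \<in> A" "b \<in> A" for a b
    by (rule integrable_mult_right) (rule e(1)[OF that])
  have eq: "indicator (torus h) \<eta> * (trigpoly h f A \<eta> * trigpoly h g A (\<xi> - \<eta>))
      = (\<Sum>a\<in>A. \<Sum>b\<in>A. ?t a b * ?e a b \<eta>)" for \<eta>
  proof -
    have c: "cis (- (a \<bullet> \<eta>)) * cis (- (b \<bullet> (\<xi> - \<eta>))) = cis (- (b \<bullet> \<xi>)) * cis (- ((a - b) \<bullet> \<eta>))" for a b :: "real^'n"
    proof -
      have "- (a \<bullet> \<eta>) + - (b \<bullet> (\<xi> - \<eta>)) = - (b \<bullet> \<xi>) + - ((a - b) \<bullet> \<eta>)"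
        by (simp add: inner_diff_left inner_diff_right)
      then show ?thesis by (simp only: cis_mult)
    qed
    have "indicator (torus h) \<eta> * (trigpoly h f A \<eta> * trigpoly h g A (\<xi> - \<eta>))
      = indicator (torus h) \<eta> * ?c\<^sup>2 * (\<Sum>a\<in>A. \<Sum>b\<in>A. (f a * cis (- (a \<bullet> \<eta>))) * (g b * cis (- (b \<bullet> (\<xi> - \<eta>)))))"
      unfolding trigpoly_def sum_product[symmetric] power2_eq_square by (simp only: mult_ac)
    also have "\<dots> = (\<Sum>a\<in>A. \<Sum>b\<in>A. ?t a b * ?e a b \<eta>)"
      unfolding sum_distrib_left
    proof (intro sum.cong refl)
      fix a b :: "real^'n"
      have "indicator (torus h) \<eta> * ?c\<^sup>2 * (f a * cis (- (a \<bullet> \<eta>)) * (g b * cis (- (b \<bullet> (\<xi> - \<eta>)))))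
         = indicator (torus h) \<eta> * ?c\<^sup>2 * (f a * g b) * (cis (- (a \<bullet> \<eta>)) * cis (- (b \<bullet> (\<xi> - \<eta>))))"
        by (simp only: mult_ac)
      also have "\<dots> = indicator (torus h) \<eta> * ?c\<^sup>2 * (f a * g b) * (cis (- (b \<bullet> \<xi>)) * cis (- ((a - b) \<bullet> \<eta>)))"
        by (simp only: c)
      also have "\<dots> = ?t a b * ?e a b \<eta>"
        by (simp only: mult_ac)
      finally show "indicator (torus h) \<eta> * ?c\<^sup>2 * (f a * cis (- (a \<bullet> \<eta>)) * (g b * cis (- (b \<bullet> (\<xi> - \<eta>)))))
         = ?t a b * ?e a b \<eta>" .
    qed
    finally show ?thesis .
  qed
  have "(LINT \<eta>|lborel. indicator (torus h) \<eta> * (trigpoly h f A \<eta> * trigpoly h g A (\<xi> - \<eta>)))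
      = (LINT \<eta>|lborel. (\<Sum>a\<in>A. \<Sum>b\<in>A. ?t a b * ?e a b \<eta>))"
    by (rule Bochner_Integration.integral_cong[OF refl eq])
  also have "\<dots> = (\<Sum>a\<in>A. (LINT \<eta>|lborel. (\<Sum>b\<in>A. ?t a b * ?e a b \<eta>)))"
    by (rule Bochner_Integration.integral_sum) (rule Bochner_Integration.integrable_sum, rule ti)
  also have "\<dots> = (\<Sum>a\<in>A. \<Sum>b\<in>A. (LINT \<eta>|lborel. ?t a b * ?e a b \<eta>))"
    by (rule sum.cong[OF refl], rule Bochner_Integration.integral_sum) (rule ti)
  also have "\<dots> = (\<Sum>a\<in>A. \<Sum>b\<in>A. if a = b then ?t a b * ?d else 0)"
    unfolding integral_mult_right_zero
  proof (intro sum.cong refl)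
    fix a b assume "a \<in> A" "b \<in> A"
    then show "?t a b * (LINT \<eta>|lborel. ?e a b \<eta>)
       = (if a = b then ?t a b * ?d else 0)"
      unfolding e(2)[OF \<open>a \<in> A\<close> \<open>b \<in> A\<close>] by (cases "a = b") (simp_all only: simp_thms if_True if_False mult_zero_right)
  qed
  also have "\<dots> = (\<Sum>a\<in>A. ?t a a * ?d)"
    by (intro sum.cong refl) (simp only: sum.delta'[OF A(1)] if_True)
  also have "\<dots> = of_real (h ^ CARD('n) * ((2 * pi / h) ^ CARD('n))) * trigpoly h (\<lambda>a. f a * g a) A \<xi>"
    unfolding trigpoly_def sum_distrib_left
    by (intro sum.cong refl) (simp only: of_real_mult power2_eq_square mult_ac)
  also have "h ^ CARD('n) * ((2 * pi / h) ^ CARD('n)) = (2 * pi) ^ CARD('n)"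
    unfolding power_mult_distrib[symmetric] using h by simp
  finally show ?thesis .
qed

text \<open>
  Convolving with the conjugate polynomial and evaluating at the origin gives the squared norm, so
  this is a special case of the preceding lemma.
\<close>

lemma trigpoly_l2sq:
  fixes g :: "real^'n \<Rightarrow> complex"
  assumes h: "h > 0" and A: "finite A" "A \<subseteq> grid h"
  shows "l2sq lborel (on_torus h (trigpoly h g A)) = ennreal ((2 * pi * h) ^ CARD('n) * (\<Sum>a\<in>A. (norm (g a))\<^sup>2))"
proof -
  let ?T = "trigpoly h g A"
  have cnj: "trigpoly h (\<lambda>a. cnj (g a)) A (0 - \<eta>) = cnj (?T \<eta>)" for \<eta>
    by (simp only: trigpoly_def complex_cnj_mult complex_cnj_complex_of_real cnj_sum cis_cnj
        diff_0 inner_minus_right minus_minus)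
  have i: "integrable lborel (\<lambda>\<eta>. (norm (on_torus h ?T \<eta>))\<^sup>2)"
    using trigpoly_L2[of h g A] unfolding L2_space_def by blast
  let ?N = "\<lambda>\<eta>. (norm (on_torus h ?T \<eta>))\<^sup>2" and ?S = "\<Sum>a\<in>A. (norm (g a))\<^sup>2"
  have "complex_of_real (LINT \<eta>|lborel. ?N \<eta>) = (LINT \<eta>|lborel. of_real (?N \<eta>))"
    by (rule integral_complex_of_real[symmetric])
  also have "\<dots> = (LINT \<eta>|lborel. indicator (torus h) \<eta> * (?T \<eta> * trigpoly h (\<lambda>a. cnj (g a)) A (0 - \<eta>)))"
  proof (rule Bochner_Integration.integral_cong[OF refl])
    fix \<eta> :: "real^'n"
    show "complex_of_real (?N \<eta>) = indicator (torus h) \<eta> * (?T \<eta> * trigpoly h (\<lambda>a. cnj (g a)) A (0 - \<eta>))"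
      unfolding cnj complex_norm_square by (cases "\<eta> \<in> torus h") simp_all
  qed
  also have "\<dots> = of_real ((2 * pi) ^ CARD('n)) * trigpoly h (\<lambda>a. g a * cnj (g a)) A 0"
    by (rule trigpoly_product_integral[OF h A])
  also have "\<dots> = of_real ((2 * pi * h) ^ CARD('n) * ?S)"
  proof -
    have "trigpoly h (\<lambda>a. g a * cnj (g a)) A 0 = of_real (h ^ CARD('n) * ?S)"
      by (simp only: trigpoly_def complex_norm_square[symmetric] inner_zero_right minus_zero cis_zero
          mult_1_right of_real_mult of_real_sum)
    then show ?thesis
      by (simp only: of_real_mult[symmetric] mult.assoc[symmetric] power_mult_distrib[symmetric])
  qed
  finally have eq: "(LINT \<eta>|lborel. ?N \<eta>) = (2 * pi * h) ^ CARD('n) * ?S"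
    by (simp only: of_real_eq_iff)
  have "l2sq lborel (on_torus h ?T) = ennreal (LINT \<eta>|lborel. ?N \<eta>)"
    unfolding l2sq_def by (rule nn_integral_eq_integral[OF i]) simp
  then show ?thesis unfolding eq .
qed

text \<open>
  The two polynomials on the right have no grid point in common with a large set contained in both
  \<open>A\<close> and \<open>B\<close>, which is what makes the partial sums Cauchy.
\<close>

lemma trigpoly_diff:
  assumes "finite A" "finite B"
  shows "trigpoly h g A \<xi> - trigpoly h g B \<xi> = trigpoly h g (A - B) \<xi> - trigpoly h g (B - A) \<xi>"
proof -
  have "(\<Sum>a\<in>A. f a) - (\<Sum>a\<in>B. f a) = (\<Sum>a\<in>A - B. f a) - (\<Sum>a\<in>B - A. f a)" for f :: "_ \<Rightarrow> complex"
    using assms by (simp add: sum.Int_Diff[of A f B] sum.Int_Diff[of B f A] Int_commute)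
  then show ?thesis unfolding trigpoly_def right_diff_distrib[symmetric] by simp
qed

lemma trigpoly_cauchy:
  fixes g :: "real^'n \<Rightarrow> complex"
  assumes h: "h > 0" and g: "g \<in> L2_grid h" and e: "e > 0"
  shows "\<exists>P. eventually P (finite_subsets_at_top (grid h)) \<and> (\<forall>A B. P A \<longrightarrow> P B \<longrightarrow>
    l2sq lborel (\<lambda>\<xi>. on_torus h (trigpoly h g A) \<xi> - on_torus h (trigpoly h g B) \<xi>) \<le> ennreal e)"
proof -
  define S where "S = infsum (\<lambda>a. (norm (g a))\<^sup>2) (grid h)"
  have S: "((\<lambda>a. (norm (g a))\<^sup>2) has_sum S) (grid h)"
    using g unfolding L2_grid_def S_def by (auto intro: has_sum_infsum)
  define c where "c = (2 * pi * h) ^ CARD('n)"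
  have c: "c > 0" using h by (simp add: c_def)
  have "\<forall>\<^sub>F A in finite_subsets_at_top (grid h). (\<Sum>a\<in>A. (norm (g a))\<^sup>2) > S - e / (4 * c)"
    using S c e unfolding has_sum_def by (intro order_tendstoD(1)) auto
  then obtain F0 where F0: "finite F0" "F0 \<subseteq> grid h" "(\<Sum>a\<in>F0. (norm (g a))\<^sup>2) > S - e / (4 * c)"
    unfolding eventually_finite_subsets_at_top by blast
  let ?T = "\<lambda>A. on_torus h (trigpoly h g A)"
  have small: "l2sq lborel (?T X) \<le> ennreal (e / 4)" if X: "finite X" "X \<subseteq> grid h" "X \<inter> F0 = {}" for X
  proof -
    have "(\<Sum>a\<in>X. (norm (g a))\<^sup>2) + (\<Sum>a\<in>F0. (norm (g a))\<^sup>2) = (\<Sum>a\<in>X \<union> F0. (norm (g a))\<^sup>2)"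
      using X F0 by (simp add: sum.union_disjoint)
    also have "\<dots> \<le> S" using X F0 by (intro finite_sum_le_has_sum[OF S]) auto
    finally have "(\<Sum>a\<in>X. (norm (g a))\<^sup>2) \<le> e / (4 * c)" using F0 by simp
    then have "c * (\<Sum>a\<in>X. (norm (g a))\<^sup>2) \<le> e / 4" using c by (simp add: field_simps)
    then show ?thesis unfolding trigpoly_l2sq[OF h X(1,2)] c_def by (rule ennreal_leI)
  qed
  let ?P = "\<lambda>A. finite A \<and> A \<subseteq> grid h \<and> F0 \<subseteq> A"
  have "eventually ?P (finite_subsets_at_top (grid h))"
    unfolding eventually_finite_subsets_at_top using F0 by (intro exI[of _ F0]) auto
  moreover have "l2sq lborel (\<lambda>\<xi>. ?T A \<xi> - ?T B \<xi>) \<le> ennreal e"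
    if "?P A" "?P B" for A B
  proof -
    have "(\<lambda>\<xi>. ?T A \<xi> - ?T B \<xi>)
        = (\<lambda>\<xi>. ?T (A - B) \<xi> - ?T (B - A) \<xi>)"
      using trigpoly_diff[of A B h g] that by (simp flip: right_diff_distrib)
    then have "l2sq lborel (\<lambda>\<xi>. ?T A \<xi> - ?T B \<xi>)
        \<le> 2 * l2sq lborel (?T (A - B)) + 2 * l2sq lborel (?T (B - A))"
      by (simp only:) (rule l2sq_diff; simp)
    also have "\<dots> \<le> 2 * ennreal (e / 4) + 2 * ennreal (e / 4)"
      using that by (intro add_mono mult_left_mono small) auto
    also have "\<dots> = ennreal 4 * ennreal (e / 4)"
      by (simp flip: distrib_right)
    also have "\<dots> = ennreal e" using e by (subst ennreal_mult[symmetric]) auto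
    finally show ?thesis .
  qed
  ultimately show ?thesis by (intro exI[of _ ?P]) auto
qed

abbreviation is_dft :: "real \<Rightarrow> (real^'n \<Rightarrow> complex) \<Rightarrow> (real^'n \<Rightarrow> complex) \<Rightarrow> bool" where
  "is_dft h g G \<equiv> tendsto_L2 lborel (\<lambda>A. on_torus h (trigpoly h g A)) (on_torus h G) (finite_subsets_at_top (grid h))"

lemma dft_altdef:
  "dft h g = (SOME G. on_torus h G \<in> L2_space lborel \<and>
     is_dft h g G)"
  unfolding dft_def L2_space_torus tendsto_L2_torus trigpoly_def ..

text \<open>
  Limits in mean square are unique, so exhibiting any limit determines the discrete transform.
\<close>

lemma dftI:
  fixes g :: "real^'n \<Rightarrow> complex"
  assumes "on_torus h G \<in> L2_space lborel"
    and "is_dft h g G"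
  shows dft_L2I: "on_torus h (dft h g) \<in> L2_space lborel"
    and dft_tendstoI: "is_dft h g (dft h g)"
    and dft_eqI: "AE \<xi> in lborel. on_torus h (dft h g) \<xi> = on_torus h G \<xi>"
proof -
  show *: "on_torus h (dft h g) \<in> L2_space lborel"
     "is_dft h g (dft h g)"
    using someI[of "\<lambda>G. on_torus h G \<in> L2_space lborel \<and>
     is_dft h g G" G] assms
    unfolding dft_altdef by blast+
  show "AE \<xi> in lborel. on_torus h (dft h g) \<xi> = on_torus h G \<xi>"
    by (rule tendsto_L2_unique[OF finite_subsets_at_top_neq_bot _ _ _ *(2) assms(2)])
       (use L2_spaceD(1)[OF *(1)] L2_spaceD(1)[OF assms(1)] L2_spaceD(1)[OF trigpoly_L2] in auto)
qed

lemma
  fixes g :: "real^'n \<Rightarrow> complex"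
  assumes h: "h > 0" and g: "g \<in> L2_grid h"
  shows dft_L2: "on_torus h (dft h g) \<in> L2_space lborel"
    and dft_tendsto: "is_dft h g (dft h g)"
proof -
  have "\<exists>G\<in>L2_space (torus_measure h). tendsto_L2 (torus_measure h) (\<lambda>A. trigpoly h g A) G (finite_subsets_at_top (grid h))"
  proof (rule L2_complete[OF finite_subsets_at_top_neq_bot])
    show "trigpoly h g A \<in> L2_space (torus_measure h)" for A
      by (simp add: L2_space_torus trigpoly_L2)
    show "\<exists>P. eventually P (finite_subsets_at_top (grid h)) \<and> (\<forall>A B. P A \<longrightarrow> P B \<longrightarrow>
      l2sq (torus_measure h) (\<lambda>\<xi>. trigpoly h g A \<xi> - trigpoly h g B \<xi>) \<le> ennreal e)" if "e > 0" for e
      using trigpoly_cauchy[OF h g that] unfolding l2sq_torus right_diff_distrib .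
  qed
  then obtain G where "G \<in> L2_space (torus_measure h)"
      "tendsto_L2 (torus_measure h) (\<lambda>A. trigpoly h g A) G (finite_subsets_at_top (grid h))"
    by blast
  note G = this[unfolded L2_space_torus tendsto_L2_torus]
  show "on_torus h (dft h g) \<in> L2_space lborel"
    by (rule dft_L2I[OF G])
  show "is_dft h g (dft h g)"
    by (rule dft_tendstoI[OF G])
qed

section \<open>Convolution of square-integrable functions\<close>

definition conv :: "(real^'n \<Rightarrow> complex) \<Rightarrow> (real^'n \<Rightarrow> complex) \<Rightarrow> real^'n \<Rightarrow> complex" where
  "conv F G \<xi> = (LINT \<eta>|lborel. F \<eta> * G (\<xi> - \<eta>))"

lemma conv_measurable [measurable]:
  assumes [measurable]: "F \<in> borel_measurable borel" "G \<in> borel_measurable borel"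
  shows "conv F G \<in> borel_measurable borel"
  unfolding conv_def[abs_def] by measurable

lemma nn_integral_lborel_shift_reflect:
  fixes f :: "'a::euclidean_space \<Rightarrow> ennreal"
  assumes "f \<in> borel_measurable borel"
  shows "(\<integral>\<^sup>+x. f (t - x) \<partial>lborel) = (\<integral>\<^sup>+x. f x \<partial>lborel)"
  using nn_integral_lborel_affine[OF assms, of "-1" t] by simp

lemma
  fixes G :: "real^'n \<Rightarrow> complex"
  assumes G: "G \<in> L2_space lborel"
  shows L2_space_shift_reflect: "(\<lambda>\<eta>. G (\<xi> - \<eta>)) \<in> L2_space lborel"
    and l2sq_shift_reflect: "l2sq lborel (\<lambda>\<eta>. G (\<xi> - \<eta>)) = l2sq lborel G"
proof -
  have [measurable]: "G \<in> borel_measurable borel" using G by auto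
  show eq: "l2sq lborel (\<lambda>\<eta>. G (\<xi> - \<eta>)) = l2sq lborel G"
    unfolding l2sq_def by (rule nn_integral_lborel_shift_reflect) simp
  show "(\<lambda>\<eta>. G (\<xi> - \<eta>)) \<in> L2_space lborel"
    using G by (auto simp: L2_space_iff eq)
qed

lemma conv_integrable:
  fixes F G :: "real^'n \<Rightarrow> complex"
  assumes "F \<in> L2_space lborel" "G \<in> L2_space lborel"
  shows "integrable lborel (\<lambda>\<eta>. F \<eta> * G (\<xi> - \<eta>))"
  by (intro L2_mult_integrable L2_space_shift_reflect assms)

lemma conv_bound:
  assumes "F \<in> L2_space lborel" "G \<in> L2_space lborel"
  shows "ennreal ((norm (conv F G \<xi>))\<^sup>2) \<le> l2sq lborel F * l2sq lborel G"
  using norm_integral_mult_le[OF assms(1) L2_space_shift_reflect[OF assms(2)], of \<xi>]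
  unfolding conv_def l2sq_shift_reflect[OF assms(2)] .

lemma conv_bounded:
  assumes "F \<in> L2_space lborel" "G \<in> L2_space lborel"
  shows "\<exists>B. \<forall>\<xi>. norm (conv F G \<xi>) \<le> B"
proof -
  define C where "C = enn2real (l2sq lborel F * l2sq lborel G)"
  have "l2sq lborel F * l2sq lborel G = ennreal C"
    using assms unfolding C_def by (auto simp: L2_space_iff ennreal_mult_less_top)
  then have "ennreal ((norm (conv F G \<xi>))\<^sup>2) \<le> ennreal C" for \<xi>
    using conv_bound[OF assms, of \<xi>] by (simp only:)
  then have "(norm (conv F G \<xi>))\<^sup>2 \<le> C" for \<xi>
    by (subst (asm) ennreal_le_iff) (auto simp: C_def)
  then have "norm (conv F G \<xi>) \<le> sqrt C" for \<xi>
    by (rule real_le_rsqrt)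
  then show ?thesis by blast
qed

text \<open>
  Bilinearity and the Cauchy--Schwarz inequality. The bound does not depend on \<open>\<xi>\<close>, so convolutions
  converge uniformly when both factors converge in mean square.
\<close>

lemma conv_diff_bound:
  assumes F: "F \<in> L2_space lborel" "F' \<in> L2_space lborel" and G: "G \<in> L2_space lborel" "G' \<in> L2_space lborel"
  shows "ennreal ((norm (conv F' G' \<xi> - conv F G \<xi>))\<^sup>2) \<le>
    2 * (l2sq lborel (\<lambda>x. F' x - F x) * l2sq lborel G) + 2 * (l2sq lborel F' * l2sq lborel (\<lambda>x. G' x - G x))"
proof -
  have "conv F' G' \<xi> - conv F G \<xi> = conv (\<lambda>x. F' x - F x) G \<xi> + conv F' (\<lambda>x. G' x - G x) \<xi>"
    unfolding conv_def left_diff_distrib right_diff_distrib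
    by (simp add: conv_integrable F G)
  then have "(norm (conv F' G' \<xi> - conv F G \<xi>))\<^sup>2 \<le>
      2 * (norm (conv (\<lambda>x. F' x - F x) G \<xi>))\<^sup>2 + 2 * (norm (conv F' (\<lambda>x. G' x - G x) \<xi>))\<^sup>2"
    by (simp only: norm_add_sq_le)
  then have "ennreal ((norm (conv F' G' \<xi> - conv F G \<xi>))\<^sup>2) \<le>
      2 * ennreal ((norm (conv (\<lambda>x. F' x - F x) G \<xi>))\<^sup>2) + 2 * ennreal ((norm (conv F' (\<lambda>x. G' x - G x) \<xi>))\<^sup>2)"
    using ennreal_leI by (fastforce simp: ennreal_mult ennreal_plus)
  also have "\<dots> \<le> 2 * (l2sq lborel (\<lambda>x. F' x - F x) * l2sq lborel G) + 2 * (l2sq lborel F' * l2sq lborel (\<lambda>x. G' x - G x))"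
    by (intro add_mono mult_left_mono conv_bound L2_space_diff F G) auto
  finally show ?thesis .
qed

section \<open>Periodization\<close>

text \<open>
  A sum of two points of the torus cube lies in the doubled cube, and that cube is covered by the
  translates of the torus cube along these \<open>3\<^sup>n\<close> vectors. For functions supported in the doubled cube the
  finite sum over \<open>shifts\<close> therefore agrees on the torus with the full periodization.
\<close>

definition shifts :: "(real^'n) set" where
  "shifts = {k. \<forall>j. k $ j \<in> {-1, 0, 1}}"

lemma finite_shifts [simp]: "finite (shifts :: (real^'n) set)"
proof (rule finite_imageD)
  show "inj_on vec_nth (shifts :: (real^'n) set)"
    by (auto simp: inj_on_def vec_eq_iff)
  have "vec_nth ` (shifts :: (real^'n) set) \<subseteq> PiE UNIV (\<lambda>_. {-1, 0, 1})"
    by (auto simp: shifts_def)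
  then show "finite (vec_nth ` (shifts :: (real^'n) set))"
    by (rule finite_subset) (intro finite_PiE; simp)
qed

definition periodize :: "real \<Rightarrow> (real^'n \<Rightarrow> complex) \<Rightarrow> real^'n \<Rightarrow> complex" where
  "periodize h H \<xi> = (\<Sum>k\<in>shifts. H (\<xi> + (2 * pi / h) *\<^sub>R k))"

lemma periodize_measurable [measurable]:
  assumes [measurable]: "H \<in> borel_measurable borel"
  shows "periodize h H \<in> borel_measurable borel"
  unfolding periodize_def[abs_def] by measurable

lemma norm_sum_sq_le:
  fixes f :: "'i \<Rightarrow> complex"
  shows "(norm (\<Sum>i\<in>I. f i))\<^sup>2 \<le> real (card I) * (\<Sum>i\<in>I. (norm (f i))\<^sup>2)"
proof -
  have "(norm (\<Sum>i\<in>I. f i))\<^sup>2 \<le> (\<Sum>i\<in>I. norm (f i))\<^sup>2"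
    by (intro power_mono norm_sum) auto
  also have "\<dots> \<le> real (card I) * (\<Sum>i\<in>I. (norm (f i))\<^sup>2)"
    using sum_squared_le_sum_of_squares[of "\<lambda>i. norm (f i)" I] by (simp add: mult.commute)
  finally show ?thesis .
qed

lemma trigpoly_periodic:
  fixes g :: "real^'n \<Rightarrow> complex"
  assumes h: "h > 0" and A: "A \<subseteq> grid h" and k: "k \<in> shifts"
  shows "trigpoly h g A (\<xi> + (2 * pi / h) *\<^sub>R k) = trigpoly h g A \<xi>"
proof -
  have "cis (- (a \<bullet> (\<xi> + (2 * pi / h) *\<^sub>R k))) = cis (- (a \<bullet> \<xi>))" if "a \<in> A" for a
  proof -
    have "a \<in> grid h" using that A by auto
    then obtain m :: "'n \<Rightarrow> int" where m: "\<And>j. a $ j = h * of_int (m j)"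
      unfolding grid_def by (auto, metis)
    have kZ: "k $ j \<in> \<int>" for j using k by (auto simp: shifts_def) (metis Ints_0 Ints_1 Ints_minus)+
    have "a \<bullet> ((2 * pi / h) *\<^sub>R k) = 2 * pi * (\<Sum>j\<in>UNIV. of_int (m j) * k $ j)"
      using h by (simp add: inner_vec_def m sum_distrib_left mult_ac)
    moreover have "(\<Sum>j\<in>UNIV. of_int (m j) * k $ j) \<in> \<int>"
      by (intro Ints_sum Ints_mult kZ) auto
    ultimately have "cis (a \<bullet> ((2 * pi / h) *\<^sub>R k)) = 1"
      by (simp add: cis_multiple_2pi)
    then have "cis (- (a \<bullet> ((2 * pi / h) *\<^sub>R k))) = 1"
      by (metis cis_cnj complex_cnj_one)
    then show ?thesis
      by (simp only: inner_add_right minus_add_distrib cis_mult[symmetric] mult_1_right)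
  qed
  then show ?thesis unfolding trigpoly_def by simp
qed

text \<open>
  Away from the null set of boundary points, exactly one of the translates of the point
  \<open>\<xi> - \<eta>\<close> of the doubled cube falls into the torus cube.
\<close>

lemma torus_tiling:
  fixes \<xi> :: "real^'n"
  assumes h: "h > 0" and \<xi>: "\<xi> \<in> torus h"
  shows "AE \<eta> in lborel. \<eta> \<in> torus h \<longrightarrow>
    (\<Sum>k\<in>shifts. indicator (torus h) (\<xi> + (2 * pi / h) *\<^sub>R k - \<eta>)) = (1 :: complex)"
proof -
  let ?l = "(\<chi> j. - pi / h) :: real^'n" and ?u = "(\<chi> j. pi / h) :: real^'n"
  let ?y = "\<lambda>\<eta> k. \<xi> + (2 * pi / h) *\<^sub>R k - \<eta>"
  have m1: "(-1 :: real) \<noteq> 0" by simp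
  have inner_eq: "x \<in> cbox ?l ?u \<longleftrightarrow> x \<in> box ?l ?u" if "x \<notin> cbox ?l ?u - box ?l ?u" for x
    using that subsetD[OF box_subset_cbox, of x ?l ?u] by blast
  have ae: "AE \<eta> in lborel. ?y \<eta> k \<notin> cbox ?l ?u - box ?l ?u" for k
    using AE_lborel_affine[OF AE_not_in[OF null_sets_cbox_Diff_box] m1, of "\<xi> + (2 * pi / h) *\<^sub>R k" ?l ?u]
    unfolding scaleR_minus1_left add_uminus_conv_diff .
  have "AE \<eta> in lborel. \<forall>k\<in>shifts. ?y \<eta> k \<notin> cbox ?l ?u - box ?l ?u"
    by (rule AE_finite_allI[OF finite_shifts ae])
  then show ?thesis
  proof eventually_elim
    case (elim \<eta>)
    show ?case
    proof
      assume \<eta>: "\<eta> \<in> torus h"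
      have iff: "?y \<eta> k \<in> torus h \<longleftrightarrow> (\<forall>j. - pi / h < ?y \<eta> k $ j \<and> ?y \<eta> k $ j < pi / h)" if "k \<in> shifts" for k
      proof -
        have "?y \<eta> k \<notin> cbox ?l ?u - box ?l ?u" using elim that by (rule bspec)
        then have "?y \<eta> k \<in> torus h \<longleftrightarrow> ?y \<eta> k \<in> box ?l ?u"
          unfolding torus_def using inner_eq by blast
        then show ?thesis unfolding mem_box_cart vec_lambda_beta .
      qed
      let ?i = "\<lambda>k. indicator (torus h) (?y \<eta> k) :: complex"
      \<comment> \<open>Coordinatewise, move \<open>\<xi> - \<eta>\<close> back by one period where it has left the cube.\<close>
      define k0 :: "real^'n" where "k0 = (\<chi> j. if (\<xi> - \<eta>) $ j < - pi / h then 1 else if (\<xi> - \<eta>) $ j > pi / h then -1 else 0)"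
      have k0: "k0 \<in> shifts" by (simp add: shifts_def k0_def)
      have k0_in: "?y \<eta> k0 \<in> torus h"
      proof -
        have "- pi / h \<le> ?y \<eta> k0 $ j \<and> ?y \<eta> k0 $ j \<le> pi / h" for j
        proof -
          define p where "p = pi / h"
          have p: "p > 0" "- pi / h = - p" "pi / h = p" "2 * pi / h = 2 * p" using h by (auto simp: p_def)
          have "- p \<le> \<xi> $ j" "\<xi> $ j \<le> p" "- p \<le> \<eta> $ j" "\<eta> $ j \<le> p"
            using \<xi> \<eta> unfolding mem_torus p(2,3) by blast+
          moreover have "k0 $ j = (if \<xi> $ j - \<eta> $ j < - p then 1 else if \<xi> $ j - \<eta> $ j > p then -1 else 0)"
            by (simp only: k0_def vec_lambda_beta p(2,3) vector_minus_component)
          ultimately have "- p \<le> \<xi> $ j + 2 * p * k0 $ j - \<eta> $ j \<and> \<xi> $ j + 2 * p * k0 $ j - \<eta> $ j \<le> p"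
            using p(1) by (cases "\<xi> $ j - \<eta> $ j < - p"; cases "\<xi> $ j - \<eta> $ j > p"; simp; linarith)
          then show ?thesis
            by (simp only: p(2-4) vector_add_component vector_minus_component vector_scaleR_component real_scaleR_def)
        qed
        then show ?thesis by (auto simp: mem_torus)
      qed
      have k0_unique: "k = k0" if k: "k \<in> shifts" "?y \<eta> k \<in> torus h" for k
      proof -
        have "k $ j = k0 $ j" for j
        proof -
          define p where "p = pi / h"
          have p: "- pi / h = - p" "pi / h = p" "2 * pi / h = 2 * p" by (auto simp: p_def)
          have "- p < ?y \<eta> k $ j" "?y \<eta> k $ j < p" "- p < ?y \<eta> k0 $ j" "?y \<eta> k0 $ j < p"
            using iff[OF k(1)] iff[OF k0] k(2) k0_in unfolding p(1,2) by blast+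
          then have "\<bar>2 * p * k $ j - 2 * p * k0 $ j\<bar> < 2 * p"
            unfolding p(3) vector_add_component vector_minus_component vector_scaleR_component real_scaleR_def by linarith
          then have *: "\<bar>2 * p * (k $ j - k0 $ j)\<bar> < 2 * p"
            unfolding right_diff_distrib .
          have p0: "0 < 2 * p" using h by (simp add: p_def)
          have "2 * p * \<bar>k $ j - k0 $ j\<bar> < 2 * p * 1"
            using * unfolding abs_mult[of "2 * p"] abs_of_pos[OF p0] mult_1_right .
          then have "\<bar>k $ j - k0 $ j\<bar> < 1"
            by (simp only: mult_less_cancel_left_pos[OF p0])
          moreover have "k $ j \<in> {-1, 0, 1}" "k0 $ j \<in> {-1, 0, 1}" using k k0 by (auto simp: shifts_def)
          ultimately show ?thesis by auto
        qed
        then show ?thesis by (simp add: vec_eq_iff)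
      qed
      have "(\<Sum>k\<in>shifts. ?i k) = (\<Sum>k\<in>shifts. if k = k0 then 1 else (0::complex))"
      proof (rule sum.cong[OF refl])
        fix k :: "real^'n" assume k: "k \<in> shifts"
        show "?i k = (if k = k0 then 1 else (0::complex))"
        proof (cases "k = k0")
          case True
          show ?thesis unfolding True using indicator_simps(1)[OF k0_in] by (simp only: if_True refl)
        next
          case False
          then have "?y \<eta> k \<notin> torus h" using k0_unique[OF k] by blast
          then show ?thesis using False unfolding indicator_def by (simp only: if_False simp_thms of_bool_eq)
        qed
      qed
      also have "\<dots> = 1" by (simp only: sum.delta[OF finite_shifts] k0 if_True)
      finally show "(\<Sum>k\<in>shifts. ?i k) = (1::complex)" .
    qed
  qed
qed

text \<open>
  Polynomials cut off to one period have a convolution on the whole space. Its periodization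
  is the convolution over one period, because the translates of the cut-off tile the torus and the
  polynomials themselves are periodic.
\<close>

lemma trigpoly_product_periodize:
  fixes f g :: "real^'n \<Rightarrow> complex"
  assumes h: "h > 0" and A: "finite A" "A \<subseteq> grid h" and \<xi>: "\<xi> \<in> torus h"
  shows "periodize h (conv (on_torus h (trigpoly h f A)) (on_torus h (trigpoly h g A))) \<xi>
    = of_real ((2 * pi) ^ CARD('n)) * trigpoly h (\<lambda>a. f a * g a) A \<xi>"
proof -
  let ?F = "on_torus h (trigpoly h f A)" and ?G = "on_torus h (trigpoly h g A)"
  let ?q = "\<lambda>\<eta>. indicator (torus h) \<eta> * (trigpoly h f A \<eta> * trigpoly h g A (\<xi> - \<eta>))"
  let ?y = "\<lambda>k. \<xi> + (2 * pi / h) *\<^sub>R k"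
  let ?I = "\<lambda>k \<eta>. ?F \<eta> * ?G (?y k - \<eta>)"
  have "periodize h (conv (?F) (?G)) \<xi>
      = (\<Sum>k\<in>shifts. (LINT \<eta>|lborel. ?I k \<eta>))"
    unfolding periodize_def conv_def ..
  also have "\<dots> = (LINT \<eta>|lborel. (\<Sum>k\<in>shifts. ?I k \<eta>))"
    by (rule Bochner_Integration.integral_sum[symmetric]) (rule conv_integrable[OF trigpoly_L2 trigpoly_L2])
  also have "\<dots> = (LINT \<eta>|lborel. ?q \<eta>)"
  proof (rule integral_cong_AE)
    show "AE \<eta> in lborel. (\<Sum>k\<in>shifts. ?I k \<eta>) = ?q \<eta>"
      using torus_tiling[OF h \<xi>]
    proof eventually_elim
      case (elim \<eta>)
      have "?I k \<eta> = ?q \<eta> * indicator (torus h) (?y k - \<eta>)"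
        if "k \<in> shifts" for k
      proof -
        have "?y k - \<eta> = (\<xi> - \<eta>) + (2 * pi / h) *\<^sub>R k" by simp
        then have "trigpoly h g A (?y k - \<eta>) = trigpoly h g A (\<xi> - \<eta>)"
          by (simp only: trigpoly_periodic[OF h A(2) that])
        then show ?thesis by (simp only: mult_ac)
      qed
      then have "(\<Sum>k\<in>shifts. ?I k \<eta>) = (\<Sum>k\<in>shifts. ?q \<eta> * indicator (torus h) (?y k - \<eta>))"
        by (rule sum.cong[OF refl])
      also have "\<dots> = ?q \<eta> * (\<Sum>k\<in>shifts. indicator (torus h) (?y k - \<eta>))"
        by (rule sum_distrib_left[symmetric])
      finally show ?case using elim by (cases "\<eta> \<in> torus h") simp_all
    qed
  qed measurable
  also have "\<dots> = of_real ((2 * pi) ^ CARD('n)) * trigpoly h (\<lambda>a. f a * g a) A \<xi>"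
    by (rule trigpoly_product_integral[OF h A])
  finally show ?thesis .
qed

text \<open>
  For truncations to finite sets of grid points the identity is the preceding lemma. Both transforms
  converge in mean square, hence the convolutions converge uniformly and the polynomials of the
  product converge on the torus, to \<open>P\<close>. Thus the transform of the product exists and equals \<open>P\<close>.
\<close>

theorem dft_product:
  fixes f g :: "real^'n \<Rightarrow> complex"
  assumes h: "h > 0" and f: "f \<in> L2_grid h" and g: "g \<in> L2_grid h"
  defines "P \<equiv> (\<lambda>\<xi>. periodize h (conv (on_torus h (dft h f)) (on_torus h (dft h g))) \<xi> / of_real ((2 * pi) ^ CARD('n)))"
  shows "on_torus h (dft h (\<lambda>a. f a * g a)) \<in> L2_space lborel"
    and "AE \<xi> in lborel. on_torus h (dft h (\<lambda>a. f a * g a)) \<xi> = on_torus h P \<xi>"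
proof -
  let ?F = "on_torus h (dft h f)" and ?G = "on_torus h (dft h g)"
  let ?FA = "\<lambda>A. on_torus h (trigpoly h f A)" and ?GA = "\<lambda>A. on_torus h (trigpoly h g A)"
  let ?c = "(2 * pi) ^ CARD('n)"
  let ?K = "card (shifts :: (real^'n) set)"
  let ?fs = "finite_subsets_at_top (grid h) :: (real^'n) set filter"
  note F = dft_L2[OF h f] and G = dft_L2[OF h g]
  have [measurable]: "?F \<in> borel_measurable borel" "?G \<in> borel_measurable borel" using F G by auto
  have [measurable]: "P \<in> borel_measurable borel" unfolding P_def by measurable
  let ?T = "\<lambda>A. trigpoly h (\<lambda>a. f a * g a) A"
  have P: "on_torus h P \<in> L2_space lborel"
  proof -
    obtain B where B: "\<And>\<xi>. norm (conv ?F ?G \<xi>) \<le> B" using conv_bounded[OF F G] by blast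
    have "norm (P \<xi>) \<le> ?K * B / ?c" for \<xi>
    proof -
      have "norm (periodize h (conv ?F ?G) \<xi>) \<le> ?K * B"
        unfolding periodize_def using B by (intro sum_norm_bound) auto
      then show ?thesis unfolding P_def norm_divide norm_of_real by (simp add: divide_right_mono)
    qed
    then show ?thesis by (intro on_torus_bounded_L2) auto
  qed
  let ?V = "of_nat ?K * of_nat ?K * emeasure lborel (torus h :: (real^'n) set)"
  \<comment> \<open>An upper bound for the squared error of the convolution at every frequency; it tends to zero along the finite sets of grid points.\<close>
  define N where "N A = 2 * (l2sq lborel (\<lambda>x. ?FA A x - ?F x) * l2sq lborel ?G)
      + 2 * ((2 * l2sq lborel (\<lambda>x. ?FA A x - ?F x) + 2 * l2sq lborel ?F) * l2sq lborel (\<lambda>x. ?GA A x - ?G x))" for A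
  have Nlim: "(N \<longlongrightarrow> 2 * (0 * l2sq lborel ?G) + 2 * ((2 * 0 + 2 * l2sq lborel ?F) * 0)) ?fs"
    unfolding N_def[abs_def]
    using dft_tendsto[OF h f] dft_tendsto[OF h g] L2_spaceD(2)[OF F] L2_spaceD(2)[OF G]
    unfolding tendsto_L2_iff
    by (intro tendsto_add tendsto_mult_ennreal tendsto_const) (auto simp: ennreal_mult_eq_top_iff)
  have conv_le: "ennreal ((norm (conv (?FA A) (?GA A) \<xi> - conv ?F ?G \<xi>))\<^sup>2) \<le> N A" for A \<xi>
  proof -
    have "l2sq lborel (?FA A) \<le> 2 * l2sq lborel (\<lambda>x. ?FA A x - ?F x) + 2 * l2sq lborel ?F"
      using l2sq_add[of "\<lambda>x. ?FA A x - ?F x" lborel ?F] by simp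
    then show ?thesis unfolding N_def
      by (intro order_trans[OF conv_diff_bound[OF F trigpoly_L2 G trigpoly_L2]] add_mono mult_left_mono mult_right_mono) auto
  qed
  have bound: "l2sq lborel (\<lambda>\<xi>. on_torus h (?T A) \<xi> - on_torus h P \<xi>)
      \<le> (?V) * N A" if A: "finite A" "A \<subseteq> grid h" for A
  proof -
    have "ennreal ((norm (on_torus h (?T A) \<xi> - on_torus h P \<xi>))\<^sup>2) \<le> of_nat ?K * of_nat ?K * N A * indicator (torus h) \<xi>" for \<xi>
    proof (cases "\<xi> \<in> torus h")
      case True
      let ?D = "\<lambda>k. conv (?FA A) (?GA A) (\<xi> + (2 * pi / h) *\<^sub>R k) - conv ?F ?G (\<xi> + (2 * pi / h) *\<^sub>R k)"
      have c1: "1 \<le> ?c" using pi_ge_two by (intro one_le_power) simp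
      have c0: "complex_of_real ?c \<noteq> 0" by simp
      have "?T A \<xi> = periodize h (conv (?FA A) (?GA A)) \<xi> / of_real ?c"
        unfolding trigpoly_product_periodize[OF h A True] using c0 by (rule nonzero_mult_div_cancel_left[symmetric])
      then have "?T A \<xi> - P \<xi> = (\<Sum>k\<in>shifts. ?D k) / of_real ?c"
        unfolding P_def periodize_def by (simp add: sum_subtractf diff_divide_distrib)
      then have "(norm (?T A \<xi> - P \<xi>))\<^sup>2 \<le> (norm (\<Sum>k\<in>shifts. ?D k))\<^sup>2"
        using c1 by (simp only: norm_divide norm_of_real)
           (intro power_mono; simp add: divide_le_eq mult_le_cancel_left1 del: power_mult_distrib)
      also have "\<dots> \<le> real ?K * (\<Sum>k\<in>shifts. (norm (?D k))\<^sup>2)" by (rule norm_sum_sq_le)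
      finally have "ennreal ((norm (?T A \<xi> - P \<xi>))\<^sup>2) \<le> ennreal (real ?K * (\<Sum>k\<in>shifts. (norm (?D k))\<^sup>2))"
        by (rule ennreal_leI)
      also have "\<dots> = of_nat ?K * (\<Sum>k\<in>shifts. ennreal ((norm (?D k))\<^sup>2))"
        by (simp add: ennreal_mult sum_nonneg ennreal_of_nat_eq_real_of_nat)
      also have "\<dots> \<le> of_nat ?K * (\<Sum>k\<in>(shifts :: (real^'n) set). N A)"
        by (intro mult_left_mono sum_mono conv_le) auto
      also have "\<dots> = of_nat ?K * of_nat ?K * N A" by (simp add: mult.assoc)
      finally show ?thesis using True by simp
    qed simp
    then have "l2sq lborel (\<lambda>\<xi>. on_torus h (?T A) \<xi> - on_torus h P \<xi>)
       \<le> (\<integral>\<^sup>+\<xi>. of_nat ?K * of_nat ?K * N A * indicator (torus h) (\<xi> :: real^'n) \<partial>lborel)"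
      unfolding l2sq_def by (intro nn_integral_mono)
    also have "\<dots> = of_nat ?K * of_nat ?K * N A * emeasure lborel (torus h :: (real^'n) set)"
      by (rule nn_integral_cmult_indicator) simp
    finally show ?thesis by (simp only: mult_ac)
  qed
  have lim: "tendsto_L2 lborel (\<lambda>A. on_torus h (?T A)) (on_torus h P) ?fs"
    unfolding tendsto_L2_iff
  proof (rule tendsto_sandwich[OF _ _ tendsto_const])
    show "\<forall>\<^sub>F A in ?fs. l2sq lborel (\<lambda>\<xi>. on_torus h (?T A) \<xi> - on_torus h P \<xi>)
      \<le> (?V) * N A"
      by (intro eventually_finite_subsets_at_top_weakI bound)
    have "((\<lambda>A. (?V) * N A) \<longlongrightarrow>
      (?V) * (2 * (0 * l2sq lborel ?G) + 2 * ((2 * 0 + 2 * l2sq lborel ?F) * 0))) ?fs"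
      using torus_finite[of h, where 'a='n] by (intro tendsto_mult_ennreal tendsto_const Nlim) (auto simp: ennreal_mult_eq_top_iff)
    then show "((\<lambda>A. (?V) * N A) \<longlongrightarrow> 0) ?fs" by simp
  qed simp
  show "on_torus h (dft h (\<lambda>a. f a * g a)) \<in> L2_space lborel" by (rule dft_L2I[OF P lim])
  show "AE \<xi> in lborel. on_torus h (dft h (\<lambda>a. f a * g a)) \<xi> = on_torus h P \<xi>" by (rule dft_eqI[OF P lim])
qed

section \<open>The Sobolev weight\<close>

definition weight :: "real \<Rightarrow> real^'n \<Rightarrow> real" where
  "weight s \<xi> = (1 + (norm \<xi>)\<^sup>2) powr s"

lemma one_plus_norm_sq_pos: "0 < 1 + (norm \<xi>)\<^sup>2"
  by (rule add_pos_nonneg) auto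

lemma weight_pos: "0 < weight s \<xi>"
  using one_plus_norm_sq_pos[of \<xi>] by (simp add: weight_def)

lemma weight_nonneg [simp]: "0 \<le> weight s \<xi>"
  using weight_pos[of s \<xi>] by simp

lemma weight_measurable [measurable]: "weight s \<in> borel_measurable borel"
  unfolding weight_def[abs_def] by measurable

lemma weight_add: "weight (s + t) \<xi> = weight s \<xi> * weight t \<xi>"
  by (simp add: weight_def powr_add)

lemma weight_half: "(weight (s / 2) \<xi>)\<^sup>2 = weight s \<xi>"
  using weight_add[of "s / 2" "s / 2" \<xi>] by (simp add: power2_eq_square)

lemma weight_ge_1: "0 \<le> s \<Longrightarrow> 1 \<le> weight s \<xi>"
  unfolding weight_def by (rule ge_one_powr_ge_zero) auto

text \<open>
  The longer of \<open>\<eta>\<close> and \<open>\<xi> - \<eta>\<close> has at least half the length of \<open>\<xi>\<close>.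
\<close>

lemma weight_quasi_subadditive:
  fixes \<xi> \<eta> :: "real^'n"
  assumes "0 \<le> \<delta>"
  shows "weight (\<delta> / 2) \<xi> \<le> 2 powr \<delta> * (weight (\<delta> / 2) \<eta> + weight (\<delta> / 2) (\<xi> - \<eta>))"
proof -
  define m where "m = max (1 + (norm \<eta>)\<^sup>2) (1 + (norm (\<xi> - \<eta>))\<^sup>2)"
  have m: "0 < m" unfolding m_def using one_plus_norm_sq_pos[of \<eta>] by (simp add: less_max_iff_disj)
  have "norm \<xi> \<le> norm \<eta> + norm (\<xi> - \<eta>)" using norm_triangle_ineq[of \<eta> "\<xi> - \<eta>"] by simp
  then have "(norm \<xi>)\<^sup>2 \<le> (norm \<eta> + norm (\<xi> - \<eta>))\<^sup>2" by (rule power_mono) simp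
  also have "\<dots> \<le> 2 * (norm \<eta>)\<^sup>2 + 2 * (norm (\<xi> - \<eta>))\<^sup>2"
    using zero_le_power2[of "norm \<eta> - norm (\<xi> - \<eta>)"] by (simp add: power2_eq_square algebra_simps)
  finally have "(norm \<xi>)\<^sup>2 \<le> 2 * (norm \<eta>)\<^sup>2 + 2 * (norm (\<xi> - \<eta>))\<^sup>2" .
  moreover have "1 + (norm \<eta>)\<^sup>2 \<le> m" "1 + (norm (\<xi> - \<eta>))\<^sup>2 \<le> m" by (auto simp: m_def)
  ultimately have le: "1 + (norm \<xi>)\<^sup>2 \<le> 4 * m" by linarith
  have "weight (\<delta> / 2) \<xi> \<le> (4 * m) powr (\<delta> / 2)"
    unfolding weight_def using assms le one_plus_norm_sq_pos[of \<xi>] by (intro powr_mono2) auto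
  also have "\<dots> = 4 powr (\<delta> / 2) * m powr (\<delta> / 2)"
    using m by (intro powr_mult) 
  also have "(4::real) powr (\<delta> / 2) = 2 powr \<delta>"
  proof -
    have "(4::real) = 2 powr 2" by simp
    then have "(4::real) powr (\<delta> / 2) = (2 powr 2) powr (\<delta> / 2)" by (rule arg_cong)
    also have "\<dots> = 2 powr \<delta>" unfolding powr_powr by simp
    finally show ?thesis .
  qed
  also have "m powr (\<delta> / 2) \<le> weight (\<delta> / 2) \<eta> + weight (\<delta> / 2) (\<xi> - \<eta>)"
  proof (cases "m = 1 + (norm \<eta>)\<^sup>2")
    case True
    then have "m powr (\<delta> / 2) = weight (\<delta> / 2) \<eta>" by (simp only: weight_def)
    then show ?thesis by simp
  next
    case False
    then have "m = 1 + (norm (\<xi> - \<eta>))\<^sup>2" unfolding m_def max_def by argo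
    then have "m powr (\<delta> / 2) = weight (\<delta> / 2) (\<xi> - \<eta>)" by (simp only: weight_def)
    then show ?thesis by simp
  qed
  finally show ?thesis by simp
qed

lemma ball_borel [measurable]: "ball (a::'a::euclidean_space) R \<in> sets borel"
  by (intro borel_open open_ball)

text \<open>
  On the dyadic shell of radius \<open>2^k\<close> the weight is at most \<open>4^(-\<delta> k)\<close> and the volume is of order
  \<open>2^(n k)\<close>, so the integral is bounded by a geometric series with ratio \<open>2^(n - 2\<delta>) < 1\<close>.
\<close>

lemma weight_nn_integral_finite:
  assumes \<delta>: "real CARD('n) / 2 < \<delta>"
  shows "(\<integral>\<^sup>+\<xi>. ennreal (weight (- \<delta>) (\<xi> :: real^'n)) \<partial>lborel) < \<infinity>"
proof -
  define r where "r = (4::real) powr (- \<delta>)"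
  define V where "V = unit_ball_vol (real CARD('n)) * 2 ^ CARD('n)"
  define q where "q = r * 2 ^ CARD('n)"
  have \<delta>0: "0 < \<delta>" using \<delta> by (rule le_less_trans[rotated]) simp
  have r: "0 < r" by (simp add: r_def)
  have V: "0 \<le> V" by (simp add: V_def)
  have q0: "0 \<le> q" using r by (simp add: q_def)
  have q1: "q < 1"
  proof -
    have "r = 2 powr (- 2 * \<delta>)"
    proof -
      have "(4::real) = 2 powr 2" by simp
      then show ?thesis unfolding r_def by (simp only: powr_powr) simp
    qed
    moreover have "(2::real) ^ CARD('n) = 2 powr (real CARD('n))" by (simp add: powr_realpow)
    ultimately have "q = 2 powr (real CARD('n) - 2 * \<delta>)"
      unfolding q_def by (simp add: powr_add[symmetric])
    also have "\<dots> < 2 powr 0" using \<delta> by (intro powr_less_mono) auto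
    finally show ?thesis by simp
  qed
  let ?t = "\<lambda>k (\<xi> :: real^'n). ennreal (r ^ k) * indicator (ball 0 (2 ^ Suc k)) \<xi>"
  have le: "ennreal (weight (- \<delta>) \<xi>) \<le> (\<Sum>k. ?t k \<xi>)" for \<xi> :: "real^'n"
  proof -
    \<comment> \<open>The first ball that contains \<open>\<xi>\<close>; unless it is the smallest one, \<open>\<xi>\<close> has length at least \<open>2^k\<close>.\<close>
    let ?k = "LEAST k. norm \<xi> < 2 ^ Suc k"
    have "\<exists>k. norm \<xi> < 2 ^ Suc k"
    proof -
      obtain k where "norm \<xi> < 2 ^ k" using real_arch_pow[of 2 "norm \<xi>"] by auto
      then have "norm \<xi> < 2 ^ Suc k" by (rule less_le_trans) simp
      then show ?thesis ..
    qed
    then have k: "norm \<xi> < 2 ^ Suc ?k" by (rule LeastI_ex)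
    have "weight (- \<delta>) \<xi> \<le> r ^ ?k"
    proof (cases ?k)
      case 0
      have "weight (- \<delta>) \<xi> \<le> 1" using weight_ge_1[of \<delta> \<xi>] \<delta>0
        by (simp add: weight_def powr_minus inverse_le_1_iff)
      then show ?thesis unfolding 0 by simp
    next
      case (Suc j)
      have "\<not> norm \<xi> < 2 ^ Suc j" using not_less_Least[of j "\<lambda>k. norm \<xi> < 2 ^ Suc k"] Suc by auto
      then have "(2 ^ ?k)\<^sup>2 \<le> (norm \<xi>)\<^sup>2" unfolding Suc by (intro power_mono) auto
      then have ge: "4 ^ ?k \<le> 1 + (norm \<xi>)\<^sup>2" by (simp add: power_mult[symmetric] mult.commute[of _ 2]) (simp add: power_mult)
      have "weight (- \<delta>) \<xi> \<le> (4 ^ ?k) powr (- \<delta>)"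
        unfolding weight_def using ge \<delta>0 by (intro powr_mono2') auto
      also have "\<dots> = r ^ ?k" unfolding r_def by (simp add: powr_realpow[symmetric] powr_powr mult.commute)
      finally show ?thesis .
    qed
    define f :: "nat \<Rightarrow> ennreal" where "f k = ?t k \<xi>" for k
    have "ennreal (weight (- \<delta>) \<xi>) \<le> f ?k"
      using \<open>weight (- \<delta>) \<xi> \<le> r ^ ?k\<close> k unfolding f_def by (simp add: ennreal_leI)
    also have "f ?k \<le> (\<Sum>k. f k)"
      using sum_le_suminf[OF summableI, of "{?k}" f] by simp
    also have "\<dots> = (\<Sum>k. ?t k \<xi>)"
      by (simp only: f_def)
    finally show ?thesis .
  qed
  have "(\<integral>\<^sup>+\<xi>. ennreal (weight (- \<delta>) (\<xi> :: real^'n)) \<partial>lborel)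
      \<le> (\<integral>\<^sup>+\<xi>. (\<Sum>k. ?t k \<xi>) \<partial>lborel)"
    by (intro nn_integral_mono le)
  also have "\<dots> = (\<Sum>k. ennreal (r ^ k) * emeasure lborel (ball (0 :: real^'n) (2 ^ Suc k)))"
    by (subst nn_integral_suminf) (simp_all add: nn_integral_cmult_indicator borel_open)
  also have "\<dots> = (\<Sum>k. ennreal (V * q ^ k))"
  proof (rule suminf_cong)
    fix k :: nat
    have "emeasure lborel (ball (0 :: real^'n) (2 ^ Suc k)) = ennreal (unit_ball_vol (real CARD('n)) * (2 ^ Suc k) ^ CARD('n))"
      by (subst emeasure_ball) auto
    moreover have "r ^ k * (unit_ball_vol (real CARD('n)) * (2 ^ Suc k) ^ CARD('n)) = V * q ^ k"
      unfolding V_def q_def power_Suc power_mult_distrib power_mult[symmetric]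
      by (simp only: mult_ac)
    ultimately show "ennreal (r ^ k) * emeasure lborel (ball (0 :: real^'n) (2 ^ Suc k)) = ennreal (V * q ^ k)"
      using r by (simp only: ennreal_mult'[symmetric] zero_le_power less_imp_le)
  qed
  also have "\<dots> < \<infinity>"
    using q0 q1 V by (subst suminf_ennreal_eq[OF _ sums_mult[OF geometric_sums]]) auto
  finally show ?thesis .
qed

text \<open>
  If \<open>F\<close> is the Fourier transform of \<open>u\<close>, this is \<open>(2\<pi>)\<^sup>n\<close> times the squared Sobolev norm of \<open>u\<close>.
\<close>

definition wsq :: "real \<Rightarrow> (real^'n \<Rightarrow> complex) \<Rightarrow> ennreal" where
  "wsq s F = (\<integral>\<^sup>+\<xi>. ennreal (weight s \<xi> * (norm (F \<xi>))\<^sup>2) \<partial>lborel)"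

lemma wsq_eq_half: "wsq s F = (\<integral>\<^sup>+\<xi>. (ennreal (weight (s / 2) \<xi> * norm (F \<xi>)))\<^sup>2 \<partial>lborel)"
  unfolding wsq_def by (simp add: ennreal_power power_mult_distrib weight_half)

lemma wsq_cong_AE: "AE \<xi> in lborel. F \<xi> = G \<xi> \<Longrightarrow> wsq s F = wsq s G"
  unfolding wsq_def by (intro nn_integral_cong_AE) auto

lemma l2sq_le_wsq:
  assumes "0 \<le> s"
  shows "l2sq lborel F \<le> wsq s F"
  unfolding l2sq_def wsq_def
proof (intro nn_integral_mono ennreal_leI)
  fix \<xi>
  show "(norm (F \<xi>))\<^sup>2 \<le> weight s \<xi> * (norm (F \<xi>))\<^sup>2"
    using mult_right_mono[OF weight_ge_1[OF assms, of \<xi>], of "(norm (F \<xi>))\<^sup>2"] by simp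
qed

text \<open>
  The Fourier-side form of the Sobolev embedding into bounded functions. The first factor is finite when
  \<open>\<delta> > n/2\<close>.
\<close>

lemma L1_le_wsq:
  fixes G :: "real^'n \<Rightarrow> complex"
  assumes [measurable]: "G \<in> borel_measurable borel"
  shows "(\<integral>\<^sup>+\<xi>. ennreal (norm (G \<xi>)) \<partial>lborel)\<^sup>2 \<le> (\<integral>\<^sup>+\<xi>. ennreal (weight (- \<delta>) (\<xi> :: real^'n)) \<partial>lborel) * wsq \<delta> G"
proof -
  have cancel: "norm (G \<xi>) = weight (- \<delta> / 2) \<xi> * (weight (\<delta> / 2) \<xi> * norm (G \<xi>))" for \<xi>
  proof -
    have "weight (- \<delta> / 2) \<xi> * weight (\<delta> / 2) \<xi> = weight 0 \<xi>"
      by (simp add: weight_add[symmetric])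
    also have "\<dots> = 1" using one_plus_norm_sq_pos[of \<xi>] by (simp add: weight_def)
    finally show ?thesis by (simp only: mult.assoc[symmetric] mult_1_left)
  qed
  have "(\<integral>\<^sup>+\<xi>. ennreal (norm (G \<xi>)) \<partial>lborel) =
      (\<integral>\<^sup>+\<xi>. ennreal (weight (- \<delta> / 2) \<xi>) * ennreal (weight (\<delta> / 2) \<xi> * norm (G \<xi>)) \<partial>lborel)"
    by (intro nn_integral_cong, subst ennreal_mult[symmetric]) (simp_all only: cancel[symmetric] weight_nonneg mult_nonneg_nonneg norm_ge_zero)
  also have "\<dots>\<^sup>2 \<le> (\<integral>\<^sup>+\<xi>. (ennreal (weight (- \<delta> / 2) (\<xi> :: real^'n)))\<^sup>2 \<partial>lborel) *
      (\<integral>\<^sup>+\<xi>. (ennreal (weight (\<delta> / 2) \<xi> * norm (G \<xi>)))\<^sup>2 \<partial>lborel)"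
    by (rule Cauchy_Schwarz_nn_integral) simp_all
  also have "\<dots> = (\<integral>\<^sup>+\<xi>. ennreal (weight (- \<delta>) (\<xi> :: real^'n)) \<partial>lborel) * wsq \<delta> G"
    unfolding wsq_eq_half by (simp only: ennreal_power[OF weight_nonneg] weight_half)
  finally show ?thesis .
qed

section \<open>The Sobolev space as an algebra\<close>

text \<open>
  Young's inequality for an integrable and a square-integrable factor: the Cauchy--Schwarz inequality
  with \<open>q\<close> split into two square roots, followed by Tonelli's theorem.
\<close>

lemma young_nn:
  fixes p q :: "real^'n \<Rightarrow> real"
  assumes [measurable]: "p \<in> borel_measurable borel" "q \<in> borel_measurable borel"
    and q: "\<And>x. 0 \<le> q x"
  shows "(\<integral>\<^sup>+\<xi>. (\<integral>\<^sup>+\<eta>. ennreal (p \<eta>) * ennreal (q (\<xi> - \<eta>)) \<partial>lborel)\<^sup>2 \<partial>lborel)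
    \<le> (\<integral>\<^sup>+\<eta>. (ennreal (p \<eta>))\<^sup>2 \<partial>lborel) * (\<integral>\<^sup>+x. ennreal (q x) \<partial>lborel)\<^sup>2"
proof -
  let ?Q = "\<integral>\<^sup>+x. ennreal (q x) \<partial>lborel"
  let ?J = "\<lambda>\<xi>. \<integral>\<^sup>+\<eta>. (ennreal (p \<eta>))\<^sup>2 * ennreal (q (\<xi> - \<eta>)) \<partial>lborel" and ?I = "\<lambda>\<xi>. \<integral>\<^sup>+\<eta>. ennreal (p \<eta>) * ennreal (q (\<xi> - \<eta>)) \<partial>lborel"
  have sq: "(ennreal (sqrt (q x)))\<^sup>2 = ennreal (q x)" for x
    using q[of x] by (simp add: ennreal_power)
  have Q: "(\<integral>\<^sup>+\<eta>. ennreal (q (\<xi> - \<eta>)) \<partial>lborel) = ?Q" for \<xi>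
    by (rule nn_integral_lborel_shift_reflect) simp
  have Q': "(\<integral>\<^sup>+\<xi>. ennreal (q (\<xi> - \<eta>)) \<partial>lborel) = ?Q" for \<eta>
    using nn_integral_lborel_affine[of "\<lambda>x. ennreal (q x)" 1 "- \<eta>"] by simp
  have "(?I \<xi>)\<^sup>2
      \<le> (?J \<xi>) * ?Q" for \<xi>
  proof -
    have "(?I \<xi>)
        = (\<integral>\<^sup>+\<eta>. (ennreal (p \<eta>) * ennreal (sqrt (q (\<xi> - \<eta>)))) * ennreal (sqrt (q (\<xi> - \<eta>))) \<partial>lborel)"
      unfolding mult.assoc power2_eq_square[symmetric] sq ..
    also have "\<dots>\<^sup>2 \<le> (\<integral>\<^sup>+\<eta>. (ennreal (p \<eta>) * ennreal (sqrt (q (\<xi> - \<eta>))))\<^sup>2 \<partial>lborel) * (\<integral>\<^sup>+\<eta>. (ennreal (sqrt (q (\<xi> - \<eta>))))\<^sup>2 \<partial>lborel)"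
      by (rule Cauchy_Schwarz_nn_integral) measurable
    finally show ?thesis unfolding power_mult_distrib sq Q .
  qed
  then have "(\<integral>\<^sup>+\<xi>. (?I \<xi>)\<^sup>2 \<partial>lborel)
      \<le> (\<integral>\<^sup>+\<xi>. (?J \<xi>) * ?Q \<partial>lborel)"
    by (rule nn_integral_mono)
  also have "\<dots> = (\<integral>\<^sup>+\<xi>. (?J \<xi>) \<partial>lborel) * ?Q"
    by (rule nn_integral_multc) measurable
  also have "(\<integral>\<^sup>+\<xi>. (?J \<xi>) \<partial>lborel)
      = (\<integral>\<^sup>+\<eta>. (\<integral>\<^sup>+\<xi>. (ennreal (p \<eta>))\<^sup>2 * ennreal (q (\<xi> - \<eta>)) \<partial>lborel) \<partial>lborel)"
    by (rule lborel_pair.Fubini') measurable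
  also have "\<dots> = (\<integral>\<^sup>+\<eta>. (ennreal (p \<eta>))\<^sup>2 * ?Q \<partial>lborel)"
    by (subst nn_integral_cmult) (simp_all add: Q')
  also have "\<dots> = (\<integral>\<^sup>+\<eta>. (ennreal (p \<eta>))\<^sup>2 \<partial>lborel) * ?Q"
    by (rule nn_integral_multc) measurable
  finally show ?thesis by (simp only: power2_eq_square mult.assoc)
qed

lemma ennreal_sum_sq_le: "(x + y)\<^sup>2 \<le> 2 * x\<^sup>2 + 2 * (y::ennreal)\<^sup>2"
proof -
  have "(x + y)\<^sup>2 = x\<^sup>2 + y\<^sup>2 + 2 * x * y" by (simp add: power2_eq_square distrib_left distrib_right mult_2_right mult_ac add_ac)
  also have "\<dots> \<le> x\<^sup>2 + y\<^sup>2 + (x\<^sup>2 + y\<^sup>2)"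
    by (intro add_left_mono sum_of_squares_ge_ennreal)
  also have "\<dots> = 2 * x\<^sup>2 + 2 * y\<^sup>2" by (simp add: mult_2 add_ac)
  finally show ?thesis .
qed

text \<open>
  The Sobolev space is an algebra. The weight at \<open>\<xi>\<close> is distributed to one of the two factors, which then
  enters Young's inequality with its Sobolev norm, while the other factor enters with the norm of
  \<open>L\<^sup>1\<close>.
\<close>

theorem wsq_conv:
  fixes F G :: "real^'n \<Rightarrow> complex"
  assumes [measurable]: "F \<in> borel_measurable borel" "G \<in> borel_measurable borel" and \<delta>: "0 \<le> \<delta>"
  shows "wsq \<delta> (conv F G) \<le> 4 * (ennreal (2 powr \<delta>))\<^sup>2 * (\<integral>\<^sup>+\<xi>. ennreal (weight (- \<delta>) (\<xi> :: real^'n)) \<partial>lborel) * (wsq \<delta> F * wsq \<delta> G)"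
proof -
  let ?W = "\<integral>\<^sup>+\<xi>. ennreal (weight (- \<delta>) (\<xi> :: real^'n)) \<partial>lborel"
  let ?c = "ennreal (2 powr \<delta>)"
  let ?w = "weight (\<delta> / 2)"
  define p where "p \<eta> = ?w \<eta> * norm (F \<eta>)" for \<eta>
  define q where "q \<eta> = ?w \<eta> * norm (G \<eta>)" for \<eta>
  have [measurable]: "p \<in> borel_measurable borel" "q \<in> borel_measurable borel"
    unfolding p_def[abs_def] q_def[abs_def] by measurable
  have pq: "0 \<le> p x" "0 \<le> q x" for x by (auto simp: p_def q_def)
  \<comment> \<open>In \<open>I1\<close> the weight sits on \<open>F\<close>, in \<open>I2\<close> on \<open>G\<close>.\<close>
  define I1 where "I1 \<xi> = (\<integral>\<^sup>+\<eta>. ennreal (p \<eta>) * ennreal (norm (G (\<xi> - \<eta>))) \<partial>lborel)" for \<xi>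
  define I2 where "I2 \<xi> = (\<integral>\<^sup>+\<eta>. ennreal (q \<eta>) * ennreal (norm (F (\<xi> - \<eta>))) \<partial>lborel)" for \<xi>
  have [measurable]: "I1 \<in> borel_measurable borel" "I2 \<in> borel_measurable borel"
    unfolding I1_def[abs_def] I2_def[abs_def] by measurable
  have I2_eq: "I2 \<xi> = (\<integral>\<^sup>+\<eta>. ennreal (norm (F \<eta>)) * ennreal (q (\<xi> - \<eta>)) \<partial>lborel)" for \<xi>
    unfolding I2_def
    using nn_integral_lborel_shift_reflect[of "\<lambda>\<eta>. ennreal (norm (F \<eta>)) * ennreal (q (\<xi> - \<eta>))" \<xi>]
    by (simp add: mult.commute)
  have pt: "ennreal (?w \<xi> * norm (conv F G \<xi>)) \<le> ?c * (I1 \<xi> + I2 \<xi>)" for \<xi>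
  proof -
    have "ennreal (?w \<xi> * norm (conv F G \<xi>)) = ennreal (?w \<xi>) * ennreal (norm (conv F G \<xi>))"
      by (simp add: ennreal_mult)
    also have "\<dots> \<le> ennreal (?w \<xi>) * (\<integral>\<^sup>+\<eta>. ennreal (norm (F \<eta> * G (\<xi> - \<eta>))) \<partial>lborel)"
      unfolding conv_def by (intro mult_left_mono nn_integral_norm_bound) simp
    also have "\<dots> = (\<integral>\<^sup>+\<eta>. ennreal (?w \<xi>) * ennreal (norm (F \<eta> * G (\<xi> - \<eta>))) \<partial>lborel)"
      by (rule nn_integral_cmult[symmetric]) measurable
    also have "\<dots> \<le> (\<integral>\<^sup>+\<eta>. ?c * (ennreal (p \<eta>) * ennreal (norm (G (\<xi> - \<eta>))) + ennreal (norm (F \<eta>)) * ennreal (q (\<xi> - \<eta>))) \<partial>lborel)"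
    proof (rule nn_integral_mono)
      fix \<eta> :: "real^'n"
      have "?w \<xi> * norm (F \<eta> * G (\<xi> - \<eta>))
          \<le> 2 powr \<delta> * (?w \<eta> + ?w (\<xi> - \<eta>)) * norm (F \<eta> * G (\<xi> - \<eta>))"
        by (intro mult_right_mono weight_quasi_subadditive \<delta>) simp
      also have "\<dots> = 2 powr \<delta> * (p \<eta> * norm (G (\<xi> - \<eta>)) + norm (F \<eta>) * q (\<xi> - \<eta>))"
        unfolding p_def q_def norm_mult by (simp add: algebra_simps)
      finally have "ennreal (?w \<xi> * norm (F \<eta> * G (\<xi> - \<eta>)))
         \<le> ennreal (2 powr \<delta> * (p \<eta> * norm (G (\<xi> - \<eta>)) + norm (F \<eta>) * q (\<xi> - \<eta>)))"
        by (rule ennreal_leI)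
      then show "ennreal (?w \<xi>) * ennreal (norm (F \<eta> * G (\<xi> - \<eta>)))
        \<le> ?c * (ennreal (p \<eta>) * ennreal (norm (G (\<xi> - \<eta>))) + ennreal (norm (F \<eta>)) * ennreal (q (\<xi> - \<eta>)))"
        using pq by (simp add: ennreal_mult ennreal_plus)
    qed
    also have "\<dots> = ?c * (I1 \<xi> + I2 \<xi>)"
      unfolding I1_def I2_eq by (subst nn_integral_cmult, measurable, subst nn_integral_add) auto
    finally show ?thesis .
  qed
  have Y1: "(\<integral>\<^sup>+\<xi>. (I1 \<xi>)\<^sup>2 \<partial>lborel) \<le> wsq \<delta> F * (?W * wsq \<delta> G)"
  proof -
    have "(\<integral>\<^sup>+\<xi>. (I1 \<xi>)\<^sup>2 \<partial>lborel) \<le> (\<integral>\<^sup>+\<eta>. (ennreal (p \<eta>))\<^sup>2 \<partial>lborel) * (\<integral>\<^sup>+x. ennreal (norm (G x)) \<partial>lborel)\<^sup>2"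
      unfolding I1_def by (rule young_nn) simp_all
    also have "\<dots> \<le> wsq \<delta> F * (?W * wsq \<delta> G)"
      unfolding wsq_eq_half[of \<delta> F] p_def by (intro mult_left_mono L1_le_wsq) simp_all
    finally show ?thesis .
  qed
  have Y2: "(\<integral>\<^sup>+\<xi>. (I2 \<xi>)\<^sup>2 \<partial>lborel) \<le> wsq \<delta> G * (?W * wsq \<delta> F)"
  proof -
    have "(\<integral>\<^sup>+\<xi>. (I2 \<xi>)\<^sup>2 \<partial>lborel) \<le> (\<integral>\<^sup>+\<eta>. (ennreal (q \<eta>))\<^sup>2 \<partial>lborel) * (\<integral>\<^sup>+x. ennreal (norm (F x)) \<partial>lborel)\<^sup>2"
      unfolding I2_def by (rule young_nn) simp_all
    also have "\<dots> \<le> wsq \<delta> G * (?W * wsq \<delta> F)"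
      unfolding wsq_eq_half[of \<delta> G] q_def by (intro mult_left_mono L1_le_wsq) simp_all
    finally show ?thesis .
  qed
  have "wsq \<delta> (conv F G) \<le> (\<integral>\<^sup>+\<xi>. ?c\<^sup>2 * (2 * (I1 \<xi>)\<^sup>2 + 2 * (I2 \<xi>)\<^sup>2) \<partial>lborel)"
    unfolding wsq_eq_half
  proof (rule nn_integral_mono)
    fix \<xi> :: "real^'n"
    have "(ennreal (?w \<xi> * norm (conv F G \<xi>)))\<^sup>2 \<le> (?c * (I1 \<xi> + I2 \<xi>))\<^sup>2"
      by (rule power_mono_ennreal[OF pt])
    also have "\<dots> = ?c\<^sup>2 * (I1 \<xi> + I2 \<xi>)\<^sup>2" by (rule power_mult_distrib)
    also have "\<dots> \<le> ?c\<^sup>2 * (2 * (I1 \<xi>)\<^sup>2 + 2 * (I2 \<xi>)\<^sup>2)" by (intro mult_left_mono ennreal_sum_sq_le) simp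
    finally show "(ennreal (?w \<xi> * norm (conv F G \<xi>)))\<^sup>2 \<le> ?c\<^sup>2 * (2 * (I1 \<xi>)\<^sup>2 + 2 * (I2 \<xi>)\<^sup>2)" .
  qed
  also have "\<dots> = ?c\<^sup>2 * (2 * (\<integral>\<^sup>+\<xi>. (I1 \<xi>)\<^sup>2 \<partial>lborel) + 2 * (\<integral>\<^sup>+\<xi>. (I2 \<xi>)\<^sup>2 \<partial>lborel))"
    by (subst nn_integral_cmult, measurable, subst nn_integral_add) (auto simp: nn_integral_cmult)
  also have "\<dots> \<le> ?c\<^sup>2 * (2 * (wsq \<delta> F * (?W * wsq \<delta> G)) + 2 * (wsq \<delta> G * (?W * wsq \<delta> F)))"
    by (intro mult_left_mono add_mono Y1 Y2) simp_all
  also have "2 * (wsq \<delta> F * (?W * wsq \<delta> G)) + 2 * (wsq \<delta> G * (?W * wsq \<delta> F)) = 4 * (?W * (wsq \<delta> F * wsq \<delta> G))"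
  proof -
    have "wsq \<delta> F * (?W * wsq \<delta> G) = ?W * (wsq \<delta> F * wsq \<delta> G)" "wsq \<delta> G * (?W * wsq \<delta> F) = ?W * (wsq \<delta> F * wsq \<delta> G)"
      by (simp_all only: mult_ac)
    then show ?thesis by (simp only: distrib_right[symmetric]) simp
  qed
  finally show ?thesis by (simp only: mult_ac)
qed

section \<open>The aliasing error\<close>

text \<open>
  This is the source of the power of \<open>h\<close>: at frequencies beyond \<open>\<pi>/h\<close>, each derivative given up gains a
  factor \<open>h\<close>.
\<close>

lemma weight_far:
  fixes \<eta> :: "real^'n"
  assumes h: "0 < h" and s: "s \<le> \<delta>" and \<eta>: "pi / h \<le> norm \<eta>"
  shows "weight s \<eta> \<le> (h powr (\<delta> - s))\<^sup>2 * weight \<delta> \<eta>"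
proof -
  let ?t = "\<delta> - s"
  have "1 / h \<le> norm \<eta>"
    using \<eta> h pi_ge_two by (intro order_trans[OF _ \<eta>] divide_right_mono) auto
  then have "1 / h * (1 / h) \<le> norm \<eta> * norm \<eta>" using h by (intro mult_mono) auto
  then have "1 / h * (1 / h) \<le> 1 + (norm \<eta>)\<^sup>2" unfolding power2_eq_square by linarith
  then have le: "(1 / h * (1 / h)) powr ?t \<le> weight ?t \<eta>"
    unfolding weight_def using h s by (intro powr_mono2) auto
  have "(h powr ?t)\<^sup>2 * (1 / h * (1 / h)) powr ?t = (h * (1 / h)) powr ?t * (h * (1 / h)) powr ?t"
    using h unfolding power2_eq_square by (simp only: powr_mult less_imp_le divide_nonneg_nonneg zero_le_one mult_ac)
  also have "\<dots> = 1" using h by simp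
  finally have "1 \<le> (h powr ?t)\<^sup>2 * weight ?t \<eta>"
    using mult_left_mono[OF le, of "(h powr ?t)\<^sup>2"] by simp
  then have "weight s \<eta> * 1 \<le> weight s \<eta> * ((h powr ?t)\<^sup>2 * weight ?t \<eta>)"
    by (intro mult_left_mono) auto
  also have "\<dots> = (h powr ?t)\<^sup>2 * weight (s + ?t) \<eta>" unfolding weight_add by (simp only: mult_ac)
  finally show ?thesis by simp
qed

text \<open>
  Points of the torus cube have length at most \<open>\<surd>n \<pi>/h\<close>.
\<close>

lemma weight_on_torus:
  fixes \<xi> \<eta> :: "real^'n"
  assumes h: "0 < h" and s: "0 \<le> s" and \<xi>: "\<xi> \<in> torus h" and \<eta>: "pi / h \<le> norm \<eta>"
  shows "weight s \<xi> \<le> real CARD('n) powr s * weight s \<eta>"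
proof -
  let ?n = "real CARD('n)"
  have n: "1 \<le> ?n" by (simp add: Suc_leI)
  have "(\<xi> $ j)\<^sup>2 \<le> (norm \<eta>)\<^sup>2" for j
  proof -
    have "\<bar>\<xi> $ j\<bar> \<le> pi / h" using \<xi> unfolding mem_torus by (simp add: abs_le_iff minus_le_iff)
    then have "\<bar>\<xi> $ j\<bar> \<le> norm \<eta>" using \<eta> by linarith
    then have "\<bar>\<xi> $ j\<bar>\<^sup>2 \<le> (norm \<eta>)\<^sup>2" by (rule power_mono) simp
    then show ?thesis by simp
  qed
  then have "(\<Sum>j\<in>UNIV. (\<xi> $ j)\<^sup>2) \<le> (\<Sum>j\<in>(UNIV :: 'n set). (norm \<eta>)\<^sup>2)" by (rule sum_mono)
  moreover have "(norm \<xi>)\<^sup>2 = (\<Sum>j\<in>UNIV. (\<xi> $ j)\<^sup>2)"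
    by (simp add: norm_vec_def L2_set_def sum_nonneg)
  ultimately have "(norm \<xi>)\<^sup>2 \<le> ?n * (norm \<eta>)\<^sup>2" by simp
  then have "1 + (norm \<xi>)\<^sup>2 \<le> ?n * (1 + (norm \<eta>)\<^sup>2)" using n unfolding distrib_left by linarith
  then have "weight s \<xi> \<le> (?n * (1 + (norm \<eta>)\<^sup>2)) powr s"
    unfolding weight_def using s by (intro powr_mono2) auto
  also have "\<dots> = ?n powr s * weight s \<eta>"
    unfolding weight_def using n by (intro powr_mult)
  finally show ?thesis .
qed

lemma norm_shift_ge:
  fixes \<xi> k :: "real^'n"
  assumes h: "0 < h" and \<xi>: "\<xi> \<in> torus h" and k: "k \<in> shifts" "k \<noteq> 0"
  shows "pi / h \<le> norm (\<xi> + (2 * pi / h) *\<^sub>R k)"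
proof -
  define p where "p = pi / h"
  obtain j where "k $ j \<noteq> 0" using k(2) by (auto simp: vec_eq_iff)
  then have kj: "k $ j = 1 \<or> k $ j = -1" using k(1) by (auto simp: shifts_def)
  have "- p \<le> \<xi> $ j" "\<xi> $ j \<le> p" using \<xi> unfolding mem_torus p_def by auto
  then have "p \<le> \<bar>\<xi> $ j + 2 * p * k $ j\<bar>" using kj by auto
  also have "\<xi> $ j + 2 * p * k $ j = (\<xi> + (2 * pi / h) *\<^sub>R k) $ j" by (simp add: p_def)
  also have "\<bar>\<dots>\<bar> \<le> norm (\<xi> + (2 * pi / h) *\<^sub>R k)" by (rule component_le_norm_cart)
  finally show ?thesis by (simp only: p_def)
qed

lemma norm_outside_torus_ge:
  fixes \<xi> :: "real^'n"
  assumes "\<xi> \<notin> torus h"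
  shows "pi / h \<le> norm \<xi>"
proof -
  obtain j where "\<not> (- pi / h \<le> \<xi> $ j \<and> \<xi> $ j \<le> pi / h)" using assms by (auto simp: mem_torus)
  then have "pi / h \<le> \<bar>\<xi> $ j\<bar>" by (auto simp: abs_if)
  also have "\<dots> \<le> norm \<xi>" by (rule component_le_norm_cart)
  finally show ?thesis .
qed

lemma wsq_on_torus_finite:
  fixes f :: "real^'n \<Rightarrow> complex"
  assumes h: "0 < h" and s: "0 \<le> s" and f: "on_torus h f \<in> L2_space lborel"
  shows "wsq s (on_torus h f) < \<infinity>"
proof -
  have [measurable]: "on_torus h f \<in> borel_measurable borel" using f by auto
  obtain \<eta> :: "real^'n" where "norm \<eta> = pi / h"
    using vector_choose_size[of "pi / h"] h by auto
  then have \<eta>: "pi / h \<le> norm \<eta>" by simp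
  define B where "B = real CARD('n) powr s * weight s \<eta>"
  have B: "0 \<le> B" by (simp add: B_def)
  have "wsq s (on_torus h f) \<le> (\<integral>\<^sup>+\<xi>. ennreal B * ennreal ((norm (on_torus h f \<xi>))\<^sup>2) \<partial>lborel)"
    unfolding wsq_def
  proof (rule nn_integral_mono)
    fix \<xi> :: "real^'n"
    have "weight s \<xi> * (norm (on_torus h f \<xi>))\<^sup>2 \<le> B * (norm (on_torus h f \<xi>))\<^sup>2"
    proof (cases "\<xi> \<in> torus h")
      case True
      then show ?thesis unfolding B_def by (intro mult_right_mono weight_on_torus[OF h s _ \<eta>]) auto
    qed simp
    then show "ennreal (weight s \<xi> * (norm (on_torus h f \<xi>))\<^sup>2) \<le> ennreal B * ennreal ((norm (on_torus h f \<xi>))\<^sup>2)"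
      unfolding ennreal_mult[OF B zero_le_power2, symmetric] by (rule ennreal_leI)
  qed
  also have "\<dots> = ennreal B * l2sq lborel (on_torus h f)"
    unfolding l2sq_def by (rule nn_integral_cmult) measurable
  also have "\<dots> < \<infinity>" using f by (simp add: L2_space_iff ennreal_mult_less_top)
  finally show ?thesis .
qed

lemma zero_in_shifts [simp]: "0 \<in> shifts"
  by (simp add: shifts_def)

text \<open>
  On the torus the term \<open>k = 0\<close> of the periodization cancels against \<open>H\<close>, and the remaining terms
  evaluate \<open>H\<close> at frequencies of length at least \<open>\<pi>/h\<close>. Off the torus what is left is \<open>H\<close> itself, again at
  such frequencies. There the weight of order \<open>s\<close> may be traded for the weight of order \<open>\<delta>\<close>.
\<close>

lemma aliasing_bound:
  fixes H :: "real^'n \<Rightarrow> complex"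
  assumes h: "0 < h" and s: "0 \<le> s" "s \<le> \<delta>" and c: "1 \<le> c"
    and [measurable]: "H \<in> borel_measurable borel"
  defines "K \<equiv> real (card (shifts :: (real^'n) set))"
  shows "wsq s (\<lambda>\<xi>. on_torus h (\<lambda>\<xi>. periodize h H \<xi> / complex_of_real c) \<xi> - H \<xi> / complex_of_real c)
    \<le> ennreal ((K * real CARD('n) powr s + 1) * K * (h powr (\<delta> - s))\<^sup>2) * wsq \<delta> H"
proof -
  let ?y = "\<lambda>\<xi> k. \<xi> + (2 * pi / h) *\<^sub>R k"
  let ?D = "\<lambda>\<xi>. on_torus h (\<lambda>\<xi>. periodize h H \<xi> / complex_of_real c) \<xi> - H \<xi> / complex_of_real c"
  let ?n = "real CARD('n) powr s"
  let ?p = "(h powr (\<delta> - s))\<^sup>2"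
  \<comment> \<open>The summand \<open>K * n powr s\<close> serves the torus, the summand \<open>1\<close> its complement.\<close>
  define M where "M = K * ?n + 1"
  have K: "0 \<le> K" by (simp add: K_def)
  have M: "0 \<le> M" "1 \<le> M" "K * ?n \<le> M" using K by (simp_all add: M_def)
  define T where "T \<xi> k = weight \<delta> (?y \<xi> k) * (norm (H (?y \<xi> k)))\<^sup>2" for \<xi> k
  have T: "0 \<le> T \<xi> k" for \<xi> k by (simp add: T_def)
  let ?N = "\<lambda>\<xi> k. (norm (H (?y \<xi> k)))\<^sup>2"
  have drop_c: "(norm (z / complex_of_real c))\<^sup>2 \<le> (norm z)\<^sup>2" for z
  proof (rule power_mono)
    have "norm (z / complex_of_real c) = norm z / c" using c by (simp add: norm_divide)
    also have "\<dots> \<le> norm z / 1" using c by (intro divide_left_mono) auto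
    finally show "norm (z / complex_of_real c) \<le> norm z" by simp
  qed simp
  have pt: "weight s \<xi> * (norm (?D \<xi>))\<^sup>2 \<le> M * ?p * (\<Sum>k\<in>shifts. T \<xi> k)" for \<xi>
  proof (cases "\<xi> \<in> torus h")
    case True
    have "periodize h H \<xi> = H (?y \<xi> 0) + (\<Sum>k\<in>shifts - {0}. H (?y \<xi> k))"
      unfolding periodize_def by (rule sum.remove) simp_all
    then have "?D \<xi> = (\<Sum>k\<in>shifts - {0}. H (?y \<xi> k)) / complex_of_real c"
      using True by (simp add: diff_divide_distrib[symmetric])
    then have "(norm (?D \<xi>))\<^sup>2 \<le> (norm (\<Sum>k\<in>shifts - {0}. H (?y \<xi> k)))\<^sup>2"
      by (simp only: drop_c)
    also have "\<dots> \<le> real (card ((shifts :: (real^'n) set) - {0})) * (\<Sum>k\<in>shifts - {0}. ?N \<xi> k)"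
      by (rule norm_sum_sq_le)
    also have "\<dots> \<le> K * (\<Sum>k\<in>shifts - {0}. ?N \<xi> k)"
      unfolding K_def by (intro mult_right_mono sum_nonneg of_nat_mono card_mono) auto
    finally have "weight s \<xi> * (norm (?D \<xi>))\<^sup>2 \<le> weight s \<xi> * (K * (\<Sum>k\<in>shifts - {0}. ?N \<xi> k))"
      by (rule mult_left_mono) simp
    also have "\<dots> = K * (\<Sum>k\<in>shifts - {0}. weight s \<xi> * ?N \<xi> k)"
      unfolding sum_distrib_left by (intro sum.cong refl) (simp only: mult_ac)
    also have "\<dots> \<le> K * (\<Sum>k\<in>shifts - {0}. ?n * ?p * T \<xi> k)"
    proof (intro mult_left_mono sum_mono K)
      fix k :: "real^'n" assume k: "k \<in> shifts - {0}"
      then have far: "pi / h \<le> norm (?y \<xi> k)" by (intro norm_shift_ge[OF h True]) auto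
      have "weight s \<xi> \<le> ?n * weight s (?y \<xi> k)" by (rule weight_on_torus[OF h s(1) True far])
      also have "\<dots> \<le> ?n * (?p * weight \<delta> (?y \<xi> k))"
        by (intro mult_left_mono weight_far[OF h s(2) far]) simp
      finally have "weight s \<xi> * ?N \<xi> k \<le> ?n * (?p * weight \<delta> (?y \<xi> k)) * ?N \<xi> k"
        by (rule mult_right_mono) simp
      then show "weight s \<xi> * ?N \<xi> k \<le> ?n * ?p * T \<xi> k"
        by (simp only: T_def mult.assoc)
    qed
    also have "\<dots> = K * ?n * (?p * (\<Sum>k\<in>shifts - {0}. T \<xi> k))"
      unfolding sum_distrib_left[symmetric] by (simp only: mult.assoc)
    also have "\<dots> \<le> M * (?p * (\<Sum>k\<in>shifts. T \<xi> k))"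
      by (intro mult_mono M mult_nonneg_nonneg sum_nonneg T mult_left_mono sum_mono2) auto
    finally show ?thesis by (simp only: mult.assoc)
  next
    case False
    then have D: "?D \<xi> = (- H \<xi>) / complex_of_real c" by simp
    have "weight s \<xi> * (norm (?D \<xi>))\<^sup>2 \<le> (?p * weight \<delta> \<xi>) * (norm (- H \<xi>))\<^sup>2"
      unfolding D by (intro mult_mono weight_far[OF h s(2) norm_outside_torus_ge[OF False]] drop_c) auto
    also have "\<dots> = ?p * T \<xi> 0" by (simp add: T_def)
    also have "\<dots> \<le> ?p * (\<Sum>k\<in>shifts. T \<xi> k)"
      by (intro mult_left_mono member_le_sum T) auto
    also have "\<dots> = 1 * (?p * (\<Sum>k\<in>shifts. T \<xi> k))" by simp
    also have "\<dots> \<le> M * (?p * (\<Sum>k\<in>shifts. T \<xi> k))"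
      by (intro mult_right_mono M mult_nonneg_nonneg sum_nonneg T) auto
    finally show ?thesis by (simp only: mult.assoc)
  qed
  have Mp: "0 \<le> M * ?p" using M by simp
  have "wsq s ?D \<le> (\<integral>\<^sup>+\<xi>. ennreal (M * ?p) * (\<Sum>k\<in>shifts. ennreal (T \<xi> k)) \<partial>lborel)"
    unfolding wsq_def
  proof (rule nn_integral_mono)
    fix \<xi> :: "real^'n"
    have "ennreal (weight s \<xi> * (norm (?D \<xi>))\<^sup>2) \<le> ennreal (M * ?p * (\<Sum>k\<in>shifts. T \<xi> k))"
      by (rule ennreal_leI[OF pt])
    also have "\<dots> = ennreal (M * ?p) * (\<Sum>k\<in>shifts. ennreal (T \<xi> k))"
      using Mp T by (subst ennreal_mult) (auto intro: sum_nonneg)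
    finally show "ennreal (weight s \<xi> * (norm (?D \<xi>))\<^sup>2) \<le> ennreal (M * ?p) * (\<Sum>k\<in>shifts. ennreal (T \<xi> k))" .
  qed
  also have "\<dots> = ennreal (M * ?p) * (\<Sum>k\<in>shifts. (\<integral>\<^sup>+\<xi>. ennreal (T \<xi> k) \<partial>lborel))"
    unfolding T_def by (subst nn_integral_cmult, measurable, subst nn_integral_sum) auto
  also have "(\<Sum>k\<in>shifts. (\<integral>\<^sup>+\<xi>. ennreal (T \<xi> k) \<partial>lborel)) = (\<Sum>k\<in>(shifts :: (real^'n) set). wsq \<delta> H)"
  proof (rule sum.cong[OF refl])
    fix k :: "real^'n"
    have "(\<integral>\<^sup>+\<xi>. ennreal (weight \<delta> ((2 * pi / h) *\<^sub>R k + 1 *\<^sub>R \<xi>) * (norm (H ((2 * pi / h) *\<^sub>R k + 1 *\<^sub>R \<xi>)))\<^sup>2) \<partial>lborel) = wsq \<delta> H"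
      unfolding wsq_def
      using nn_integral_lborel_affine[of "\<lambda>x. ennreal (weight \<delta> x * (norm (H x))\<^sup>2)" 1 "(2 * pi / h) *\<^sub>R k"]
      by simp
    then show "(\<integral>\<^sup>+\<xi>. ennreal (T \<xi> k) \<partial>lborel) = wsq \<delta> H"
      unfolding T_def by (simp only: scaleR_one add.commute)
  qed
  also have "ennreal (M * ?p) * (\<Sum>k\<in>(shifts :: (real^'n) set). wsq \<delta> H) = ennreal (M * ?p) * (ennreal K * wsq \<delta> H)"
    by (simp add: K_def ennreal_of_nat_eq_real_of_nat)
  also have "\<dots> = ennreal (M * K * ?p) * wsq \<delta> H"
    unfolding mult.assoc[symmetric] ennreal_mult[OF Mp K, symmetric] by (simp only: mult_ac)
  finally show ?thesis unfolding M_def .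
qed

section \<open>Products and convolutions\<close>

lemma
  fixes F G :: "real^'n \<Rightarrow> complex"
  assumes F: "integrable lborel F" and G: "integrable lborel G"
  shows integrable_conv: "integrable lborel (conv F G)"
    and fint_conv: "fint (conv F G) x = fint F x * fint G x"
proof -
  have [measurable]: "F \<in> borel_measurable borel" "G \<in> borel_measurable borel" using F G by auto
  have norm_int: "(LINT \<xi>|lborel. norm (F \<eta> * G (\<xi> - \<eta>))) = norm (F \<eta>) * (LINT \<xi>|lborel. norm (G \<xi>))" for \<eta>
    using integral_lborel_affine[of "\<lambda>x. norm (G x)" 1 "- \<eta>"] by (simp add: norm_mult)
  have G_shift: "integrable lborel (\<lambda>\<xi>. G (\<xi> - \<eta>))" for \<eta>
    using integrable_lborel_affine[OF G, of 1 "- \<eta>"] by simp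
  have pair: "integrable (lborel \<Otimes>\<^sub>M lborel) (\<lambda>(\<eta>, \<xi>). F \<eta> * G (\<xi> - \<eta>))"
  proof (rule lborel_pair.Fubini_integrable)
    show "integrable lborel (\<lambda>\<eta>. LINT \<xi>|lborel. norm (case (\<eta>, \<xi>) of (\<eta>, \<xi>) \<Rightarrow> F \<eta> * G (\<xi> - \<eta>)))"
      using F by (simp add: norm_int)
    show "AE \<eta> in lborel. integrable lborel (\<lambda>\<xi>. case (\<eta>, \<xi>) of (\<eta>, \<xi>) \<Rightarrow> F \<eta> * G (\<xi> - \<eta>))"
      using G_shift by simp
  qed measurable
  show "integrable lborel (conv F G)"
    unfolding conv_def[abs_def] by (rule lborel_pair.integrable_snd[OF pair])
  have "integrable (lborel \<Otimes>\<^sub>M lborel) (\<lambda>p. (case p of (\<eta>, \<xi>) \<Rightarrow> F \<eta> * G (\<xi> - \<eta>)) * cis (- (snd p \<bullet> x)))"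
    by (rule integrable_mult_cis[OF pair]) measurable
  then have pair': "integrable (lborel \<Otimes>\<^sub>M lborel) (\<lambda>(\<eta>, \<xi>). F \<eta> * G (\<xi> - \<eta>) * cis (- (\<xi> \<bullet> x)))"
    by (simp add: case_prod_unfold)
  let ?h = "\<lambda>\<eta> \<xi>. F \<eta> * G (\<xi> - \<eta>) * cis (- (\<xi> \<bullet> x))" and ?r = "\<lambda>\<eta> \<xi>. F \<eta> * cis (- (\<eta> \<bullet> x)) * (G \<xi> * cis (- (\<xi> \<bullet> x)))"
  have "fint (conv F G) x = (LINT \<xi>|lborel. LINT \<eta>|lborel. ?h \<eta> \<xi>)"
    unfolding fint_def conv_def integral_mult_left_zero[symmetric] ..
  also have "\<dots> = (LINT \<eta>|lborel. LINT \<xi>|lborel. ?h \<eta> \<xi>)"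
    by (rule lborel_pair.Fubini_integral[OF pair'])
  also have "\<dots> = (LINT \<eta>|lborel. F \<eta> * cis (- (\<eta> \<bullet> x)) * fint G x)"
  proof (rule Bochner_Integration.integral_cong[OF refl])
    fix \<eta> :: "real^'n"
    have "(LINT \<xi>|lborel. ?h \<eta> \<xi>)
        = (LINT \<xi>|lborel. ?h \<eta> (\<eta> + 1 *\<^sub>R \<xi>))"
      by (subst integral_lborel_affine[where c = 1 and t = \<eta>]) (simp_all)
    also have "\<dots> = (LINT \<xi>|lborel. ?r \<eta> \<xi>)"
    proof (rule Bochner_Integration.integral_cong[OF refl])
      fix \<xi> :: "real^'n"
      have "cis (- ((\<eta> + \<xi>) \<bullet> x)) = cis (- (\<eta> \<bullet> x)) * cis (- (\<xi> \<bullet> x))"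
        by (simp add: cis_mult inner_add_left)
      then show "?h \<eta> (\<eta> + 1 *\<^sub>R \<xi>) = ?r \<eta> \<xi>"
        by simp
    qed
    finally show "(LINT \<xi>|lborel. ?h \<eta> \<xi>) = F \<eta> * cis (- (\<eta> \<bullet> x)) * fint G x"
      unfolding fint_def integral_mult_right_zero .
  qed
  also have "\<dots> = fint F x * fint G x"
    unfolding fint_def[of F] integral_mult_left_zero ..
  finally show "fint (conv F G) x = fint F x * fint G x" .
qed

text \<open>
  The normalization of the inverse transform contributes one factor \<open>(2\<pi>)^(-n)\<close> too many on the left, which
  the density on the right absorbs.
\<close>

lemma ifint_product:
  fixes F G :: "real^'n \<Rightarrow> complex"
  assumes F: "integrable lborel F" and G: "integrable lborel G"
  shows "ifint F x * ifint G x = ifint (\<lambda>\<xi>. conv F G \<xi> / complex_of_real ((2 * pi) ^ CARD('n))) x"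
proof -
  let ?c = "complex_of_real ((2 * pi) ^ CARD('n))"
  have "fint (\<lambda>\<xi>. conv F G \<xi> / ?c) y = fint (conv F G) y / ?c" for y
    unfolding fint_def by (simp only: times_divide_eq_left integral_divide_zero)
  then show ?thesis unfolding ifint_def fint_conv[OF F G]
    by (simp only: times_divide_times_eq divide_divide_eq_left)
qed

lemma ifint_diff:
  fixes F G :: "real^'n \<Rightarrow> complex"
  assumes F: "integrable lborel F" and G: "integrable lborel G"
  shows "ifint (\<lambda>\<xi>. F \<xi> - G \<xi>) x = ifint F x - ifint G x"
  unfolding ifint_def fint_diff[OF F G] by (rule diff_divide_distrib)

section \<open>Sobolev norms through the transform\<close>

lemma
  fixes u U :: "real^'n \<Rightarrow> complex"
  assumes u: "u \<in> L2_space lborel" and eq: "AE \<xi> in lborel. fourier u \<xi> = U \<xi>" and fin: "wsq s U < \<infinity>"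
  shows sobolev_memI: "u \<in> sobolev s"
    and sobolev_norm_eq: "sobolev_norm s u = sqrt (enn2real (wsq s U) / (2 * pi) ^ CARD('n))"
proof -
  have [measurable]: "fourier u \<in> borel_measurable borel" using fourier_L2_space[OF u] by auto
  have w: "(\<integral>\<^sup>+\<xi>. ennreal (weight s \<xi> * (norm (fourier u \<xi>))\<^sup>2) \<partial>lborel) = wsq s U"
    using wsq_cong_AE[OF eq, of s] unfolding wsq_def .
  have i: "integrable lborel (\<lambda>\<xi>. weight s \<xi> * (norm (fourier u \<xi>))\<^sup>2)"
    by (rule integrableI_nonneg) (use fin w in auto)
  show "u \<in> sobolev s" using u i unfolding sobolev_def weight_def by blast
  have "(LINT \<xi>|lborel. weight s \<xi> * (norm (fourier u \<xi>))\<^sup>2) = enn2real (wsq s U)"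
    unfolding w[symmetric] by (rule integral_eq_nn_integral) auto
  then show "sobolev_norm s u = sqrt (enn2real (wsq s U) / (2 * pi) ^ CARD('n))"
    unfolding sobolev_norm_def weight_def by simp
qed

section \<open>The product estimate\<close>

text \<open>
  Each of the three interpolants is an inverse Fourier integral, so the error is one too: its density is
  the transform of the grid product, which is a periodized convolution on the torus, minus the
  convolution that belongs to the product of the interpolants.
\<close>

theorem shannon_product_error:
  fixes f g :: "real^'n \<Rightarrow> complex"
  assumes h: "0 < h" and \<delta>: "0 \<le> \<delta>" and f: "f \<in> L2_grid h" and g: "g \<in> L2_grid h"
  defines "diff \<equiv> (\<lambda>x. shannon h (\<lambda>a. f a * g a) x - shannon h f x * shannon h g x)"
    and "F \<equiv> on_torus h (dft h f)" and "G \<equiv> on_torus h (dft h g)"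
    and "c \<equiv> (2 * pi) ^ CARD('n)"
  defines "U \<equiv> (\<lambda>\<xi>. on_torus h (\<lambda>\<xi>. periodize h (conv F G) \<xi> / complex_of_real c) \<xi> - conv F G \<xi> / complex_of_real c)"
  assumes fin: "wsq s U < \<infinity>" and fin_conv: "wsq \<delta> (conv F G) < \<infinity>"
  shows "diff \<in> sobolev s" and "sobolev_norm s diff = sqrt (enn2real (wsq s U) / c)"
proof -
  define V where "V = on_torus h (dft h (\<lambda>a. f a * g a))"
  define H where "H \<xi> = conv F G \<xi> / complex_of_real c" for \<xi>
  have F: "F \<in> L2_space lborel" "integrable lborel F"
    unfolding F_def using dft_L2[OF h f] on_torus_integrable by blast+
  have G: "G \<in> L2_space lborel" "integrable lborel G"
    unfolding G_def using dft_L2[OF h g] on_torus_integrable by blast+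
  have V: "V \<in> L2_space lborel" "integrable lborel V"
    unfolding V_def using dft_product(1)[OF h f g] on_torus_integrable by blast+
  have VP: "AE \<xi> in lborel. V \<xi> = on_torus h (\<lambda>\<xi>. periodize h (conv F G) \<xi> / complex_of_real c) \<xi>"
    unfolding V_def F_def G_def c_def by (rule dft_product(2)[OF h f g])
  have [measurable]: "F \<in> borel_measurable borel" "G \<in> borel_measurable borel" using F G by auto
  have conv_L2: "conv F G \<in> L2_space lborel"
    using le_less_trans[OF l2sq_le_wsq[OF \<delta>] fin_conv] by (simp add: L2_space_iff)
  have H_alt: "H = (\<lambda>\<xi>. 1 / complex_of_real c * conv F G \<xi>)" by (simp add: H_def[abs_def])
  have H: "H \<in> L2_space lborel" "integrable lborel H"
    unfolding H_alt by (rule L2_space_cmult[OF conv_L2], rule integrable_mult_right[OF integrable_conv[OF F(2) G(2)]])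
  have VH: "integrable lborel (\<lambda>\<xi>. V \<xi> - H \<xi>)" "(\<lambda>\<xi>. V \<xi> - H \<xi>) \<in> L2_space lborel"
    by (rule Bochner_Integration.integrable_diff[OF V(2) H(2)], rule L2_space_diff[OF V(1) H(1)])
  have sh: "shannon h f = inv_fourier F" "shannon h g = inv_fourier G" "shannon h (\<lambda>a. f a * g a) = inv_fourier V"
    unfolding shannon_def F_def G_def V_def by (rule refl)+
  have diff_eq: "AE x in lborel. diff x = ifint (\<lambda>\<xi>. V \<xi> - H \<xi>) x"
    using inv_fourier_eq_ifint[OF F(2) F(1)] inv_fourier_eq_ifint[OF G(2) G(1)] inv_fourier_eq_ifint[OF V(2) V(1)]
  proof eventually_elim
    case (elim x)
    then show ?case
      unfolding diff_def sh ifint_diff[OF V(2) H(2)]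
      by (simp only: ifint_product[OF F(2) G(2)] H_def[abs_def] c_def)
  qed
  have inv_meas: "inv_fourier F \<in> borel_measurable borel" "inv_fourier G \<in> borel_measurable borel" "inv_fourier V \<in> borel_measurable borel"
    using inv_fourier_L2_space[OF F(2) F(1)] inv_fourier_L2_space[OF G(2) G(1)] inv_fourier_L2_space[OF V(2) V(1)] by auto
  have meas: "diff \<in> borel_measurable borel"
    unfolding diff_def sh using inv_meas by (intro borel_measurable_diff borel_measurable_times)
  have diff_L2: "diff \<in> L2_space lborel"
    using ifint_L2_space[OF VH] meas l2sq_cong_AE[OF diff_eq] by (simp add: L2_space_iff)
  have ifint_meas: "ifint (\<lambda>\<xi>. V \<xi> - H \<xi>) \<in> borel_measurable borel"
    using ifint_L2_space[OF VH] by auto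
  have "fourier diff = fourier (ifint (\<lambda>\<xi>. V \<xi> - H \<xi>))"
    by (rule fourier_cong_AE[OF diff_eq meas ifint_meas])
  then have "AE \<xi> in lborel. fourier diff \<xi> = V \<xi> - H \<xi>"
    using fourier_ifint[OF VH] by simp
  then have fU: "AE \<xi> in lborel. fourier diff \<xi> = U \<xi>"
    using VP by eventually_elim (simp add: U_def H_def)
  show "diff \<in> sobolev s" by (rule sobolev_memI[OF diff_L2 fU fin])
  show "sobolev_norm s diff = sqrt (enn2real (wsq s U) / c)"
    unfolding c_def by (rule sobolev_norm_eq[OF diff_L2 fU fin])
qed

theorem proposition6:
  fixes \<delta> s :: real
  assumes "real CARD('n::finite) / 2 < \<delta>" and "0 \<le> s" and "s \<le> \<delta>"
  shows "\<exists>C>0. \<forall>h>0. \<forall>f \<in> sobolev_grid \<delta> h. \<forall>g \<in> sobolev_grid \<delta> h.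
    (\<lambda>x :: real ^ 'n. shannon h (\<lambda>a. f a * g a) x - shannon h f x * shannon h g x) \<in> sobolev s \<and>
    sobolev_norm s (\<lambda>x. shannon h (\<lambda>a. f a * g a) x - shannon h f x * shannon h g x)
      \<le> C * h powr (\<delta> - s) * sobolev_norm \<delta> (shannon h f) * sobolev_norm \<delta> (shannon h g)"
proof -
  define c where "c = (2 * pi) ^ CARD('n)"
  define K where "K = real (card (shifts :: (real^'n) set))"
  define W where "W = enn2real (\<integral>\<^sup>+\<xi>. ennreal (weight (- \<delta>) (\<xi> :: real^'n)) \<partial>lborel)"
  define C0 where "C0 = (K * real CARD('n) powr s + 1) * K * (4 * (2 powr \<delta>)\<^sup>2 * W)"
  \<comment> \<open>The estimate itself gives \<open>sqrt (C0 * c)\<close>; adding \<open>1\<close> makes the constant positive.\<close>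
  define C where "C = sqrt (C0 * c) + 1"
  have c: "1 \<le> c" unfolding c_def using pi_ge_two by (intro one_le_power) simp
  have K: "0 \<le> K" by (simp add: K_def)
  have W: "0 \<le> W" by (simp add: W_def)
  have W_eq: "(\<integral>\<^sup>+\<xi>. ennreal (weight (- \<delta>) (\<xi> :: real^'n)) \<partial>lborel) = ennreal W"
    unfolding W_def using weight_nn_integral_finite[OF assms(1)] by simp
  have C0: "0 \<le> C0" unfolding C0_def using K W by (intro mult_nonneg_nonneg add_nonneg_nonneg) auto
  have \<delta>0: "0 \<le> \<delta>" using assms by linarith
  let ?d = "\<lambda>h f g x. shannon h (\<lambda>a. f a * g a) x - shannon h f x * shannon h g (x :: real^'n)"
  have main: "(?d h f g) \<in> sobolev s \<and>
    sobolev_norm s (?d h f g)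
      \<le> C * h powr (\<delta> - s) * sobolev_norm \<delta> (shannon h f) * sobolev_norm \<delta> (shannon h g)"
    if h: "0 < h" and fg: "f \<in> sobolev_grid \<delta> h" "g \<in> sobolev_grid \<delta> h" for h and f g :: "real^'n \<Rightarrow> complex"
  proof -
    have f: "f \<in> L2_grid h" and g: "g \<in> L2_grid h" using fg by (auto simp: sobolev_grid_def)
    define F where "F = on_torus h (dft h f)"
    define G where "G = on_torus h (dft h g)"
    have F: "F \<in> L2_space lborel" "integrable lborel F"
      unfolding F_def using dft_L2[OF h f] on_torus_integrable by blast+
    have G: "G \<in> L2_space lborel" "integrable lborel G"
      unfolding G_def using dft_L2[OF h g] on_torus_integrable by blast+
    have meas: "F \<in> borel_measurable borel" "G \<in> borel_measurable borel" using F G by auto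
    define A where "A = enn2real (wsq \<delta> F)"
    define B where "B = enn2real (wsq \<delta> G)"
    have fin: "wsq \<delta> F < \<infinity>" "wsq \<delta> G < \<infinity>"
      using wsq_on_torus_finite[OF h \<delta>0] F(1) G(1) unfolding F_def G_def by blast+
    have AB: "0 \<le> A" "0 \<le> B" "wsq \<delta> F = ennreal A" "wsq \<delta> G = ennreal B"
      unfolding A_def B_def using fin by simp_all
    let ?H = "conv F G"
    let ?U = "\<lambda>\<xi>. on_torus h (\<lambda>\<xi>. periodize h ?H \<xi> / complex_of_real c) \<xi> - ?H \<xi> / complex_of_real c"
    let ?p = "(h powr (\<delta> - s))\<^sup>2"
    have conv: "wsq \<delta> ?H \<le> ennreal (4 * (2 powr \<delta>)\<^sup>2 * W * (A * B))"
    proof -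
      have "wsq \<delta> ?H \<le> 4 * (ennreal (2 powr \<delta>))\<^sup>2 * ennreal W * (ennreal A * ennreal B)"
        using wsq_conv[OF meas \<delta>0] unfolding W_eq AB(3,4) .
      also have "\<dots> = ennreal (4 * (2 powr \<delta>)\<^sup>2 * W * (A * B))"
        using W AB(1,2) by (simp add: ennreal_mult ennreal_power)
      finally show ?thesis .
    qed
    then have fin_conv: "wsq \<delta> ?H < \<infinity>" by (rule le_less_trans) simp
    have U: "wsq s ?U \<le> ennreal (C0 * ?p * (A * B))"
    proof -
      have "wsq s ?U \<le> ennreal ((K * real CARD('n) powr s + 1) * K * ?p) * wsq \<delta> ?H"
        unfolding K_def by (rule aliasing_bound[OF h assms(2,3) c conv_measurable[OF meas]])
      also have "\<dots> \<le> ennreal ((K * real CARD('n) powr s + 1) * K * ?p) * ennreal (4 * (2 powr \<delta>)\<^sup>2 * W * (A * B))"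
        by (intro mult_left_mono conv) simp
      also have "\<dots> = ennreal ((K * real CARD('n) powr s + 1) * K * ?p * (4 * (2 powr \<delta>)\<^sup>2 * W * (A * B)))"
        using K W AB(1,2) by (intro ennreal_mult[symmetric] mult_nonneg_nonneg add_nonneg_nonneg) auto
      also have "(K * real CARD('n) powr s + 1) * K * ?p * (4 * (2 powr \<delta>)\<^sup>2 * W * (A * B)) = C0 * ?p * (A * B)"
        unfolding C0_def by (simp only: mult_ac)
      finally show ?thesis .
    qed
    then have fin_U: "wsq s ?U < \<infinity>" by (rule le_less_trans) simp
    note error = shannon_product_error[OF h \<delta>0 f g, folded F_def G_def c_def, OF fin_U fin_conv]
    have norm_f: "sobolev_norm \<delta> (shannon h f) = sqrt (A / c)"
      unfolding shannon_def F_def[symmetric] A_def c_def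
      by (rule sobolev_norm_eq[OF inv_fourier_L2_space[OF F(2,1)] fourier_inv_fourier[OF F(2,1)] fin(1)])
    have norm_g: "sobolev_norm \<delta> (shannon h g) = sqrt (B / c)"
      unfolding shannon_def G_def[symmetric] B_def c_def
      by (rule sobolev_norm_eq[OF inv_fourier_L2_space[OF G(2,1)] fourier_inv_fourier[OF G(2,1)] fin(2)])
    have "enn2real (wsq s ?U) \<le> C0 * ?p * (A * B)"
      using U C0 AB(1,2) by (intro enn2real_leI) auto
    then have "sqrt (enn2real (wsq s ?U) / c) \<le> sqrt (C0 * ?p * (A * B) / c)"
      using c by (intro real_sqrt_le_mono divide_right_mono) auto
    also have "C0 * ?p * (A * B) / c = (C0 * c) * ?p * ((A / c) * (B / c))"
      using c by (simp add: field_simps)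
    also have "sqrt \<dots> = sqrt (C0 * c) * h powr (\<delta> - s) * (sqrt (A / c) * sqrt (B / c))"
      unfolding real_sqrt_mult by simp
    also have "\<dots> \<le> C * h powr (\<delta> - s) * (sqrt (A / c) * sqrt (B / c))"
      unfolding C_def using AB(1,2) c by (intro mult_right_mono mult_nonneg_nonneg) auto
    finally have "sqrt (enn2real (wsq s ?U) / c) \<le> C * h powr (\<delta> - s) * sobolev_norm \<delta> (shannon h f) * sobolev_norm \<delta> (shannon h g)"
      unfolding norm_f norm_g by (simp only: mult.assoc)
    then show ?thesis using error by simp
  qed
  have "0 < C" unfolding C_def using C0 c by (intro add_nonneg_pos) auto
  then show ?thesis using main by blast
qed

end
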